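(* Let $\lambda,\mu\in X(T)$. If $$\operatorname{Ext}^1_{\mathrm{Dist}(G)}(L(\lambda),L(\mu))\neq 0,$$ then $\mathrm{wt}(\lambda)=\mathrm{wt}(\mu)$.
   Context: **Setting.** $k$ is a field of characteristic $p$ (possibly $p=0$; then $\mathbb Z/p\mathbb Z=\mathbb Z$ and congruence mod $p$ means equality). $V$ is a $k$-superspace ($\mathbb Z_2$-graded space) with $\dim V_{\bar 0}=m$, $\dim V_{\bar 1}=n$, and $v_1,\dots,v_{m+n}$ is a fixed ordered homogeneous basis; $\bar v_i\in\mathbb Z_2$ is the parity of $v_i$. $G=GL(V)$. Let $U_{\mathbb C}$ be the universal enveloping superalgebra of the complex Lie superalgebra with basis $e_{i,j}$ ($1\le i,j\le m+n$), $e_{i,j}$ of parity $\bar v_i+\bar v_j$, and $[e_{i,j},e_{k,l}]=\delta_{j,k}e_{i,l}-(-1)^{(\bar v_i+\bar v_j)(\bar v_k+\bar v_l)}\delta_{i,l}e_{k,j}$. Write $h_i=e_{i,i}$. $U_{\mathbb Z}$ is the $\mathbb Z$-subalgebra generated by the odd $e_{i,j}$, the $e_{i,j}^{(r)}=e_{i,j}^r/r!$ for $i\ne j$, $\bar v_i+\bar v_j=\bar 0$, $r\ge1$, and the $\binom{h_i}{r}$, $r\ge 1$. $\mathrm{Dist}(G)=k\otimes_{\mathbb Z}U_{\mathbb Z}$, a Hopf superalgebra. $\mathrm{Dist}(T)$ is the subalgebra generated by all $\binom{h_i}{r}$, and $\mathrm{Dist}(B)$ the subalgebra generated by $\mathrm{Dist}(T)$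 and all $e_{i,j}^{(a)}$ with $i<j$ ($a\ge0$ if $e_{i,j}$ is even, $a\in\{0,1\}$ if odd). $X(T)=\bigoplus_{i=1}^{m+n}\mathbb Z\varepsilon_i$ with symmetric bilinear form $(\varepsilon_i,\varepsilon_j)=(-1)^{\bar v_i}\delta_{i,j}$. Dominance order: $\lambda\le\mu$ iff $\mu-\lambda$ is a $\mathbb Z_{\ge0}$-combination of the $\varepsilon_i-\varepsilon_j$, $i<j$. $\mathrm{Dist}(G)$-supermodules are $\mathbb Z_2$-graded left modules; morphisms are all linear maps $f$ (not only even ones) with $f(xm)=(-1)^{\bar f\bar x}xf(m)$. For $\lambda=\sum\lambda_i\varepsilon_i$, $M_\lambda=\{m\in M:\binom{h_i}{r}m=\binom{\lambda_i}{r}m\ \forall i,\ r\ge1\}$. $\mathcal O_p$ is the full subcategory of supermodules $M=\bigoplus_\lambda M_\lambda$ with all $M_\lambda$ finite dimensional and all weights contained in a finite union of sets $\{\mu:\mu\le\lambda^{(i)}\}$. All supermodules are assumed to lie in $\mathcal O_p$. $M(\lambda)=\mathrm{Dist}(G)\otimes_{\mathrm{Dist}(B)}k_\lambda$ ($k_\lambda$ one-dimensional of weight $\lambda$ in degree $\bar 0$, on which $e_{i,j}^{(a)}$, $i<j$, $a\geq 1$, act by zero) and $L(\lambda)$ is its unique irreducible quotient. $\operatorname{Ext}^1_{\mathrm{Dist}(G)}(M,N)$ is computed in $\mathcal O_p$: it vanishes iff every short exact sequence $0\to N'\to E\to M\to0$ in $\mathcal O_p$ with even maps, $N'=N$ or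 $N'$ the parity shift $\Pi N$, splits. **Weight function.** $\rho\in X(T)$ is determined by: $(\rho,\varepsilon_{m+n})=1$ if $\bar v_{m+n}=\bar 0$ and $0$ if $\bar v_{m+n}=\bar1$; and for $1\le i\le m+n-1$, $(\rho,\varepsilon_i-\varepsilon_{i+1})$ is $1$ if $\bar v_i=\bar v_{i+1}=\bar0$, $-1$ if $\bar v_i=\bar v_{i+1}=\bar1$, and $0$ if $\bar v_i\ne\bar v_{i+1}$. If $p=0$, $P$ is the free abelian group on $\gamma_a$ ($a\in\mathbb Z$). If $p>0$, $P=\mathbb Z\delta\oplus\bigoplus_{r\in\mathbb Z/p\mathbb Z}\mathbb Z\Lambda_r$, and for $a=pd+s$ with $d\in\mathbb Z$, $s\in\{1,\dots,p\}$, $\gamma_a=\Lambda_s-\Lambda_{s-1}-d\delta$. Then $\mathrm{wt}(\lambda)=\sum_{i=1}^{m+n}(-1)^{\bar v_i}\gamma_{(\lambda+\rho,\varepsilon_i)}\in P$. *)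

theory Defs
  imports Complex_Main "HOL-Library.Poly_Mapping" "HOL-Algebra.Module" "HOL-Algebra.QuotRing"
    "HOL-Algebra.Generated_Rings" "HOL-Algebra.Free_Abelian_Groups"
    "HOL-Algebra.Algebraic_Closure_Type"
begin

text \<open>
  Throughout, \<open>vs :: bool list\<close> is the parity sequence of the ordered homogeneous basis
  \<open>v\<^sub>1, \<dots>, v\<^sub>N\<close> of \<open>V\<close>, where \<open>N = m + n\<close> is the length of \<open>vs\<close>; indices run over \<open>{1..N}\<close>.
  A parity is a \<open>bool\<close>: \<open>False\<close> is even, \<open>True\<close> is odd, and addition of parities is \<open>\<noteq>\<close>.
  The ground field is the type \<open>'k\<close>, of characteristic \<open>CHAR('k)\<close>.
\<close>

definition idx :: "bool list \<Rightarrow> nat set" where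
  "idx vs = {1..length vs}"

definition vbar :: "bool list \<Rightarrow> nat \<Rightarrow> bool" where
  "vbar vs i = vs ! (i - 1)"

definition ebar :: "bool list \<Rightarrow> nat \<Rightarrow> nat \<Rightarrow> bool" where
  "ebar vs i j \<longleftrightarrow> vbar vs i \<noteq> vbar vs j"

definition psgn :: "bool \<Rightarrow> 'a::ring_1" where
  "psgn b = (if b then - 1 else 1)"


section \<open>Superrings and left supermodules\<close>

record 'a superring = "'a ring" +
  ring_part :: "bool \<Rightarrow> 'a set"

text \<open>The inherited fields \<open>mult\<close> and \<open>one\<close> of a supermodule are never used.\<close>

record ('a, 'b) supermodule = "('a, 'b) module" +
  mod_part :: "bool \<Rightarrow> 'b set"

locale left_supermodule = R?: ring R + M?: abelian_group M
  for R :: "'a superring" (structure) and M :: "('a, 'b) supermodule" (structure) +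
  assumes smult_closed:
      "\<lbrakk> a \<in> carrier R; x \<in> carrier M \<rbrakk> \<Longrightarrow> a \<odot>\<^bsub>M\<^esub> x \<in> carrier M"
    and smult_l_distr:
      "\<lbrakk> a \<in> carrier R; b \<in> carrier R; x \<in> carrier M \<rbrakk> \<Longrightarrow>
       (a \<oplus>\<^bsub>R\<^esub> b) \<odot>\<^bsub>M\<^esub> x = a \<odot>\<^bsub>M\<^esub> x \<oplus>\<^bsub>M\<^esub> b \<odot>\<^bsub>M\<^esub> x"
    and smult_r_distr:
      "\<lbrakk> a \<in> carrier R; x \<in> carrier M; y \<in> carrier M \<rbrakk> \<Longrightarrow>
       a \<odot>\<^bsub>M\<^esub> (x \<oplus>\<^bsub>M\<^esub> y) = a \<odot>\<^bsub>M\<^esub> x \<oplus>\<^bsub>M\<^esub> a \<odot>\<^bsub>M\<^esub> y"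
    and smult_assoc:
      "\<lbrakk> a \<in> carrier R; b \<in> carrier R; x \<in> carrier M \<rbrakk> \<Longrightarrow>
       (a \<otimes>\<^bsub>R\<^esub> b) \<odot>\<^bsub>M\<^esub> x = a \<odot>\<^bsub>M\<^esub> (b \<odot>\<^bsub>M\<^esub> x)"
    and smult_one:
      "x \<in> carrier M \<Longrightarrow> \<one>\<^bsub>R\<^esub> \<odot>\<^bsub>M\<^esub> x = x"
    and part_subgroup: "additive_subgroup (mod_part M p) M"
    and part_disjoint: "mod_part M False \<inter> mod_part M True = {\<zero>\<^bsub>M\<^esub>}"
    and part_sum: "x \<in> carrier M \<Longrightarrow>
       \<exists>x0 \<in> mod_part M False. \<exists>x1 \<in> mod_part M True. x = x0 \<oplus>\<^bsub>M\<^esub> x1"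
    and part_smult: "\<lbrakk> a \<in> ring_part R p; x \<in> mod_part M q \<rbrakk> \<Longrightarrow> a \<odot>\<^bsub>M\<^esub> x \<in> mod_part M (p \<noteq> q)"

definition even_hom ::
    "'a superring \<Rightarrow> ('a, 'b) supermodule \<Rightarrow> ('a, 'c) supermodule \<Rightarrow> ('b \<Rightarrow> 'c) \<Rightarrow> bool" where
  "even_hom R M M' f \<longleftrightarrow>
     f \<in> carrier M \<rightarrow> carrier M' \<and>
     (\<forall>x \<in> carrier M. \<forall>y \<in> carrier M. f (x \<oplus>\<^bsub>M\<^esub> y) = f x \<oplus>\<^bsub>M'\<^esub> f y) \<and>
     (\<forall>a \<in> carrier R. \<forall>x \<in> carrier M. f (a \<odot>\<^bsub>M\<^esub> x) = a \<odot>\<^bsub>M'\<^esub> f x) \<and>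
     (\<forall>b. f ` mod_part M b \<subseteq> mod_part M' b)"

definition subsupermodule :: "'a superring \<Rightarrow> ('a, 'b) supermodule \<Rightarrow> 'b set \<Rightarrow> bool" where
  "subsupermodule R M S \<longleftrightarrow>
     additive_subgroup S M \<and>
     (\<forall>a \<in> carrier R. \<forall>x \<in> S. a \<odot>\<^bsub>M\<^esub> x \<in> S) \<and>
     (\<forall>x \<in> S. \<exists>x0 \<in> S \<inter> mod_part M False. \<exists>x1 \<in> S \<inter> mod_part M True. x = x0 \<oplus>\<^bsub>M\<^esub> x1)"

definition irreducible_supermodule :: "'a superring \<Rightarrow> ('a, 'b) supermodule \<Rightarrow> bool" where
  "irreducible_supermodule R M \<longleftrightarrow>
     left_supermodule R M \<and> carrier M \<noteq> {\<zero>\<^bsub>M\<^esub>} \<and>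
     (\<forall>S. subsupermodule R M S \<longrightarrow> S = {\<zero>\<^bsub>M\<^esub>} \<or> S = carrier M)"

definition parity_involution :: "('a, 'b) supermodule \<Rightarrow> 'b \<Rightarrow> 'b" where
  "parity_involution M x =
     (THE y. \<exists>x0 \<in> mod_part M False. \<exists>x1 \<in> mod_part M True.
        x = x0 \<oplus>\<^bsub>M\<^esub> x1 \<and> y = x0 \<ominus>\<^bsub>M\<^esub> x1)"

text \<open>
  Conjugating the action of a homogeneous \<open>x\<close> by the parity involution multiplies it by
  \<open>(- 1)\<^sup>p\<close>, \<open>p\<close> the parity of \<open>x\<close>; with this sign, the identity map is an odd morphism
  from \<open>M\<close> to its parity shift.
\<close>

definition parity_shift :: "('a, 'b) supermodule \<Rightarrow> ('a, 'b) supermodule" where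
  "parity_shift M = M\<lparr>
     module.smult := (\<lambda>x m. parity_involution M (x \<odot>\<^bsub>M\<^esub> parity_involution M m)),
     mod_part := (\<lambda>b. mod_part M (\<not> b))\<rparr>"

definition short_exact ::
    "'a superring \<Rightarrow> ('a, 'b) supermodule \<Rightarrow> ('b \<Rightarrow> 'e) \<Rightarrow> ('a, 'e) supermodule \<Rightarrow>
     ('e \<Rightarrow> 'c) \<Rightarrow> ('a, 'c) supermodule \<Rightarrow> bool" where
  "short_exact R N f E g M \<longleftrightarrow>
     even_hom R N E f \<and> even_hom R E M g \<and> inj_on f (carrier N) \<and>
     f ` carrier N = {x \<in> carrier E. g x = \<zero>\<^bsub>M\<^esub>} \<and> g ` carrier E = carrier M"

definition splits ::
    "'a superring \<Rightarrow> ('a, 'e) supermodule \<Rightarrow> ('e \<Rightarrow> 'c) \<Rightarrow> ('a, 'c) supermodule \<Rightarrow> bool" where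
  "splits R E g M \<longleftrightarrow> (\<exists>s. even_hom R M E s \<and> (\<forall>x \<in> carrier M. g (s x) = x))"


section \<open>Tensor products\<close>

text \<open>
  The tensor product of the right \<open>S\<close>-module \<open>A\<close> and the left \<open>S\<close>-module \<open>C\<close>, with actions
  \<open>ra\<close> and \<open>la\<close>: the free abelian group on \<open>carrier A \<times> carrier C\<close> modulo \<open>tensor_rel\<close>.
\<close>

definition tensor_free ::
    "('x, 'r) ring_scheme \<Rightarrow> ('y, 's) ring_scheme \<Rightarrow> (('x \<times> 'y) \<Rightarrow>\<^sub>0 int) monoid" where
  "tensor_free A C = free_Abelian_group (carrier A \<times> carrier C)"

definition tensor_rel ::
    "('x, 'r) ring_scheme \<Rightarrow> ('y, 's) ring_scheme \<Rightarrow> 'b set \<Rightarrow> ('x \<Rightarrow> 'b \<Rightarrow> 'x) \<Rightarrow> ('b \<Rightarrow> 'y \<Rightarrow> 'y) \<Rightarrow>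
     (('x \<times> 'y) \<Rightarrow>\<^sub>0 int) set" where
  "tensor_rel A C S ra la = generate (tensor_free A C)
     ({frag_of (x \<oplus>\<^bsub>A\<^esub> x', y) - frag_of (x, y) - frag_of (x', y) |
         x x' y. x \<in> carrier A \<and> x' \<in> carrier A \<and> y \<in> carrier C} \<union>
      {frag_of (x, y \<oplus>\<^bsub>C\<^esub> y') - frag_of (x, y) - frag_of (x, y') |
         x y y'. x \<in> carrier A \<and> y \<in> carrier C \<and> y' \<in> carrier C} \<union>
      {frag_of (ra x b, y) - frag_of (x, la b y) |
         x b y. x \<in> carrier A \<and> b \<in> S \<and> y \<in> carrier C})"


section \<open>The universal enveloping superalgebra over the complex numbers\<close>

text \<open>
  Words in the letters \<open>e\<^sub>i\<^sub>,\<^sub>j\<close>, under concatenation. The free associative algebra on the letters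
  consists of the finitely supported functions from words to \<open>complex\<close>, with convolution.
\<close>

datatype word = Word (letters: "(nat \<times> nat) list")

instantiation word :: monoid_add
begin

definition zero_word :: word where "zero_word = Word []"

definition plus_word :: "word \<Rightarrow> word \<Rightarrow> word" where
  "plus_word u v = Word (letters u @ letters v)"

instance
  by standard (auto simp: zero_word_def plus_word_def)

end

type_synonym fa = "word \<Rightarrow>\<^sub>0 complex"

definition word_bar :: "bool list \<Rightarrow> word \<Rightarrow> bool" where
  "word_bar vs w = odd (length (filter (\<lambda>(i, j). ebar vs i j) (letters w)))"

definition free_alg :: "bool list \<Rightarrow> fa ring" where
  "free_alg vs = ring_of_type_algebra
     \<lparr>carrier := {x. \<forall>w \<in> Poly_Mapping.keys x. set (letters w) \<subseteq> idx vs \<times> idx vs}\<rparr>"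

definition free_part :: "bool list \<Rightarrow> bool \<Rightarrow> fa set" where
  "free_part vs b = {x \<in> carrier (free_alg vs). \<forall>w \<in> Poly_Mapping.keys x. word_bar vs w = b}"

definition letter :: "nat \<Rightarrow> nat \<Rightarrow> fa" where
  "letter i j = Poly_Mapping.single (Word [(i, j)]) 1"

definition fa_const :: "complex \<Rightarrow> fa" where
  "fa_const c = Poly_Mapping.single 0 c"

definition lie_bracket :: "bool list \<Rightarrow> nat \<Rightarrow> nat \<Rightarrow> nat \<Rightarrow> nat \<Rightarrow> fa" where
  "lie_bracket vs i j k l =
     (if j = k then letter i l else 0)
     - psgn (ebar vs i j \<and> ebar vs k l) * (if i = l then letter k j else 0)"

definition UC_ideal :: "bool list \<Rightarrow> fa set" where
  "UC_ideal vs = genideal (free_alg vs)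
     {letter i j * letter k l - psgn (ebar vs i j \<and> ebar vs k l) * (letter k l * letter i j)
        - lie_bracket vs i j k l | i j k l. {i, j, k, l} \<subseteq> idx vs}"

definition UC :: "bool list \<Rightarrow> fa set ring" where
  "UC vs = free_alg vs Quot UC_ideal vs"

definition UC_cls :: "bool list \<Rightarrow> fa \<Rightarrow> fa set" where
  "UC_cls vs x = UC_ideal vs +>\<^bsub>free_alg vs\<^esub> x"

definition fa_divpow :: "nat \<Rightarrow> nat \<Rightarrow> nat \<Rightarrow> fa" where
  "fa_divpow i j r = fa_const (1 / fact r) * letter i j ^ r"

definition fa_binom :: "nat \<Rightarrow> nat \<Rightarrow> fa" where
  "fa_binom i r = fa_const (1 / fact r) * prod_list (map (\<lambda>t. letter i i - of_nat t) [0..<r])"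


section \<open>The integral form and the distribution superalgebra\<close>

definition UZ :: "bool list \<Rightarrow> fa set ring" where
  "UZ vs = (UC vs)\<lparr>carrier := generate_ring (UC vs) (UC_cls vs `
     ({letter i j | i j. i \<in> idx vs \<and> j \<in> idx vs \<and> ebar vs i j} \<union>
      {fa_divpow i j r | i j r. i \<in> idx vs \<and> j \<in> idx vs \<and> i \<noteq> j \<and> \<not> ebar vs i j \<and> r \<ge> 1} \<union>
      {fa_binom i r | i r. i \<in> idx vs \<and> r \<ge> 1}))\<rparr>"

definition UZ_part :: "bool list \<Rightarrow> bool \<Rightarrow> fa set set" where
  "UZ_part vs b = carrier (UZ vs) \<inter> UC_cls vs ` free_part vs b"

type_synonym 'k dist = "(('k \<times> fa set) \<Rightarrow>\<^sub>0 int) set"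

definition ground :: "'k::field ring" where
  "ground = ring_of_type_algebra"

definition Dist_free :: "bool list \<Rightarrow> (('k::field \<times> fa set) \<Rightarrow>\<^sub>0 int) monoid" where
  "Dist_free vs = tensor_free ground (UZ vs)"

definition Dist_rel :: "bool list \<Rightarrow> (('k::field \<times> fa set) \<Rightarrow>\<^sub>0 int) set" where
  "Dist_rel vs = tensor_rel ground (UZ vs) (UNIV :: int set)
     (\<lambda>c z. c * of_int z) (\<lambda>z u. add_pow (UZ vs) z u)"

definition Dist_cls :: "bool list \<Rightarrow> (('k::field \<times> fa set) \<Rightarrow>\<^sub>0 int) \<Rightarrow> 'k dist" where
  "Dist_cls vs p = Dist_rel vs #>\<^bsub>Dist_free vs\<^esub> p"

text \<open>The biadditive extension of \<open>(c \<otimes> u) (d \<otimes> v) = c d \<otimes> u v\<close>.\<close>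

definition Dist_free_mult :: "bool list \<Rightarrow> (('k::field \<times> fa set) \<Rightarrow>\<^sub>0 int) \<Rightarrow>
    (('k \<times> fa set) \<Rightarrow>\<^sub>0 int) \<Rightarrow> (('k \<times> fa set) \<Rightarrow>\<^sub>0 int)" where
  "Dist_free_mult vs p q =
     frag_extend (\<lambda>(c, u). frag_extend (\<lambda>(d, v). frag_of (c * d, u \<otimes>\<^bsub>UZ vs\<^esub> v)) q) p"

definition Dist :: "bool list \<Rightarrow> 'k::field dist superring" where
  "Dist vs = \<lparr>
     carrier = carrier (Dist_free vs Mod Dist_rel vs),
     monoid.mult = (\<lambda>P Q. \<Union>p \<in> P. \<Union>q \<in> Q. Dist_cls vs (Dist_free_mult vs p q)),
     monoid.one = Dist_cls vs (frag_of (1, \<one>\<^bsub>UZ vs\<^esub>)),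
     ring.zero = \<one>\<^bsub>Dist_free vs Mod Dist_rel vs\<^esub>,
     ring.add = (\<otimes>\<^bsub>Dist_free vs Mod Dist_rel vs\<^esub>),
     ring_part = (\<lambda>b. Dist_cls vs ` {p. Poly_Mapping.keys p \<subseteq> UNIV \<times> UZ_part vs b})\<rparr>"

text \<open>
  \<open>Dist_scalar\<close> embeds the ground field centrally; this is the \<open>k\<close>-algebra structure of
  \<open>Dist vs\<close> and the \<open>k\<close>-space structure of its modules.
\<close>

definition Dist_scalar :: "bool list \<Rightarrow> 'k::field \<Rightarrow> 'k dist" where
  "Dist_scalar vs c = Dist_cls vs (frag_of (c, \<one>\<^bsub>UZ vs\<^esub>))"

definition Dist_elem :: "bool list \<Rightarrow> fa \<Rightarrow> 'k::field dist" where
  "Dist_elem vs x = Dist_cls vs (frag_of (1, UC_cls vs x))"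

definition Dist_T :: "bool list \<Rightarrow> 'k::field dist set" where
  "Dist_T vs = generate_ring (Dist vs)
     (range (Dist_scalar vs) \<union> {Dist_elem vs (fa_binom i r) | i r. i \<in> idx vs \<and> r \<ge> 1})"

text \<open>The elements \<open>e\<^sub>i\<^sub>,\<^sub>j\<^sup>(\<^sup>a\<^sup>)\<close> with \<open>i < j\<close> and \<open>a \<ge> 1\<close>.\<close>

definition Dist_raising :: "bool list \<Rightarrow> 'k::field dist set" where
  "Dist_raising vs = {Dist_elem vs (fa_divpow i j a) | i j a.
     i \<in> idx vs \<and> j \<in> idx vs \<and> i < j \<and> a \<ge> 1 \<and> (ebar vs i j \<longrightarrow> a = 1)}"

definition Dist_B :: "bool list \<Rightarrow> 'k::field dist superring" where
  "Dist_B vs = (let B = generate_ring (Dist vs) (Dist_T vs \<union> Dist_raising vs) in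
     (Dist vs)\<lparr>carrier := B, ring_part := (\<lambda>b. B \<inter> ring_part (Dist vs) b)\<rparr>)"


section \<open>Weights\<close>

text \<open>\<open>X(T)\<close> is the free abelian group on \<open>idx vs\<close>, with \<open>\<epsilon>\<^sub>i = frag_of i\<close>.\<close>

type_synonym weight = "nat \<Rightarrow>\<^sub>0 int"

definition XT :: "bool list \<Rightarrow> weight set" where
  "XT vs = carrier (free_Abelian_group (idx vs))"

abbreviation eps :: "nat \<Rightarrow> weight" where
  "eps i \<equiv> frag_of i"

definition bform :: "bool list \<Rightarrow> weight \<Rightarrow> weight \<Rightarrow> int" where
  "bform vs lam mu = (\<Sum>i \<in> idx vs. psgn (vbar vs i) * Poly_Mapping.lookup lam i * Poly_Mapping.lookup mu i)"

definition dominance_le :: "bool list \<Rightarrow> weight \<Rightarrow> weight \<Rightarrow> bool" where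
  "dominance_le vs lam mu \<longleftrightarrow> (\<exists>c :: nat \<Rightarrow> nat \<Rightarrow> nat.
     mu - lam = (\<Sum>i \<in> idx vs. \<Sum>j \<in> {j \<in> idx vs. i < j}. frag_cmul (int (c i j)) (eps i - eps j)))"

definition is_rho :: "bool list \<Rightarrow> weight \<Rightarrow> bool" where
  "is_rho vs \<rho> \<longleftrightarrow> \<rho> \<in> XT vs \<and>
     (vs \<noteq> [] \<longrightarrow>
        bform vs \<rho> (eps (length vs)) = (if vbar vs (length vs) then 0 else 1)) \<and>
     (\<forall>i. 1 \<le> i \<and> i < length vs \<longrightarrow>
        bform vs \<rho> (eps i - eps (i + 1)) =
          (if vbar vs i \<noteq> vbar vs (i + 1) then 0 else if vbar vs i then - 1 else 1))"

definition rho :: "bool list \<Rightarrow> weight" where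
  "rho vs = (THE \<rho>. is_rho vs \<rho>)"

lemma bform_eps:
  assumes "i \<in> idx vs"
  shows "bform vs lam (eps i) = psgn (vbar vs i) * Poly_Mapping.lookup lam i"
proof -
  have "bform vs lam (eps i) =
      (\<Sum>t \<in> idx vs. if t = i then psgn (vbar vs i) * Poly_Mapping.lookup lam i else 0)"
    unfolding bform_def by (rule sum.cong) (auto simp: lookup_single when_def)
  then show ?thesis
    using assms by (simp add: idx_def)
qed

lemma bform_diff_right: "bform vs lam (mu - nu) = bform vs lam mu - bform vs lam nu"
  by (simp add: bform_def lookup_minus right_diff_distrib sum_subtractf)

lemma is_rho_unique:
  assumes "is_rho vs \<rho>" "is_rho vs \<rho>'"
  shows "\<rho> = \<rho>'"
proof (rule poly_mapping_eqI)
  fix i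
  let ?n = "length vs"
  have eq: "bform vs \<rho> (eps i) = bform vs \<rho>' (eps i)" if "1 \<le> i" "i \<le> ?n" for i
    using that(2,1)
  proof (induction i rule: inc_induct)
    case base
    then show ?case using assms unfolding is_rho_def by auto
  next
    case (step i)
    then have "bform vs \<rho> (eps i - eps (i + 1)) = bform vs \<rho>' (eps i - eps (i + 1))"
      using assms unfolding is_rho_def by auto
    with step show ?case by (simp add: bform_diff_right)
  qed
  show "Poly_Mapping.lookup \<rho> i = Poly_Mapping.lookup \<rho>' i"
  proof (cases "i \<in> idx vs")
    case True
    then show ?thesis
      using eq[of i] bform_eps[OF True] by (auto simp: idx_def psgn_def split: if_splits)
  next
    case False
    then have "i \<notin> Poly_Mapping.keys \<rho>" "i \<notin> Poly_Mapping.keys \<rho>'"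
      using assms by (auto simp: is_rho_def XT_def)
    then show ?thesis by (simp add: in_keys_iff)
  qed
qed

lemma is_rho_exists: "\<exists>\<rho>. is_rho vs \<rho>"
proof -
  let ?n = "length vs"
  define step :: "nat \<Rightarrow> int" where
    "step i = (if vbar vs i \<noteq> vbar vs (i + 1) then 0 else if vbar vs i then - 1 else 1)" for i
  define c :: "nat \<Rightarrow> int" where
    "c i = (if vbar vs ?n then 0 else 1) + (\<Sum>t \<in> {i..<?n}. step t)" for i
  define \<rho> :: weight where
    "\<rho> = (\<Sum>i \<in> idx vs. Poly_Mapping.single i (psgn (vbar vs i) * c i))"
  have lookup: "Poly_Mapping.lookup \<rho> i = (if i \<in> idx vs then psgn (vbar vs i) * c i else 0)" for i
    by (simp add: \<rho>_def lookup_sum lookup_single when_def idx_def)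
  have form: "bform vs \<rho> (eps i) = c i" if "i \<in> idx vs" for i
    using that by (simp add: bform_eps lookup psgn_def)
  have "\<rho> \<in> XT vs"
    by (auto simp: XT_def in_keys_iff lookup split: if_splits)
  moreover have "bform vs \<rho> (eps ?n) = (if vbar vs ?n then 0 else 1)" if "vs \<noteq> []"
    using that by (subst form) (auto simp: idx_def c_def Suc_le_eq)
  moreover have "bform vs \<rho> (eps i - eps (i + 1)) = step i" if "1 \<le> i" "i < ?n" for i
    using that by (simp add: bform_diff_right form idx_def c_def sum.atLeast_Suc_lessThan)
  ultimately have "is_rho vs \<rho>"
    unfolding is_rho_def step_def by blast
  then show ?thesis by blast
qed

lemma is_rho_rho: "is_rho vs (rho vs)"
proof -
  obtain \<rho> where \<rho>: "is_rho vs \<rho>"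
    using is_rho_exists by blast
  then show ?thesis
    unfolding rho_def by (rule theI) (rule is_rho_unique[OF _ \<rho>])
qed

text \<open>
  Free generators of \<open>P\<close>: the \<open>\<gamma>\<^sub>a\<close> if \<open>p = 0\<close>; \<open>\<delta>\<close> and the \<open>\<Lambda>\<^sub>r\<close> if \<open>p > 0\<close>, where the
  residue class of \<open>r\<close> modulo \<open>p\<close> is represented by \<open>r mod p\<close>.
\<close>

datatype pgen = Gamma int | Delta | Lambda int

definition gam :: "nat \<Rightarrow> int \<Rightarrow> (pgen \<Rightarrow>\<^sub>0 int)" where
  "gam p a =
     (if p = 0 then frag_of (Gamma a)
      else let d = (a - 1) div int p; s = (a - 1) mod int p + 1 in
        frag_of (Lambda (s mod int p)) - frag_of (Lambda ((s - 1) mod int p))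
          - frag_cmul d (frag_of Delta))"

definition wt :: "nat \<Rightarrow> bool list \<Rightarrow> weight \<Rightarrow> (pgen \<Rightarrow>\<^sub>0 int)" where
  "wt p vs lam = (\<Sum>i \<in> idx vs. frag_cmul (psgn (vbar vs i)) (gam p (bform vs (lam + rho vs) (eps i))))"


section \<open>The category O, Verma modules and irreducible modules\<close>

text \<open>
  The division is exact. (The constraint that \<open>Complex_Main\<close> puts on \<^const>\<open>gbinomial\<close> excludes \<open>int\<close>.)
\<close>

definition int_binom :: "int \<Rightarrow> nat \<Rightarrow> int" where
  "int_binom z r = (\<Prod>t = 0..<r. z - int t) div fact r"

definition binom_acts ::
    "bool list \<Rightarrow> ('k::field dist, 'b) supermodule \<Rightarrow> weight \<Rightarrow> 'b \<Rightarrow> bool" where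
  "binom_acts vs M lam x \<longleftrightarrow> (\<forall>i \<in> idx vs. \<forall>r \<ge> 1.
     Dist_elem vs (fa_binom i r) \<odot>\<^bsub>M\<^esub> x =
       Dist_scalar vs (of_int (int_binom (Poly_Mapping.lookup lam i) r)) \<odot>\<^bsub>M\<^esub> x)"

definition weight_space ::
    "bool list \<Rightarrow> ('k::field dist, 'b) supermodule \<Rightarrow> weight \<Rightarrow> 'b set" where
  "weight_space vs M lam = {x \<in> carrier M. binom_acts vs M lam x}"

definition fin_dim :: "bool list \<Rightarrow> ('k::field dist, 'b) supermodule \<Rightarrow> 'b set \<Rightarrow> bool" where
  "fin_dim vs M W \<longleftrightarrow> (\<exists>B. finite B \<and> B \<subseteq> W \<and>
     (\<forall>x \<in> W. \<exists>c :: 'b \<Rightarrow> 'k. x = (\<Oplus>\<^bsub>M\<^esub>b \<in> B. Dist_scalar vs (c b) \<odot>\<^bsub>M\<^esub> b)))"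

definition in_O :: "bool list \<Rightarrow> ('k::field dist, 'b) supermodule \<Rightarrow> bool" where
  "in_O vs M \<longleftrightarrow>
     left_supermodule (Dist vs) M \<and>
     (\<forall>x \<in> carrier M. \<exists>!f. (\<forall>lam \<in> XT vs. f lam \<in> weight_space vs M lam) \<and>
        (\<forall>lam. lam \<notin> XT vs \<longrightarrow> f lam = \<zero>\<^bsub>M\<^esub>) \<and> finite {lam. f lam \<noteq> \<zero>\<^bsub>M\<^esub>} \<and>
        x = (\<Oplus>\<^bsub>M\<^esub>lam \<in> {lam. f lam \<noteq> \<zero>\<^bsub>M\<^esub>}. f lam)) \<and>
     (\<forall>lam \<in> XT vs. fin_dim vs M (weight_space vs M lam)) \<and>
     (\<exists>F. finite F \<and> F \<subseteq> XT vs \<and>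
        (\<forall>mu \<in> XT vs. weight_space vs M mu \<noteq> {\<zero>\<^bsub>M\<^esub>} \<longrightarrow> (\<exists>lam \<in> F. dominance_le vs mu lam)))"

definition is_k_lambda :: "bool list \<Rightarrow> weight \<Rightarrow> ('k::field dist, 'w) supermodule \<Rightarrow> bool" where
  "is_k_lambda vs lam W \<longleftrightarrow>
     left_supermodule (Dist_B vs) W \<and>
     (\<exists>w \<in> carrier W. w \<noteq> \<zero>\<^bsub>W\<^esub> \<and> carrier W = range (\<lambda>c. Dist_scalar vs c \<odot>\<^bsub>W\<^esub> w)) \<and>
     mod_part W False = carrier W \<and>
     (\<forall>w \<in> carrier W. binom_acts vs W lam w \<and> (\<forall>x \<in> Dist_raising vs. x \<odot>\<^bsub>W\<^esub> w = \<zero>\<^bsub>W\<^esub>))"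

text \<open>
  \<open>Verma vs W\<close> is the tensor product over \<open>Dist_B vs\<close> of \<open>Dist vs\<close> with the
  \<open>Dist_B vs\<close>-supermodule \<open>W\<close>; \<open>M(\<lambda>)\<close> is the case \<open>is_k_lambda vs lam W\<close>.
\<close>

definition Verma_free ::
    "bool list \<Rightarrow> ('k::field dist, 'w) supermodule \<Rightarrow> (('k dist \<times> 'w) \<Rightarrow>\<^sub>0 int) monoid" where
  "Verma_free vs W = tensor_free (Dist vs) W"

definition Verma_rel ::
    "bool list \<Rightarrow> ('k::field dist, 'w) supermodule \<Rightarrow> (('k dist \<times> 'w) \<Rightarrow>\<^sub>0 int) set" where
  "Verma_rel vs W = tensor_rel (Dist vs) W (carrier (Dist_B vs)) (\<otimes>\<^bsub>Dist vs\<^esub>) (\<odot>\<^bsub>W\<^esub>)"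

definition Verma_cls ::
    "bool list \<Rightarrow> ('k::field dist, 'w) supermodule \<Rightarrow> (('k dist \<times> 'w) \<Rightarrow>\<^sub>0 int) \<Rightarrow>
     (('k dist \<times> 'w) \<Rightarrow>\<^sub>0 int) set" where
  "Verma_cls vs W p = Verma_rel vs W #>\<^bsub>Verma_free vs W\<^esub> p"

definition Verma ::
    "bool list \<Rightarrow> ('k::field dist, 'w) supermodule \<Rightarrow>
     ('k dist, (('k dist \<times> 'w) \<Rightarrow>\<^sub>0 int) set) supermodule" where
  "Verma vs W = \<lparr>
     carrier = carrier (Verma_free vs W Mod Verma_rel vs W),
     monoid.mult = undefined,
     monoid.one = undefined,
     ring.zero = \<one>\<^bsub>Verma_free vs W Mod Verma_rel vs W\<^esub>,
     ring.add = (\<otimes>\<^bsub>Verma_free vs W Mod Verma_rel vs W\<^esub>),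
     module.smult = (\<lambda>y P. \<Union>p \<in> P. Verma_cls vs W
       (frag_extend (\<lambda>(x, w). frag_of (y \<otimes>\<^bsub>Dist vs\<^esub> x, w)) p)),
     mod_part = (\<lambda>b. Verma_cls vs W ` {p. Poly_Mapping.keys p \<subseteq>
       (\<Union>c. ring_part (Dist vs) c \<times> mod_part W (b \<noteq> c))})\<rparr>"

text \<open>
  \<open>L\<close> is a model, on an arbitrary carrier, of \<open>L(\<lambda>)\<close>: an irreducible quotient of \<open>M(\<lambda>)\<close>.
  Every \<open>k\<^sub>\<lambda>\<close> has a copy with carrier in \<open>'k\<close>, so the type of \<open>W\<close> is no restriction.
\<close>

definition is_L :: "bool list \<Rightarrow> weight \<Rightarrow> ('k::field dist, 'b) supermodule \<Rightarrow> bool" where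
  "is_L vs lam L \<longleftrightarrow>
     irreducible_supermodule (Dist vs) L \<and>
     (\<exists>(W :: ('k dist, 'k) supermodule) \<pi>. is_k_lambda vs lam W \<and>
        even_hom (Dist vs) (Verma vs W) L \<pi> \<and> \<pi> ` carrier (Verma vs W) = carrier L)"

text \<open>
  Vanishing of \<open>Ext\<^sup>1(M, N)\<close> in the category \<open>O\<close>, tested on the extensions \<open>E\<close> with carrier in \<open>'e\<close>.
  As HOL cannot quantify over types inside a definition, \<open>'e\<close> is a parameter; any extension
  has a copy with carrier in \<open>'b \<times> 'c\<close>.
\<close>

definition Ext1_vanishes ::
    "'e itself \<Rightarrow> bool list \<Rightarrow> ('k::field dist, 'b) supermodule \<Rightarrow> ('k dist, 'c) supermodule \<Rightarrow> bool"
where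
  "Ext1_vanishes _ vs M N \<longleftrightarrow>
     (\<forall>N' \<in> {N, parity_shift N}. \<forall>(E :: ('k dist, 'e) supermodule) f g.
        in_O vs N' \<and> in_O vs E \<and> in_O vs M \<and> short_exact (Dist vs) N' f E g M \<longrightarrow>
        splits (Dist vs) E g M)"

end

theory Submission
  imports Defs "HOL-Computational_Algebra.Polynomial_FPS"
begin

text \<open>
  A central even element \<open>z\<close> of \<open>Dist(G)\<close> acts by a scalar on each irreducible highest weight module.
  If it acts by \<open>c\<close> on \<open>L(\<lambda>)\<close> and by \<open>d \<noteq> c\<close> on \<open>L(\<mu>)\<close>, then \<open>(z - d) / (c - d)\<close> splits every
  extension. It therefore suffices to have enough central elements.
  The Gelfand invariants (supertraces of the powers of the matrix \<open>(\<sigma>\<^sub>i e\<^sub>i\<^sub>,\<^sub>j)\<close>, \<open>\<sigma>\<^sub>i\<close> the sign of \<open>v\<^sub>i\<close>)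
  have eigenvalues \<open>\<chi>\<^sub>r\<close> with \<open>1 - \<Sum>\<^sub>r \<chi>\<^sub>r t\<^sup>r\<^sup>+\<^sup>1 = \<Prod>\<^sub>i (1 - (a\<^sub>i + \<sigma>\<^sub>i) t) / (1 - a\<^sub>i t)\<close>, where
  \<open>a\<^sub>i = \<sigma>\<^sub>i \<lambda>\<^sub>i + \<Sum>\<^sub>k\<^sub>>\<^sub>i \<sigma>\<^sub>k\<close>. The zeros and poles determine the numbers of indices \<open>i\<close>, counted with
  sign, for which \<open>(\<lambda> + \<rho>, \<epsilon>\<^sub>i)\<close> lies in a given residue class modulo \<open>p\<close>.
  The elements \<open>binom (h\<^sub>1 + \<dots> + h\<^sub>N) r\<close> are central too, and their eigenvalues in \<open>k\<close> determine
  the integer \<open>\<Sum>\<^sub>i \<lambda>\<^sub>i\<close>, which for \<open>p > 0\<close> fixes the coefficient of \<open>\<delta>\<close>.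
\<close>

section \<open>The free algebra and its quotient\<close>

text \<open>All eigenvalues lie in \<open>k\<close>. For p > 0, power sums would give multiplicities
  only modulo p, and h_1 + ... + h_N alone would give the sum of the lambda_i only modulo p.
  Generating functions avoid both losses: a product of linear factors over a field determines its
  roots with integer multiplicities, and the series with coefficients binom(a, r), even reduced to
  \<open>k\<close>, determines the integer a. Index i contributes a zero and a pole whose parameters
  differ by 1, so the product formula compares signed counts only at neighbouring residues c and c +
  1; a normalisation has to remove the remaining constant. The total weight governs delta because p
  times the coefficient of delta in gamma_b is -b plus a function of b mod p, while the signed sum
  of the (lambda + rho, eps_i) is the sum of the lambda_i plus a term independent of lambda.
  Commutation identities are proved over the complex numbers, where dividing by r! is harmless.
  Membership in U_Z, established separately, then carries the central elements to Dist(G).\<close>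

lemma psgn_mult_self [simp]: "psgn a * psgn a = (1 :: 'a::ring_1)"
  by (simp add: psgn_def)

lemma free_alg_simps [simp]:
  "x \<otimes>\<^bsub>free_alg vs\<^esub> y = x * y"
  "x \<oplus>\<^bsub>free_alg vs\<^esub> y = x + y"
  "\<zero>\<^bsub>free_alg vs\<^esub> = 0"
  "\<one>\<^bsub>free_alg vs\<^esub> = 1"
  by (simp_all add: free_alg_def ring_of_type_algebra_def)

lemma carrier_free_alg:
  "carrier (free_alg vs) = {x. \<forall>w \<in> Poly_Mapping.keys x. set (letters w) \<subseteq> idx vs \<times> idx vs}"
  by (simp add: free_alg_def)

lemma free_alg_zero: "0 \<in> carrier (free_alg vs)"
  by (simp add: carrier_free_alg)

lemma free_alg_const: "fa_const c \<in> carrier (free_alg vs)"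
  by (auto simp: carrier_free_alg fa_const_def zero_word_def)

lemma fa_const_1 [simp]: "fa_const 1 = 1"
  by (simp add: fa_const_def)

lemma free_alg_one: "1 \<in> carrier (free_alg vs)"
  using free_alg_const[of 1] by simp

lemma free_alg_add:
  "x \<in> carrier (free_alg vs) \<Longrightarrow> y \<in> carrier (free_alg vs) \<Longrightarrow> x + y \<in> carrier (free_alg vs)"
  using keys_add[of x y] by (auto simp: carrier_free_alg)

lemma free_alg_uminus: "x \<in> carrier (free_alg vs) \<Longrightarrow> - x \<in> carrier (free_alg vs)"
  by (auto simp: carrier_free_alg in_keys_iff)

lemma free_alg_diff:
  "x \<in> carrier (free_alg vs) \<Longrightarrow> y \<in> carrier (free_alg vs) \<Longrightarrow> x - y \<in> carrier (free_alg vs)"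
  using free_alg_add[of x vs "- y"] free_alg_uminus[of y vs] by simp

lemma free_alg_mult:
  "x \<in> carrier (free_alg vs) \<Longrightarrow> y \<in> carrier (free_alg vs) \<Longrightarrow> x * y \<in> carrier (free_alg vs)"
  using keys_mult[of x y] by (fastforce simp: carrier_free_alg plus_word_def)

lemma free_alg_letter:
  "i \<in> idx vs \<Longrightarrow> j \<in> idx vs \<Longrightarrow> letter i j \<in> carrier (free_alg vs)"
  by (auto simp: carrier_free_alg letter_def)

lemma free_alg_of_nat: "of_nat n \<in> carrier (free_alg vs)"
  by (induction n) (auto intro: free_alg_add free_alg_zero free_alg_one)

lemma free_alg_psgn: "psgn b \<in> carrier (free_alg vs)"
  by (auto simp: psgn_def intro: free_alg_one free_alg_uminus)

lemma free_alg_sum: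
  "(\<And>t. t \<in> T \<Longrightarrow> f t \<in> carrier (free_alg vs)) \<Longrightarrow> sum f T \<in> carrier (free_alg vs)"
  by (induction T rule: infinite_finite_induct) (auto intro: free_alg_zero free_alg_add)

lemma free_alg_power: "x \<in> carrier (free_alg vs) \<Longrightarrow> x ^ n \<in> carrier (free_alg vs)"
  by (induction n) (auto intro: free_alg_one free_alg_mult)

lemma free_alg_prod_list:
  "(\<And>x. x \<in> set xs \<Longrightarrow> x \<in> carrier (free_alg vs)) \<Longrightarrow> prod_list xs \<in> carrier (free_alg vs)"
  by (induction xs) (auto intro: free_alg_one free_alg_mult)

lemma free_alg_divpow:
  "i \<in> idx vs \<Longrightarrow> j \<in> idx vs \<Longrightarrow> fa_divpow i j r \<in> carrier (free_alg vs)"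
  unfolding fa_divpow_def by (intro free_alg_mult free_alg_const free_alg_power free_alg_letter)

lemma free_alg_binom: "i \<in> idx vs \<Longrightarrow> fa_binom i r \<in> carrier (free_alg vs)"
  unfolding fa_binom_def
  by (intro free_alg_mult free_alg_const free_alg_prod_list)
    (auto intro!: free_alg_diff free_alg_letter free_alg_of_nat)

lemmas free_alg_intros = free_alg_zero free_alg_one free_alg_const free_alg_add free_alg_uminus
  free_alg_diff free_alg_mult free_alg_letter free_alg_of_nat free_alg_psgn free_alg_sum
  free_alg_divpow free_alg_binom

lemma ring_free_alg: "ring (free_alg vs)"
proof (rule ringI)
  show "abelian_group (free_alg vs)"
    by (rule abelian_groupI)
      (auto simp: algebra_simps free_alg_intros intro!: bexI[of _ "- x" for x])
  show "monoid (free_alg vs)"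
    by (rule monoidI) (auto simp: algebra_simps free_alg_intros)
qed (auto simp: algebra_simps)

interpretation free_alg: ring "free_alg vs" for vs
  by (rule ring_free_alg)

lemma free_alg_a_inv [simp]: "x \<in> carrier (free_alg vs) \<Longrightarrow> \<ominus>\<^bsub>free_alg vs\<^esub> x = - x"
  by (rule free_alg.minus_equality) (auto intro: free_alg_uminus)

text \<open>A word is a product of letters, and its coefficient can be carried along to the empty
  word, where it becomes a constant. This induction reduces centrality to commutation with the
  letters.\<close>

lemma free_alg_span:
  assumes "x \<in> carrier (free_alg vs)"
    and const: "\<And>c. P (fa_const c)"
    and letter: "\<And>i j. i \<in> idx vs \<Longrightarrow> j \<in> idx vs \<Longrightarrow> P (letter i j)"
    and add: "\<And>x y. x \<in> carrier (free_alg vs) \<Longrightarrow> y \<in> carrier (free_alg vs) \<Longrightarrow>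
      P x \<Longrightarrow> P y \<Longrightarrow> P (x + y)"
    and mult: "\<And>x y. x \<in> carrier (free_alg vs) \<Longrightarrow> y \<in> carrier (free_alg vs) \<Longrightarrow>
      P x \<Longrightarrow> P y \<Longrightarrow> P (x * y)"
  shows "P x"
proof -
  have word: "P (Poly_Mapping.single (Word l) c)" if "set l \<subseteq> idx vs \<times> idx vs" for l c
    using that
  proof (induction l)
    case Nil
    then show ?case
      using const[of c] by (simp add: fa_const_def zero_word_def)
  next
    case (Cons a l)
    obtain i j where a: "a = (i, j)" by fastforce
    have eq: "Poly_Mapping.single (Word (a # l)) c = letter i j * Poly_Mapping.single (Word l) c"
      by (simp add: letter_def mult_single plus_word_def a)
    have "P (letter i j)"
      using Cons.prems a by (auto intro: letter)
    then show ?case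
      unfolding eq using Cons a
      by (intro mult) (use free_alg_letter[of i vs j] in \<open>auto simp: carrier_free_alg\<close>)
  qed
  have "P y" if "Poly_Mapping.keys y \<subseteq> W" "finite W"
    "\<forall>w \<in> W. set (letters w) \<subseteq> idx vs \<times> idx vs" for y W
    using that(2,1,3)
  proof (induction W arbitrary: y rule: finite_induct)
    case empty
    then show ?case using const[of 0] by (simp add: fa_const_def)
  next
    case (insert w W)
    define c where "c = Poly_Mapping.lookup y w"
    define y' where "y' = y - Poly_Mapping.single w c"
    have keys: "Poly_Mapping.keys y' \<subseteq> W"
    proof
      fix v assume "v \<in> Poly_Mapping.keys y'"
      then have "Poly_Mapping.lookup y v - (if v = w then c else 0) \<noteq> 0"
        by (simp add: y'_def in_keys_iff lookup_minus lookup_single when_def split: if_splits)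
      then have "v \<noteq> w" "v \<in> Poly_Mapping.keys y"
        by (auto simp: c_def in_keys_iff split: if_splits)
      then show "v \<in> W" using insert.prems by auto
    qed
    then have y': "P y'"
      using insert by auto
    have w: "P (Poly_Mapping.single w c)"
      using word[of "letters w" c] insert.prems by auto
    have "P (y' + Poly_Mapping.single w c)"
      using keys insert.prems by (intro add y' w) (auto simp: carrier_free_alg)
    then show ?case by (simp add: y'_def)
  qed
  then show ?thesis
    using assms(1) finite_keys[of x] unfolding carrier_free_alg by blast
qed

section \<open>Congruence modulo the relations of the enveloping superalgebra\<close>

definition UC_gens :: "bool list \<Rightarrow> fa set" where
  "UC_gens vs = {letter i j * letter k l - psgn (ebar vs i j \<and> ebar vs k l) * (letter k l * letter i j)
     - lie_bracket vs i j k l | i j k l. {i, j, k, l} \<subseteq> idx vs}"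

lemma lie_bracket_closed: "{i, j, k, l} \<subseteq> idx vs \<Longrightarrow> lie_bracket vs i j k l \<in> carrier (free_alg vs)"
  unfolding lie_bracket_def by (intro free_alg_diff free_alg_mult free_alg_psgn)
    (auto intro: free_alg_intros)

lemma UC_gens_closed: "UC_gens vs \<subseteq> carrier (free_alg vs)"
  by (auto simp: UC_gens_def intro!: free_alg_intros lie_bracket_closed)

lemma ideal_UC: "ideal (UC_ideal vs) (free_alg vs)"
  unfolding UC_ideal_def using free_alg.genideal_ideal[OF UC_gens_closed] by (simp add: UC_gens_def)

text \<open>Calculating with representatives under this congruence keeps the type class arithmetic
  of the free algebra, which the carrier-based quotient ring does not offer.\<close>

definition ueq :: "bool list \<Rightarrow> fa \<Rightarrow> fa \<Rightarrow> bool" where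
  "ueq vs x y \<longleftrightarrow> x - y \<in> UC_ideal vs"

lemma UC_ideal_zero: "0 \<in> UC_ideal vs"
  using additive_subgroup.zero_closed[OF ideal.axioms(1)[OF ideal_UC]] by simp

lemma UC_ideal_add: "x \<in> UC_ideal vs \<Longrightarrow> y \<in> UC_ideal vs \<Longrightarrow> x + y \<in> UC_ideal vs"
  using additive_subgroup.a_closed[OF ideal.axioms(1)[OF ideal_UC]] by simp

lemma UC_ideal_closed: "x \<in> UC_ideal vs \<Longrightarrow> x \<in> carrier (free_alg vs)"
  using ideal.Icarr[OF ideal_UC] by simp

lemma UC_ideal_uminus: "x \<in> UC_ideal vs \<Longrightarrow> - x \<in> UC_ideal vs"
  using additive_subgroup.a_inv_closed[OF ideal.axioms(1)[OF ideal_UC], of x vs] UC_ideal_closed[of x vs] by simp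

lemma ueq_refl [intro, simp]: "ueq vs x x"
  by (simp add: ueq_def UC_ideal_zero)

lemma ueq_sym: "ueq vs x y \<Longrightarrow> ueq vs y x"
  unfolding ueq_def using UC_ideal_uminus[of "x - y" vs] by simp

lemma ueq_trans [trans]: "ueq vs x y \<Longrightarrow> ueq vs y z \<Longrightarrow> ueq vs x z"
  unfolding ueq_def using UC_ideal_add[of "x - y" vs "y - z"] by simp

lemma ueq_eq_trans [trans]: "ueq vs x y \<Longrightarrow> y = z \<Longrightarrow> ueq vs x z"
  by simp

lemma eq_ueq_trans [trans]: "x = y \<Longrightarrow> ueq vs y z \<Longrightarrow> ueq vs x z"
  by simp

lemma ueq_add: "ueq vs x y \<Longrightarrow> ueq vs x' y' \<Longrightarrow> ueq vs (x + x') (y + y')"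
  unfolding ueq_def using UC_ideal_add[of "x - y" vs "x' - y'"] by (simp add: algebra_simps)

lemma ueq_uminus: "ueq vs x y \<Longrightarrow> ueq vs (- x) (- y)"
  unfolding ueq_def using UC_ideal_uminus[of "x - y" vs] by simp

lemma ueq_diff: "ueq vs x y \<Longrightarrow> ueq vs x' y' \<Longrightarrow> ueq vs (x - x') (y - y')"
  using ueq_add[of vs x y "- x'" "- y'"] ueq_uminus[of vs x' y'] by simp

lemma ueq_lmult: "ueq vs x y \<Longrightarrow> z \<in> carrier (free_alg vs) \<Longrightarrow> ueq vs (z * x) (z * y)"
  unfolding ueq_def using ideal.I_l_closed[OF ideal_UC, of "x - y" vs z] by (simp add: algebra_simps)

lemma ueq_rmult: "ueq vs x y \<Longrightarrow> z \<in> carrier (free_alg vs) \<Longrightarrow> ueq vs (x * z) (y * z)"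
  unfolding ueq_def using ideal.I_r_closed[OF ideal_UC, of "x - y" vs z] by (simp add: algebra_simps)

lemma ueq_sum: "(\<And>t. t \<in> T \<Longrightarrow> ueq vs (f t) (g t)) \<Longrightarrow> ueq vs (sum f T) (sum g T)"
  by (induction T rule: infinite_finite_induct) (auto intro: ueq_add)

lemma ueq_letter:
  assumes "{i, j, k, l} \<subseteq> idx vs"
  shows "ueq vs (letter i j * letter k l)
    (psgn (ebar vs i j \<and> ebar vs k l) * (letter k l * letter i j) + lie_bracket vs i j k l)"
proof -
  have "letter i j * letter k l - psgn (ebar vs i j \<and> ebar vs k l) * (letter k l * letter i j)
    - lie_bracket vs i j k l \<in> UC_gens vs"
    using assms unfolding UC_gens_def by blast
  then have "letter i j * letter k l - psgn (ebar vs i j \<and> ebar vs k l) * (letter k l * letter i j)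
    - lie_bracket vs i j k l \<in> UC_ideal vs"
    using free_alg.genideal_self[OF UC_gens_closed] unfolding UC_ideal_def UC_gens_def by blast
  then show ?thesis
    by (simp add: ueq_def algebra_simps)
qed

lemma ring_UC: "ring (UC vs)"
  unfolding UC_def by (rule ideal.quotient_is_ring[OF ideal_UC])

interpretation UC: ring "UC vs" for vs
  by (rule ring_UC)

lemma UC_cls_hom: "UC_cls vs \<in> ring_hom (free_alg vs) (UC vs)"
  using ideal.rcos_ring_hom[OF ideal_UC, of vs] unfolding UC_def UC_cls_def[abs_def] .

lemma UC_cls_mult: "x \<in> carrier (free_alg vs) \<Longrightarrow> y \<in> carrier (free_alg vs) \<Longrightarrow>
    UC_cls vs (x * y) = UC_cls vs x \<otimes>\<^bsub>UC vs\<^esub> UC_cls vs y"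
  using ring_hom_mult[OF UC_cls_hom] by simp

lemma UC_cls_add: "x \<in> carrier (free_alg vs) \<Longrightarrow> y \<in> carrier (free_alg vs) \<Longrightarrow>
    UC_cls vs (x + y) = UC_cls vs x \<oplus>\<^bsub>UC vs\<^esub> UC_cls vs y"
  using ring_hom_add[OF UC_cls_hom] by simp

lemma UC_cls_one: "UC_cls vs 1 = \<one>\<^bsub>UC vs\<^esub>"
  using ring_hom_one[OF UC_cls_hom] by simp

lemma UC_cls_closed: "x \<in> carrier (free_alg vs) \<Longrightarrow> UC_cls vs x \<in> carrier (UC vs)"
  using ring_hom_closed[OF UC_cls_hom] .

lemma UC_cls_uminus:
  assumes "x \<in> carrier (free_alg vs)"
  shows "UC_cls vs (- x) = \<ominus>\<^bsub>UC vs\<^esub> UC_cls vs x"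
proof -
  interpret h: ring_hom_ring "free_alg vs" "UC vs" "UC_cls vs"
    using UC_cls_hom by (simp add: ring_hom_ring_axioms_def ring_hom_ring_def ring_free_alg ring_UC)
  show ?thesis using h.hom_a_inv[OF assms] assms by simp
qed

lemma carrier_UC: "carrier (UC vs) = UC_cls vs ` carrier (free_alg vs)"
  by (auto simp: UC_def UC_cls_def FactRing_def A_RCOSETS_def')

lemma UC_cls_cong:
  assumes "ueq vs x y" "x \<in> carrier (free_alg vs)" "y \<in> carrier (free_alg vs)"
  shows "UC_cls vs x = UC_cls vs y"
proof -
  have "x \<in> UC_ideal vs +>\<^bsub>free_alg vs\<^esub> y"
    using assms(1) unfolding ueq_def a_r_coset_def' by (auto intro!: bexI[of _ "x - y"])
  then show ?thesis
    unfolding UC_cls_def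
    using free_alg.a_repr_independence[OF _ assms(3) additive_subgroup.a_subgroup[OF ideal.axioms(1)[OF ideal_UC]]]
    by metis
qed

section \<open>Central elements\<close>

lemma fa_const_mult: "fa_const c * fa_const d = fa_const (c * d)"
  by (simp add: fa_const_def mult_single)

lemma fa_const_of_nat: "of_nat n = fa_const (of_nat n)"
  by (simp add: fa_const_def)

lemma fa_const_commute: "fa_const c * x = x * fa_const c"
proof (induction x rule: update_induct)
  case const
  show ?case by simp
next
  case (update f w b)
  have "Poly_Mapping.update w b f = f + Poly_Mapping.single w b"
    using update(1)
    by (intro poly_mapping_eqI)
      (auto simp: lookup_update lookup_add lookup_single when_def in_keys_iff)
  moreover have "fa_const c * Poly_Mapping.single w b = Poly_Mapping.single w b * fa_const c"
    by (simp add: fa_const_def mult_single mult.commute)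
  ultimately show ?case
    using update(3) by (simp add: distrib_left distrib_right)
qed

text \<open>With A the matrix (sigma_i e_ij), this is sigma_i times the (i, j) entry of A^r. The
  extra sign makes the first power equal to e_ij itself and gives the entries of every power the
  same bracket with e_ab as the letters have.\<close>

fun Epow :: "bool list \<Rightarrow> nat \<Rightarrow> nat \<Rightarrow> nat \<Rightarrow> fa" where
  "Epow vs 0 i j = (if i = j then psgn (vbar vs i) else 0)"
| "Epow vs (Suc r) i j = (\<Sum>k \<in> idx vs. psgn (vbar vs k) * (letter i k * Epow vs r k j))"

text \<open>The value of \<open>lie_bracket vs a b i j\<close> with each letter that it produces
  replaced by the corresponding entry of the r-th power.\<close>

definition Ebr :: "bool list \<Rightarrow> nat \<Rightarrow> nat \<Rightarrow> nat \<Rightarrow> nat \<Rightarrow> nat \<Rightarrow> fa" where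
  "Ebr vs r a b i j = (if b = i then Epow vs r a j else 0)
     - psgn (ebar vs a b \<and> ebar vs i j) * (if a = j then Epow vs r i b else 0)"

lemma finite_idx [simp]: "finite (idx vs)"
  by (simp add: idx_def)

lemma Epow_closed: "i \<in> idx vs \<Longrightarrow> j \<in> idx vs \<Longrightarrow> Epow vs r i j \<in> carrier (free_alg vs)"
  by (induction r arbitrary: i) (auto intro!: free_alg_intros)

text \<open>The entries of each power transform under e_ab as the letters do. In the induction e_ab
  is moved first past e_ik, then past the r-th power; the two brackets contribute the wanted terms
  and a pair of intermediate terms that cancel.\<close>

lemma Epow_bracket:
  assumes "a \<in> idx vs" "b \<in> idx vs" "i \<in> idx vs" "j \<in> idx vs"
  shows "ueq vs (letter a b * Epow vs r i j)
    (psgn (ebar vs a b \<and> ebar vs i j) * (Epow vs r i j * letter a b) + Ebr vs r a b i j)"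
  using assms(3)
proof (induction r arbitrary: i)
  case 0
  have eq: "letter a b * Epow vs 0 i j =
    psgn (ebar vs a b \<and> ebar vs i j) * (Epow vs 0 i j * letter a b) + Ebr vs 0 a b i j"
    by (simp add: Ebr_def psgn_def ebar_def)
  show ?case unfolding eq by (rule ueq_refl)
next
  case (Suc r)
  define s where "s c d = (psgn (ebar vs a b \<and> ebar vs c d) :: fa)" for c d
  define \<sigma> where "\<sigma> k = (psgn (vbar vs k) :: fa)" for k
  have ss: "s i k * s k j = s i j" for k
    by (auto simp: s_def psgn_def ebar_def)
  \<comment> \<open>The intermediate terms are multiples of
    \<open>letter i b * Epow vs r a j\<close>: one arises for k = b from the bracket with the power,
    the other for k = a from the bracket with the letter. This sign identity makes them
    cancel.\<close>
  have \<sigma>s: "\<sigma> a * s i a = \<sigma> b * s i b"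
    by (auto simp: s_def \<sigma>_def psgn_def ebar_def)
  have step: "ueq vs (letter a b * (\<sigma> k * (letter i k * Epow vs r k j)))
     (\<sigma> k * (s i k * (letter i k * (s k j * (Epow vs r k j * letter a b) + Ebr vs r a b k j))
        + lie_bracket vs a b i k * Epow vs r k j))" if k: "k \<in> idx vs" for k
  proof -
    have "letter a b * (\<sigma> k * (letter i k * Epow vs r k j)) =
        \<sigma> k * ((letter a b * letter i k) * Epow vs r k j)"
      by (simp add: \<sigma>_def psgn_def mult.assoc)
    also have "ueq vs \<dots>
        (\<sigma> k * ((s i k * (letter i k * letter a b) + lie_bracket vs a b i k) * Epow vs r k j))"
      unfolding s_def \<sigma>_def using k assms Suc.prems
      by (intro ueq_lmult ueq_rmult ueq_letter free_alg_psgn Epow_closed) auto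
    also have "\<dots> = \<sigma> k * (s i k * (letter i k * (letter a b * Epow vs r k j))
        + lie_bracket vs a b i k * Epow vs r k j)"
      by (simp add: distrib_right mult.assoc)
    also have "ueq vs \<dots>
      (\<sigma> k * (s i k * (letter i k * (s k j * (Epow vs r k j * letter a b) + Ebr vs r a b k j))
        + lie_bracket vs a b i k * Epow vs r k j))"
      unfolding s_def \<sigma>_def using k assms Suc.prems Suc.IH[OF k]
      by (intro ueq_lmult ueq_add[OF _ ueq_refl] free_alg_psgn free_alg_letter)
    finally show ?thesis .
  qed
  have "letter a b * Epow vs (Suc r) i j =
      (\<Sum>k \<in> idx vs. letter a b * (\<sigma> k * (letter i k * Epow vs r k j)))"
    by (simp add: \<sigma>_def sum_distrib_left)
  also have "ueq vs \<dots> (\<Sum>k \<in> idx vs.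
      \<sigma> k * (s i k * (letter i k * (s k j * (Epow vs r k j * letter a b) + Ebr vs r a b k j))
        + lie_bracket vs a b i k * Epow vs r k j))"
    by (intro ueq_sum step)
  also have "\<dots> =
      (\<Sum>k \<in> idx vs. s i j * (\<sigma> k * (letter i k * Epow vs r k j) * letter a b)
        + (if k = b then \<sigma> b * s i b * (letter i b * Epow vs r a j) else 0)
        - s i j * (if a = j then \<sigma> k * (letter i k * Epow vs r k b) else 0)
        + (if b = i then \<sigma> k * (letter a k * Epow vs r k j) else 0)
        - (if k = a then \<sigma> a * s i a * (letter i b * Epow vs r a j) else 0))"
  proof (rule sum.cong[OF refl])
    fix k assume "k \<in> idx vs"
    let ?A = "if b = k then Epow vs r a j else 0"
    let ?B = "if a = j then Epow vs r k b else 0"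
    let ?C = "if b = i then letter a k else 0"
    let ?D = "if a = k then letter i b else 0"
    have 1: "\<sigma> k * (s i k * (letter i k * (s k j * (Epow vs r k j * letter a b)))) =
        s i j * (\<sigma> k * (letter i k * Epow vs r k j) * letter a b)"
      unfolding ss[of k, symmetric] by (simp add: \<sigma>_def s_def psgn_def mult.assoc)
    have 2: "\<sigma> k * (s i k * (letter i k * ?A)) =
        (if k = b then \<sigma> b * s i b * (letter i b * Epow vs r a j) else 0)"
      by (simp add: mult.assoc)
    have 3: "\<sigma> k * (s i k * (letter i k * (s k j * ?B))) =
        s i j * (if a = j then \<sigma> k * (letter i k * Epow vs r k b) else 0)"
      unfolding ss[of k, symmetric] by (simp add: \<sigma>_def s_def psgn_def mult.assoc)
    have 4: "\<sigma> k * (?C * Epow vs r k j) = (if b = i then \<sigma> k * (letter a k * Epow vs r k j) else 0)"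
      by simp
    have 5: "\<sigma> k * (s i k * ?D * Epow vs r k j) =
        (if k = a then \<sigma> a * s i a * (letter i b * Epow vs r a j) else 0)"
      by (simp add: mult.assoc)
    have "\<sigma> k * (s i k * (letter i k * (s k j * (Epow vs r k j * letter a b) + Ebr vs r a b k j))
        + lie_bracket vs a b i k * Epow vs r k j) =
        \<sigma> k * (s i k * (letter i k * (s k j * (Epow vs r k j * letter a b))))
        + \<sigma> k * (s i k * (letter i k * ?A)) - \<sigma> k * (s i k * (letter i k * (s k j * ?B)))
        + \<sigma> k * (?C * Epow vs r k j) - \<sigma> k * (s i k * ?D * Epow vs r k j)"
      unfolding Ebr_def lie_bracket_def s_def[symmetric]
      by (simp only: distrib_left distrib_right left_diff_distrib right_diff_distrib add_diff_eq
          diff_diff_add add.assoc diff_add_eq)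
    then show "\<sigma> k * (s i k * (letter i k * (s k j * (Epow vs r k j * letter a b) + Ebr vs r a b k j))
        + lie_bracket vs a b i k * Epow vs r k j) =
      s i j * (\<sigma> k * (letter i k * Epow vs r k j) * letter a b)
        + (if k = b then \<sigma> b * s i b * (letter i b * Epow vs r a j) else 0)
        - s i j * (if a = j then \<sigma> k * (letter i k * Epow vs r k b) else 0)
        + (if b = i then \<sigma> k * (letter a k * Epow vs r k j) else 0)
        - (if k = a then \<sigma> a * s i a * (letter i b * Epow vs r a j) else 0)"
      unfolding 1 2 3 4 5 .
  qed
  also have "\<dots> = s i j * ((\<Sum>k \<in> idx vs. \<sigma> k * (letter i k * Epow vs r k j)) * letter a b)
      + \<sigma> b * s i b * (letter i b * Epow vs r a j)
      - s i j * (if a = j then \<Sum>k \<in> idx vs. \<sigma> k * (letter i k * Epow vs r k b) else 0)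
      + (if b = i then \<Sum>k \<in> idx vs. \<sigma> k * (letter a k * Epow vs r k j) else 0)
      - \<sigma> a * s i a * (letter i b * Epow vs r a j)"
    using assms(1,2)
    by (cases "a = j"; cases "b = i")
      (simp_all add: sum.distrib sum_subtractf sum_distrib_left sum_distrib_right)
  also have "\<dots> = s i j * (Epow vs (Suc r) i j * letter a b) + Ebr vs (Suc r) a b i j"
    unfolding Ebr_def Epow.simps s_def[symmetric] \<sigma>_def[symmetric] \<sigma>s by (simp add: algebra_simps)
  finally show ?case unfolding s_def .
qed

text \<open>Plain commutation suffices in place of supercommutation: the two agree for even
  elements, and the invariants used here are even.\<close>

definition central :: "bool list \<Rightarrow> fa \<Rightarrow> bool" where
  "central vs z \<longleftrightarrow> z \<in> carrier (free_alg vs) \<and> (\<forall>x \<in> carrier (free_alg vs). ueq vs (z * x) (x * z))"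

lemma ueq_commute_mult:
  assumes "ueq vs (z * x) (x * z)" "ueq vs (z * y) (y * z)"
    and "x \<in> carrier (free_alg vs)" "y \<in> carrier (free_alg vs)"
  shows "ueq vs (z * (x * y)) (x * y * z)"
proof -
  have "ueq vs (z * x * y) (x * z * y)" using assms by (intro ueq_rmult)
  also have "x * z * y = x * (z * y)" by (simp add: mult.assoc)
  also have "ueq vs \<dots> (x * (y * z))" using assms by (intro ueq_lmult)
  finally show ?thesis by (simp add: mult.assoc)
qed

lemma ueq_commute_add:
  "ueq vs (z * x) (x * z) \<Longrightarrow> ueq vs (z * y) (y * z) \<Longrightarrow> ueq vs (z * (x + y)) ((x + y) * z)"
  by (simp add: algebra_simps ueq_add)

lemma ueq_commute_const: "ueq vs (z * fa_const c) (fa_const c * z)"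
  by (simp add: fa_const_commute)

lemma centralI:
  assumes z: "z \<in> carrier (free_alg vs)"
    and letter: "\<And>a b. a \<in> idx vs \<Longrightarrow> b \<in> idx vs \<Longrightarrow> ueq vs (letter a b * z) (z * letter a b)"
  shows "central vs z"
proof -
  have "ueq vs (z * x) (x * z)" if "x \<in> carrier (free_alg vs)" for x
    using that
    by (rule free_alg_span)
      (auto intro: ueq_commute_const ueq_sym letter ueq_commute_add ueq_commute_mult)
  then show ?thesis using z by (simp add: central_def)
qed

lemma central_const: "central vs (fa_const c)"
  by (simp add: central_def free_alg_const fa_const_commute)

lemma central_mult:
  assumes "central vs x" "central vs y"
  shows "central vs (x * y)"
  using assms unfolding central_def
  by (metis free_alg_mult ueq_commute_mult ueq_sym)

lemma central_add: "central vs x \<Longrightarrow> central vs y \<Longrightarrow> central vs (x + y)"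
  by (simp add: central_def free_alg_add algebra_simps ueq_add)

lemma central_uminus: "central vs x \<Longrightarrow> central vs (- x)"
  by (simp add: central_def free_alg_uminus ueq_uminus)

lemma central_ueq:
  assumes "central vs x" "ueq vs x y" "y \<in> carrier (free_alg vs)"
  shows "central vs y"
  using assms unfolding central_def by (meson ueq_lmult ueq_rmult ueq_sym ueq_trans)

definition Gelfand :: "bool list \<Rightarrow> nat \<Rightarrow> fa" where
  "Gelfand vs r = (\<Sum>i \<in> idx vs. Epow vs r i i)"

text \<open>Diagonal entries are even, so no sign appears when e_ab passes them. Of the brackets, i
  = b leaves \<open>Epow vs r a b\<close> and i = a leaves its negative.\<close>

lemma central_Gelfand: "central vs (Gelfand vs r)"
proof (rule centralI)
  fix a b assume ab: "a \<in> idx vs" "b \<in> idx vs"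
  have "letter a b * Gelfand vs r = (\<Sum>i \<in> idx vs. letter a b * Epow vs r i i)"
    by (simp add: Gelfand_def sum_distrib_left)
  also have "ueq vs \<dots> (\<Sum>i \<in> idx vs.
      psgn (ebar vs a b \<and> ebar vs i i) * (Epow vs r i i * letter a b) + Ebr vs r a b i i)"
    using ab by (intro ueq_sum Epow_bracket)
  also have "\<dots> = Gelfand vs r * letter a b"
    using ab by (auto simp: ebar_def psgn_def Gelfand_def Ebr_def sum.distrib sum_subtractf
        sum_distrib_right)
  finally show "ueq vs (letter a b * Gelfand vs r) (Gelfand vs r * letter a b)" .
qed (auto simp: Gelfand_def intro: free_alg_sum Epow_closed)

text \<open>
  \<open>Hbin l r\<close> is \<open>binom (h\<^sub>1 + \<dots> + h\<^sub>l) r\<close>, written through Vandermonde's identity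
  so as to lie visibly in the integral form.
\<close>

fun Hbin :: "nat \<Rightarrow> nat \<Rightarrow> fa" where
  "Hbin 0 r = (if r = 0 then 1 else 0)"
| "Hbin (Suc l) r = (\<Sum>j \<le> r. Hbin l (r - j) * fa_binom (Suc l) j)"

definition Hsum :: "nat \<Rightarrow> fa" where
  "Hsum l = (\<Sum>i = 1..l. letter i i)"

lemma fa_binom_0 [simp]: "fa_binom i 0 = 1"
  by (simp add: fa_binom_def)

lemma fa_binom_Suc: "of_nat (Suc j) * fa_binom i (Suc j) = fa_binom i j * (letter i i - of_nat j)"
proof -
  have "of_nat (Suc j) * fa_const (1 / fact (Suc j)) = fa_const (1 / fact j)"
    unfolding fa_const_of_nat fa_const_mult by (simp add: divide_simps del: of_nat_Suc)
  then show ?thesis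
    unfolding fa_binom_def by (simp add: mult.assoc[symmetric] del: of_nat_Suc)
qed

lemma Hbin_closed: "l \<le> length vs \<Longrightarrow> Hbin l r \<in> carrier (free_alg vs)"
  by (induction l arbitrary: r)
    (auto intro!: free_alg_intros simp: idx_def)

lemma ueq_cartan_commute:
  assumes "i \<in> idx vs" "l \<in> idx vs"
  shows "ueq vs (letter i i * letter l l) (letter l l * letter i i)"
  using ueq_letter[of i i l l vs] assms
  by (cases "i = l") (auto simp: ebar_def psgn_def lie_bracket_def)

lemma ueq_Hsum_binom:
  assumes "l \<le> length vs" "i \<in> idx vs"
  shows "ueq vs (Hsum l * fa_binom i j) (fa_binom i j * Hsum l)"
proof -
  have h: "ueq vs (Hsum l * letter i i) (letter i i * Hsum l)"
    unfolding Hsum_def sum_distrib_left sum_distrib_right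
    using assms by (intro ueq_sum ueq_cartan_commute) (auto simp: idx_def)
  have *: "ueq vs (Hsum l * (letter i i - of_nat t)) ((letter i i - of_nat t) * Hsum l)" for t
    using ueq_diff[OF h ueq_commute_const[of vs "Hsum l" "of_nat t"]]
    unfolding fa_const_of_nat by (simp add: algebra_simps)
  have "ueq vs (Hsum l * prod_list (map (\<lambda>t. letter i i - of_nat t) ts))
      (prod_list (map (\<lambda>t. letter i i - of_nat t) ts) * Hsum l)" for ts
    by (induction ts)
      (use assms in \<open>auto intro!: ueq_commute_mult * free_alg_intros free_alg_prod_list\<close>)
  then show ?thesis
    unfolding fa_binom_def using assms
    by (intro ueq_commute_mult ueq_commute_const)
      (auto intro!: free_alg_prod_list free_alg_intros)
qed

text \<open>This recursion characterises binom(H, r) for H = \<open>Hsum l\<close>, so it identifies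
  \<open>Hbin\<close> modulo the relations with a polynomial in H. The factor r + 1 is split as (r +
  1 - j) + j: the first part is absorbed by the induction hypothesis for l, the second by the
  recursion of \<open>fa_binom\<close>, and (H_l - (r - j)) + (h - j) = H_(l+1) - r.\<close>

lemma Hbin_Suc:
  assumes "l \<le> length vs"
  shows "ueq vs (of_nat (Suc r) * Hbin l (Suc r)) (Hbin l r * (Hsum l - of_nat r))"
  using assms
proof (induction l arbitrary: r)
  case 0
  show ?case by (simp add: Hsum_def)
next
  case (Suc l)
  define b where "b = fa_binom (Suc l)"
  define h where "h = letter (Suc l) (Suc l)"
  have l: "Suc l \<in> idx vs" "l \<le> length vs"
    using Suc.prems by (auto simp: idx_def)
  have "of_nat (Suc r) * Hbin (Suc l) (Suc r) =
      (\<Sum>j \<le> Suc r. of_nat (Suc r - j) * Hbin l (Suc r - j) * b j)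
      + (\<Sum>j \<le> Suc r. Hbin l (Suc r - j) * (of_nat j * b j))"
  proof -
    have "of_nat (Suc r) * (Hbin l (Suc r - j) * b j) =
        of_nat (Suc r - j) * Hbin l (Suc r - j) * b j + Hbin l (Suc r - j) * (of_nat j * b j)"
      if "j \<le> Suc r" for j
    proof -
      have "(of_nat (Suc r) :: fa) = of_nat (Suc r - j) + of_nat j"
        using that by (metis le_add_diff_inverse2 of_nat_add)
      then have "of_nat (Suc r) * (Hbin l (Suc r - j) * b j) =
          of_nat (Suc r - j) * (Hbin l (Suc r - j) * b j) + of_nat j * (Hbin l (Suc r - j) * b j)"
        by (simp only: distrib_right)
      moreover have "of_nat j * (Hbin l (Suc r - j) * b j) = Hbin l (Suc r - j) * (of_nat j * b j)"
        by (metis fa_const_commute fa_const_of_nat mult.assoc)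
      ultimately show ?thesis by (simp add: mult.assoc)
    qed
    then show ?thesis
      by (simp add: sum_distrib_left b_def sum.distrib[symmetric] del: sum.atMost_Suc)
  qed
  \<comment> \<open>The term j = r + 1 has coefficient 0 here, and the term j = 0 has coefficient 0
    in the other sum, which is then shifted by one.\<close>
  also have "(\<Sum>j \<le> Suc r. of_nat (Suc r - j) * Hbin l (Suc r - j) * b j) =
      (\<Sum>j \<le> r. of_nat (Suc (r - j)) * Hbin l (Suc (r - j)) * b j)"
    by (simp add: Suc_diff_le del: of_nat_Suc of_nat_diff)
  also have "(\<Sum>j \<le> Suc r. Hbin l (Suc r - j) * (of_nat j * b j)) =
      (\<Sum>j \<le> r. Hbin l (r - j) * (of_nat (Suc j) * b (Suc j)))"
    by (simp add: sum.atMost_Suc_shift del: sum.atMost_Suc)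
  also have "\<dots> = (\<Sum>j \<le> r. Hbin l (r - j) * (b j * (h - of_nat j)))"
    by (simp only: b_def h_def fa_binom_Suc)
  also have "ueq vs ((\<Sum>j \<le> r. of_nat (Suc (r - j)) * Hbin l (Suc (r - j)) * b j) + \<dots>)
      ((\<Sum>j \<le> r. Hbin l (r - j) * (b j * (Hsum l - of_nat (r - j))))
        + (\<Sum>j \<le> r. Hbin l (r - j) * (b j * (h - of_nat j))))"
  proof (intro ueq_add ueq_refl ueq_sum)
    fix j
    have "ueq vs (of_nat (Suc (r - j)) * Hbin l (Suc (r - j)) * b j)
        (Hbin l (r - j) * (Hsum l - of_nat (r - j)) * b j)"
      using l unfolding b_def by (intro ueq_rmult Suc.IH free_alg_binom)
    also have "\<dots> = Hbin l (r - j) * ((Hsum l - of_nat (r - j)) * b j)"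
      by (simp add: mult.assoc)
    also have "ueq vs \<dots> (Hbin l (r - j) * (b j * (Hsum l - of_nat (r - j))))"
    proof (rule ueq_lmult)
      have "ueq vs (Hsum l * b j) (b j * Hsum l)"
        using l unfolding b_def by (intro ueq_Hsum_binom)
      from ueq_diff[OF this ueq_sym[OF ueq_commute_const[of vs "b j" "of_nat (r - j)"]]]
      show "ueq vs ((Hsum l - of_nat (r - j)) * b j) (b j * (Hsum l - of_nat (r - j)))"
        unfolding fa_const_of_nat by (simp add: algebra_simps)
    qed (use l in \<open>auto intro: Hbin_closed\<close>)
    finally show "ueq vs (of_nat (Suc (r - j)) * Hbin l (Suc (r - j)) * b j)
        (Hbin l (r - j) * (b j * (Hsum l - of_nat (r - j))))" .
  qed
  also have "(\<Sum>j \<le> r. Hbin l (r - j) * (b j * (Hsum l - of_nat (r - j))))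
        + (\<Sum>j \<le> r. Hbin l (r - j) * (b j * (h - of_nat j))) =
      Hbin (Suc l) r * (Hsum (Suc l) - of_nat r)"
  proof -
    have "Hbin l (r - j) * (b j * (Hsum l - of_nat (r - j))) + Hbin l (r - j) * (b j * (h - of_nat j))
        = Hbin l (r - j) * b j * (Hsum (Suc l) - of_nat r)" if "j \<le> r" for j
    proof -
      have "(of_nat r :: fa) = of_nat (r - j) + of_nat j"
        using that by (metis le_add_diff_inverse2 of_nat_add)
      moreover have "Hsum (Suc l) = Hsum l + h"
        by (simp add: Hsum_def h_def)
      ultimately show ?thesis
        by (simp add: algebra_simps)
    qed
    then show ?thesis
      by (simp add: sum.distrib[symmetric] sum_distrib_right b_def)
  qed
  finally show ?case .
qed

text \<open>This is the first Gelfand invariant: the sign in the recursion cancels the sign in the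
  zeroth power.\<close>

lemma central_Hsum: "central vs (Hsum (length vs))"
proof -
  have "Gelfand vs (Suc 0) = Hsum (length vs)"
  proof -
    have "(\<Sum>k \<in> idx vs. psgn (vbar vs k) * (letter i k * Epow vs 0 k i)) = letter i i"
      if "i \<in> idx vs" for i
    proof -
      have "(\<Sum>k \<in> idx vs. psgn (vbar vs k) * (letter i k * Epow vs 0 k i)) =
          (\<Sum>k \<in> idx vs. if k = i then letter i i else 0)"
        by (intro sum.cong) (auto simp: psgn_def)
      then show ?thesis using that by simp
    qed
    then show ?thesis
      by (simp add: Gelfand_def Hsum_def idx_def)
  qed
  then show ?thesis
    using central_Gelfand[of vs "Suc 0"] by simp
qed

text \<open>By \<open>Hbin_Suc\<close> the next binomial is, up to the factor r + 1, a product of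
  central elements. That factor is invertible because the enveloping superalgebra is
  complex.\<close>

lemma central_Hbin: "central vs (Hbin (length vs) r)"
proof (induction r)
  case 0
  have "Hbin l 0 = 1" for l by (induction l) auto
  then show ?case using central_const[of vs 1] by simp
next
  case (Suc r)
  let ?B = "Hbin (length vs)"
  have "central vs (?B r * (Hsum (length vs) + - fa_const (of_nat r)))"
    by (intro central_mult Suc central_add central_Hsum central_uminus central_const)
  then have "central vs (?B r * (Hsum (length vs) - of_nat r))"
    unfolding fa_const_of_nat by simp
  then have "central vs (of_nat (Suc r) * ?B (Suc r))"
    by (rule central_ueq) (auto intro!: ueq_sym[OF Hbin_Suc] Hbin_closed free_alg_intros
        simp del: of_nat_Suc)
  then have "central vs (fa_const (1 / of_nat (Suc r)) * (of_nat (Suc r) * ?B (Suc r)))"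
    by (rule central_mult[OF central_const])
  moreover have "fa_const (1 / of_nat (Suc r)) * (of_nat (Suc r) * ?B (Suc r)) = ?B (Suc r)"
    unfolding fa_const_of_nat mult.assoc[symmetric] fa_const_mult by (simp del: of_nat_Suc)
  ultimately show ?case by simp
qed

section \<open>Parity\<close>

lemma free_part_zero: "0 \<in> free_part vs p"
  by (simp add: free_part_def free_alg_zero)

lemma free_part_const: "fa_const c \<in> free_part vs False"
  by (auto simp: free_part_def free_alg_const) (auto simp: fa_const_def word_bar_def zero_word_def split: if_splits)

lemma free_part_letter: "i \<in> idx vs \<Longrightarrow> j \<in> idx vs \<Longrightarrow> letter i j \<in> free_part vs (ebar vs i j)"
  by (auto simp: free_part_def free_alg_letter) (auto simp: letter_def word_bar_def split: if_splits)

lemma free_part_add: "x \<in> free_part vs p \<Longrightarrow> y \<in> free_part vs p \<Longrightarrow> x + y \<in> free_part vs p"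
  using keys_add[of x y] by (auto simp: free_part_def free_alg_add)

lemma free_part_uminus: "x \<in> free_part vs p \<Longrightarrow> - x \<in> free_part vs p"
  by (auto simp: free_part_def free_alg_uminus in_keys_iff)

lemma free_part_mult:
  assumes "x \<in> free_part vs p" "y \<in> free_part vs q"
  shows "x * y \<in> free_part vs (p \<noteq> q)"
proof -
  have "word_bar vs (u + v) = (word_bar vs u \<noteq> word_bar vs v)" for u v
    by (simp add: word_bar_def plus_word_def)
  then show ?thesis
    using assms keys_mult[of x y] unfolding free_part_def by (auto intro: free_alg_mult)
qed

lemma free_part_sum: "(\<And>t. t \<in> T \<Longrightarrow> f t \<in> free_part vs p) \<Longrightarrow> sum f T \<in> free_part vs p"
  by (induction T rule: infinite_finite_induct) (auto intro: free_part_zero free_part_add)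

lemma free_part_psgn: "psgn b \<in> free_part vs False"
  using free_part_const[of 1 vs] by (auto simp: psgn_def intro: free_part_uminus)

lemma free_part_even_mult: "x \<in> free_part vs False \<Longrightarrow> y \<in> free_part vs p \<Longrightarrow> x * y \<in> free_part vs p"
  using free_part_mult[of x vs False y p] by simp

lemma Epow_part: "i \<in> idx vs \<Longrightarrow> j \<in> idx vs \<Longrightarrow> Epow vs r i j \<in> free_part vs (ebar vs i j)"
proof (induction r arbitrary: i)
  case 0
  then show ?case by (auto simp: ebar_def intro: free_part_zero free_part_psgn)
next
  case (Suc r)
  have "letter i k * Epow vs r k j \<in> free_part vs (ebar vs i j)" if "k \<in> idx vs" for k
  proof -
    have "ebar vs i j = (ebar vs i k \<noteq> ebar vs k j)" by (auto simp: ebar_def)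
    then show ?thesis
      using free_part_mult[OF free_part_letter Suc.IH, of i k k] Suc.prems that by simp
  qed
  then show ?case
    unfolding Epow.simps by (intro free_part_sum free_part_even_mult[OF free_part_psgn])
qed

text \<open>Evenness of the central elements is what later makes the splitting map preserve
  parity.\<close>

lemma Gelfand_even: "Gelfand vs r \<in> free_part vs False"
proof -
  have "ebar vs i i = False" for i by (simp add: ebar_def)
  then show ?thesis
    unfolding Gelfand_def by (intro free_part_sum) (metis Epow_part)
qed

lemma binom_even: "i \<in> idx vs \<Longrightarrow> fa_binom i r \<in> free_part vs False"
proof -
  assume i: "i \<in> idx vs"
  have "letter i i - fa_const c \<in> free_part vs False" for c
    using free_part_add[OF _ free_part_uminus[OF free_part_const[of c vs]]] free_part_letter[OF i i]
    by (fastforce simp: ebar_def)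
  then have "prod_list (map (\<lambda>t. letter i i - of_nat t) ts) \<in> free_part vs False" for ts
    by (induction ts) (use free_part_const[of 1 vs] in
        \<open>auto simp: fa_const_of_nat intro: free_part_even_mult\<close>)
  then show ?thesis
    unfolding fa_binom_def by (intro free_part_even_mult free_part_const)
qed

lemma Hbin_even: "l \<le> length vs \<Longrightarrow> Hbin l r \<in> free_part vs False"
  by (induction l arbitrary: r)
    (use free_part_const[of 1 vs] in
      \<open>auto intro!: free_part_sum free_part_even_mult binom_even free_part_zero simp: idx_def\<close>)

section \<open>Cosets of a free abelian group\<close>

text \<open>Closure under differences covers both group operations: -h = 0 - h and a + b = a - (0 -
  b).\<close>

lemma free_Abelian_group_generate_induct [consumes 2, case_names zero gen diff]:
  assumes h: "h \<in> generate (free_Abelian_group S) G" and G: "G \<subseteq> carrier (free_Abelian_group S)"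
    and zero: "P 0" and gen: "\<And>g. g \<in> G \<Longrightarrow> P g"
    and diff: "\<And>a b. P a \<Longrightarrow> P b \<Longrightarrow> P (a - b)"
  shows "P h"
  using h
proof (induction rule: generate.induct)
  case one
  then show ?case using zero by simp
next
  case (incl h)
  then show ?case by (rule gen)
next
  case (inv h)
  then have "P (0 - h)" using zero gen diff by blast
  then show ?case using inv G by (auto simp: subset_iff)
next
  case (eng a b)
  then have "P (a - (0 - b))" using zero diff by blast
  then show ?case by simp
qed

lemma free_Abelian_group_subgroup_diff:
  assumes "subgroup H (free_Abelian_group S)" "a \<in> H" "b \<in> H"
  shows "a - b \<in> H"
proof -
  have "inv\<^bsub>free_Abelian_group S\<^esub> b = - b"
    using subgroup.mem_carrier[OF assms(1,3)] by (simp add: subset_iff)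
  then show ?thesis
    using subgroup.m_closed[OF assms(1,2) subgroup.m_inv_closed[OF assms(1,3)]] by simp
qed

lemma free_Abelian_group_coset:
  "H #>\<^bsub>free_Abelian_group S\<^esub> p = (\<lambda>h. h + p) ` H"
  by (auto simp: r_coset_def)

lemma free_Abelian_group_coset_eq_iff:
  assumes "subgroup H (free_Abelian_group S)"
  shows "H #>\<^bsub>free_Abelian_group S\<^esub> p = H #>\<^bsub>free_Abelian_group S\<^esub> q \<longleftrightarrow> p - q \<in> H"
proof
  have 0: "0 \<in> H" using subgroup.one_closed[OF assms] by simp
  have diff: "a - b \<in> H" if "a \<in> H" "b \<in> H" for a b
    using free_Abelian_group_subgroup_diff[OF assms that] .
  have add: "a + b \<in> H" if "a \<in> H" "b \<in> H" for a b
    using subgroup.m_closed[OF assms that] by simp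
  {
    assume "H #>\<^bsub>free_Abelian_group S\<^esub> p = H #>\<^bsub>free_Abelian_group S\<^esub> q"
    then have "0 + p \<in> (\<lambda>h. h + q) ` H"
      using 0 unfolding free_Abelian_group_coset by blast
    then show "p - q \<in> H" by auto
  }
  assume "p - q \<in> H"
  then have "h + p \<in> (\<lambda>h. h + q) ` H" "h + q \<in> (\<lambda>h. h + p) ` H" if "h \<in> H" for h
    using that diff[of h "p - q"] add[of h "p - q"]
    by (auto intro: image_eqI[of _ _ "h + (p - q)"] image_eqI[of _ _ "h - (p - q)"]
        simp del: diff_diff_eq2)
  then show "H #>\<^bsub>free_Abelian_group S\<^esub> p = H #>\<^bsub>free_Abelian_group S\<^esub> q"
    unfolding free_Abelian_group_coset by blast
qed

lemma free_Abelian_group_coset_add: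
  assumes "subgroup H (free_Abelian_group S)"
    and "p \<in> carrier (free_Abelian_group S)" "q \<in> carrier (free_Abelian_group S)"
  shows "(H #>\<^bsub>free_Abelian_group S\<^esub> p) <#>\<^bsub>free_Abelian_group S\<^esub> (H #>\<^bsub>free_Abelian_group S\<^esub> q)
    = H #>\<^bsub>free_Abelian_group S\<^esub> (p + q)"
  using normal.rcos_sum[OF comm_group.subgroup_imp_normal[OF _ assms(1)] assms(2,3)]
    abelian_free_Abelian_group[of S] by simp

text \<open>To see that an additive map respects the defining relations of a tensor product, it is
  enough to check the generators of the relations.\<close>

lemma frag_extend_image:
  assumes "\<And>g. g \<in> G \<Longrightarrow> frag_extend f g \<in> H" "G \<subseteq> carrier (free_Abelian_group S)"
    and "subgroup H (free_Abelian_group S')"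
    and "h \<in> generate (free_Abelian_group S) G"
  shows "frag_extend f h \<in> H"
  using assms(4,2)
proof (induction rule: free_Abelian_group_generate_induct)
  case zero
  show ?case using subgroup.one_closed[OF assms(3)] by simp
next
  case (diff a b)
  then show ?case
    using free_Abelian_group_subgroup_diff[OF assms(3)] by (simp add: frag_extend_diff)
qed (use assms(1) in auto)

section \<open>The integral form\<close>

definition UZ_gens :: "bool list \<Rightarrow> fa set" where
  "UZ_gens vs = {letter i j | i j. i \<in> idx vs \<and> j \<in> idx vs \<and> ebar vs i j} \<union>
      {fa_divpow i j r | i j r. i \<in> idx vs \<and> j \<in> idx vs \<and> i \<noteq> j \<and> \<not> ebar vs i j \<and> r \<ge> 1} \<union>
      {fa_binom i r | i r. i \<in> idx vs \<and> r \<ge> 1}"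

lemma UZ_gens_letter:
  "i \<in> idx vs \<Longrightarrow> j \<in> idx vs \<Longrightarrow> ebar vs i j \<Longrightarrow> letter i j \<in> UZ_gens vs"
  unfolding UZ_gens_def by blast

lemma UZ_gens_divpow:
  "i \<in> idx vs \<Longrightarrow> j \<in> idx vs \<Longrightarrow> i \<noteq> j \<Longrightarrow> \<not> ebar vs i j \<Longrightarrow> r \<ge> 1 \<Longrightarrow>
    fa_divpow i j r \<in> UZ_gens vs"
  unfolding UZ_gens_def by blast

lemma UZ_gens_binom: "i \<in> idx vs \<Longrightarrow> r \<ge> 1 \<Longrightarrow> fa_binom i r \<in> UZ_gens vs"
  unfolding UZ_gens_def by blast

lemma UZ_gens_closed: "UC_cls vs ` UZ_gens vs \<subseteq> carrier (UC vs)"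
  by (auto simp: UZ_gens_def intro!: UC_cls_closed free_alg_intros)

lemma UZ_eq: "UZ vs = (UC vs)\<lparr>carrier := generate_ring (UC vs) (UC_cls vs ` UZ_gens vs)\<rparr>"
  by (simp add: UZ_def UZ_gens_def)

lemma UZ_simps [simp]:
  "x \<otimes>\<^bsub>UZ vs\<^esub> y = x \<otimes>\<^bsub>UC vs\<^esub> y"
  "x \<oplus>\<^bsub>UZ vs\<^esub> y = x \<oplus>\<^bsub>UC vs\<^esub> y"
  "\<zero>\<^bsub>UZ vs\<^esub> = \<zero>\<^bsub>UC vs\<^esub>"
  "\<one>\<^bsub>UZ vs\<^esub> = \<one>\<^bsub>UC vs\<^esub>"
  by (simp_all add: UZ_eq)

lemma ring_UZ: "ring (UZ vs)"
  unfolding UZ_eq by (rule UC.generate_ring_is_ring[OF UZ_gens_closed])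

interpretation UZ: ring "UZ vs" for vs
  by (rule ring_UZ)

lemma carrier_UZ_subset: "carrier (UZ vs) \<subseteq> carrier (UC vs)"
  using UC.generate_ring_incl[OF UZ_gens_closed, of vs] by (simp add: UZ_eq)

text \<open>The preimage of U_Z in the free algebra, so that integrality can be established on the
  representatives used with \<open>ueq\<close>.\<close>

definition int_form :: "bool list \<Rightarrow> fa set" where
  "int_form vs = {x \<in> carrier (free_alg vs). UC_cls vs x \<in> carrier (UZ vs)}"

lemma carrier_UZ: "carrier (UZ vs) = UC_cls vs ` int_form vs"
  using carrier_UZ_subset[of vs] by (auto simp: int_form_def carrier_UC)

lemma int_form_free_alg: "x \<in> int_form vs \<Longrightarrow> x \<in> carrier (free_alg vs)"
  by (simp add: int_form_def)

lemma int_form_cls: "x \<in> int_form vs \<Longrightarrow> UC_cls vs x \<in> carrier (UZ vs)"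
  by (simp add: int_form_def)

lemma int_form_add: "x \<in> int_form vs \<Longrightarrow> y \<in> int_form vs \<Longrightarrow> x + y \<in> int_form vs"
  using UZ.add.m_closed by (simp add: int_form_def free_alg_add UC_cls_add)

lemma int_form_mult: "x \<in> int_form vs \<Longrightarrow> y \<in> int_form vs \<Longrightarrow> x * y \<in> int_form vs"
  using UZ.m_closed by (simp add: int_form_def free_alg_mult UC_cls_mult)

lemma int_form_one: "1 \<in> int_form vs"
  using UZ.one_closed by (simp add: int_form_def free_alg_one UC_cls_one)

lemma int_form_uminus: "x \<in> int_form vs \<Longrightarrow> - x \<in> int_form vs"
  by (auto simp: int_form_def free_alg_uminus UC_cls_uminus UZ_eq intro: generate_ring.a_inv)

lemma int_form_diff: "x \<in> int_form vs \<Longrightarrow> y \<in> int_form vs \<Longrightarrow> x - y \<in> int_form vs"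
  using int_form_add[of x vs "- y"] int_form_uminus[of y vs] by simp

lemma int_form_zero: "0 \<in> int_form vs"
  using int_form_add[OF int_form_one int_form_uminus[OF int_form_one]] by simp

lemma int_form_psgn: "psgn b \<in> int_form vs"
  by (simp add: psgn_def int_form_one int_form_uminus)

lemma int_form_sum: "(\<And>t. t \<in> T \<Longrightarrow> f t \<in> int_form vs) \<Longrightarrow> sum f T \<in> int_form vs"
  by (induction T rule: infinite_finite_induct) (auto intro: int_form_zero int_form_add)

lemma int_form_gen: "x \<in> UZ_gens vs \<Longrightarrow> x \<in> int_form vs"
  by (auto simp: int_form_def UZ_eq UZ_gens_def free_alg_intros intro!: generate_ring.incl)

lemma int_form_binom: "i \<in> idx vs \<Longrightarrow> fa_binom i r \<in> int_form vs"
  by (cases "r = 0") (simp_all add: int_form_one int_form_gen UZ_gens_binom)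

lemma fa_binom_1 [simp]: "fa_binom i (Suc 0) = letter i i"
  by (simp add: fa_binom_def)

lemma fa_divpow_1 [simp]: "fa_divpow i j (Suc 0) = letter i j"
  by (simp add: fa_divpow_def)

text \<open>A diagonal letter is binom(h_i, 1), an odd letter is a generator, and an even
  off-diagonal letter is a divided power with exponent 1.\<close>

lemma int_form_letter:
  assumes "i \<in> idx vs" "j \<in> idx vs"
  shows "letter i j \<in> int_form vs"
proof -
  consider "i = j" | "ebar vs i j" | "i \<noteq> j" "\<not> ebar vs i j" by blast
  then show ?thesis
  proof cases
    case 1
    then show ?thesis using int_form_binom[OF assms(1), of "Suc 0"] by simp
  next
    case 2
    then show ?thesis by (intro int_form_gen UZ_gens_letter assms)
  next
    case 3
    then show ?thesis using int_form_gen[OF UZ_gens_divpow[OF assms, of "Suc 0"]] by simp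
  qed
qed

lemma int_form_Epow: "i \<in> idx vs \<Longrightarrow> j \<in> idx vs \<Longrightarrow> Epow vs r i j \<in> int_form vs"
  by (induction r arbitrary: i)
    (auto intro!: int_form_zero int_form_psgn int_form_sum int_form_mult int_form_letter)

lemma int_form_Gelfand: "Gelfand vs r \<in> int_form vs"
  unfolding Gelfand_def by (intro int_form_sum int_form_Epow)

lemma int_form_Hbin: "l \<le> length vs \<Longrightarrow> Hbin l r \<in> int_form vs"
  by (induction l arbitrary: r)
    (auto intro!: int_form_zero int_form_one int_form_sum int_form_mult int_form_binom simp: idx_def)

section \<open>The distribution superalgebra\<close>

definition Dist_gens :: "bool list \<Rightarrow> (('k::field \<times> fa set) \<Rightarrow>\<^sub>0 int) set" where
  "Dist_gens vs =
      {frag_of (c + c', u) - frag_of (c, u) - frag_of (c', u) | c c' u. u \<in> carrier (UZ vs)} \<union>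
      {frag_of (c, u \<oplus>\<^bsub>UZ vs\<^esub> u') - frag_of (c, u) - frag_of (c, u') |
         c u u'. u \<in> carrier (UZ vs) \<and> u' \<in> carrier (UZ vs)} \<union>
      {frag_of (c * of_int z, u) - frag_of (c, add_pow (UZ vs) z u) |
         c z u. u \<in> carrier (UZ vs)}"

abbreviation Dist_base :: "bool list \<Rightarrow> (('k::field \<times> fa set) \<Rightarrow>\<^sub>0 int) monoid" where
  "Dist_base vs \<equiv> free_Abelian_group (UNIV \<times> carrier (UZ vs))"

lemma Dist_gens_add_left:
  "u \<in> carrier (UZ vs) \<Longrightarrow> frag_of (c + c', u) - frag_of (c, u) - frag_of (c', u) \<in> Dist_gens vs"
  unfolding Dist_gens_def by blast

lemma Dist_gens_add_right:
  "u \<in> carrier (UZ vs) \<Longrightarrow> u' \<in> carrier (UZ vs) \<Longrightarrow>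
    frag_of (c, u \<oplus>\<^bsub>UZ vs\<^esub> u') - frag_of (c, u) - frag_of (c, u') \<in> Dist_gens vs"
  unfolding Dist_gens_def by blast

lemma Dist_gens_balance:
  "u \<in> carrier (UZ vs) \<Longrightarrow> frag_of (c * of_int z, u) - frag_of (c, add_pow (UZ vs) z u) \<in> Dist_gens vs"
  unfolding Dist_gens_def by blast

lemma Dist_gens_cases [consumes 1, case_names add_left add_right balance]:
  assumes "g \<in> Dist_gens vs"
  obtains c c' u where "u \<in> carrier (UZ vs)" "g = frag_of (c + c', u) - frag_of (c, u) - frag_of (c', u)"
  | c u u' where "u \<in> carrier (UZ vs)" "u' \<in> carrier (UZ vs)"
      "g = frag_of (c, u \<oplus>\<^bsub>UZ vs\<^esub> u') - frag_of (c, u) - frag_of (c, u')"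
  | c z u where "u \<in> carrier (UZ vs)" "g = frag_of (c * of_int z, u) - frag_of (c, add_pow (UZ vs) z u)"
  using assms unfolding Dist_gens_def by blast

lemma Dist_free_eq: "Dist_free vs = Dist_base vs"
  by (simp add: Dist_free_def tensor_free_def ground_def ring_of_type_algebra_def)

lemma Dist_rel_eq: "Dist_rel vs = generate (Dist_base vs) (Dist_gens vs)"
proof -
  have "Dist_rel vs = generate (Dist_free vs) (Dist_gens vs)"
    unfolding Dist_rel_def tensor_rel_def Dist_gens_def Dist_free_def ground_def
    by (simp add: ring_of_type_algebra_def del: UZ_simps)
  then show ?thesis by (simp add: Dist_free_eq)
qed

lemma keys_frag_diff_subset:
  "Poly_Mapping.keys a \<subseteq> S \<Longrightarrow> Poly_Mapping.keys b \<subseteq> S \<Longrightarrow> Poly_Mapping.keys (a - b) \<subseteq> S"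
  using keys_diff[of a b] by blast

lemma Dist_gens_closed: "Dist_gens vs \<subseteq> carrier (Dist_base vs)"
proof
  fix g assume "g \<in> Dist_gens vs"
  then show "g \<in> carrier (Dist_base vs)"
    by (cases rule: Dist_gens_cases)
      (simp_all add: keys_frag_diff_subset UZ.add.m_closed UZ.add.int_pow_closed del: UZ_simps)
qed

lemma subgroup_Dist_rel: "subgroup (Dist_rel vs) (Dist_base vs)"
  unfolding Dist_rel_eq by (rule group.generate_is_subgroup[OF group_free_Abelian_group Dist_gens_closed])

lemma Dist_rel_diff: "a \<in> Dist_rel vs \<Longrightarrow> b \<in> Dist_rel vs \<Longrightarrow> a - b \<in> Dist_rel vs"
  by (rule free_Abelian_group_subgroup_diff[OF subgroup_Dist_rel])

lemma Dist_rel_zero: "0 \<in> Dist_rel vs"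
  using subgroup.one_closed[OF subgroup_Dist_rel] by simp

lemma Dist_rel_gen: "g \<in> Dist_gens vs \<Longrightarrow> g \<in> Dist_rel vs"
  unfolding Dist_rel_eq by (rule generate.incl)

lemma Dist_cls_eq_iff: "Dist_cls vs p = Dist_cls vs q \<longleftrightarrow> p - q \<in> Dist_rel vs"
  unfolding Dist_cls_def Dist_free_eq by (rule free_Abelian_group_coset_eq_iff[OF subgroup_Dist_rel])

lemma Dist_cls_mem: "q \<in> Dist_cls vs p \<longleftrightarrow> q - p \<in> Dist_rel vs"
  unfolding Dist_cls_def Dist_free_eq free_Abelian_group_coset
  by (auto intro!: image_eqI[of _ _ "q - p"])

lemma carrier_Dist: "carrier (Dist vs) = Dist_cls vs ` carrier (Dist_base vs)"
  by (auto simp: Dist_def FactGroup_def RCOSETS_def Dist_free_eq Dist_cls_def)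

lemma Dist_add:
  "p \<in> carrier (Dist_base vs) \<Longrightarrow> q \<in> carrier (Dist_base vs) \<Longrightarrow>
    Dist_cls vs p \<oplus>\<^bsub>Dist vs\<^esub> Dist_cls vs q = Dist_cls vs (p + q)"
  using free_Abelian_group_coset_add[OF subgroup_Dist_rel]
  by (simp add: Dist_def FactGroup_def Dist_free_eq Dist_cls_def)

lemma Dist_free_mult_diff_left:
  "Dist_free_mult vs (p - p') q = Dist_free_mult vs p q - Dist_free_mult vs p' q"
  by (simp add: Dist_free_mult_def frag_extend_diff)

lemma Dist_free_mult_of_left:
  "Dist_free_mult vs (frag_of (c, u)) q =
    frag_extend (\<lambda>(d, v). frag_of (c * d, u \<otimes>\<^bsub>UZ vs\<^esub> v)) q"
  by (simp add: Dist_free_mult_def)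

lemma Dist_free_mult_diff_right:
  "Dist_free_mult vs p (q - q') = Dist_free_mult vs p q - Dist_free_mult vs p q'"
proof -
  have "Poly_Mapping.keys p \<subseteq> UNIV" by simp
  then show ?thesis
  proof (induction p rule: frag_induction)
    case (one x)
    then show ?case by (cases x) (simp add: Dist_free_mult_of_left frag_extend_diff)
  next
    case (diff a b)
    then show ?case unfolding Dist_free_mult_diff_left by simp
  qed (simp add: Dist_free_mult_def)
qed

lemma Dist_free_mult_of_right:
  "Dist_free_mult vs p (frag_of (d, v)) =
    frag_extend (\<lambda>(c, u). frag_of (c * d, u \<otimes>\<^bsub>UZ vs\<^esub> v)) p"
  by (simp add: Dist_free_mult_def)

text \<open>Right multiplication by a pure tensor turns each defining relation into a defining
  relation of the same kind; additivity in \<open>q\<close> does the rest. With the mirror statement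
  for left multiplication, the relations form a two-sided ideal.\<close>

lemma Dist_rel_mult_left:
  fixes h q :: "('k::field \<times> fa set) \<Rightarrow>\<^sub>0 int"
  assumes h: "h \<in> Dist_rel vs" and q: "q \<in> carrier (Dist_base vs)"
  shows "Dist_free_mult vs h q \<in> Dist_rel vs"
proof -
  have gen: "Dist_free_mult vs h (frag_of (d, v)) \<in> Dist_rel vs" if v: "v \<in> carrier (UZ vs)" for d v
    unfolding Dist_free_mult_of_right
  proof (rule frag_extend_image[OF _ Dist_gens_closed subgroup_Dist_rel h[unfolded Dist_rel_eq]])
    fix g :: "('k \<times> fa set) \<Rightarrow>\<^sub>0 int"
    assume "g \<in> Dist_gens vs"
    then have "frag_extend (\<lambda>(c, u). frag_of (c * d, u \<otimes>\<^bsub>UZ vs\<^esub> v)) g \<in> Dist_gens vs"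
    proof (cases rule: Dist_gens_cases)
      case (add_left c c' u)
      then show ?thesis
        using Dist_gens_add_left[of "u \<otimes>\<^bsub>UZ vs\<^esub> v" vs "c * d" "c' * d"] v UZ.m_closed
        by (simp add: frag_extend_diff distrib_right del: UZ_simps)
    next
      case (add_right c u u')
      then show ?thesis
        using Dist_gens_add_right[of "u \<otimes>\<^bsub>UZ vs\<^esub> v" vs "u' \<otimes>\<^bsub>UZ vs\<^esub> v" "c * d"] v UZ.m_closed UZ.l_distr
        by (simp add: frag_extend_diff del: UZ_simps)
    next
      case (balance c z u)
      then show ?thesis
        using Dist_gens_balance[of "u \<otimes>\<^bsub>UZ vs\<^esub> v" vs "c * d" z] v UZ.m_closed UZ.add_pow_ldistr_int
        by (simp add: frag_extend_diff mult_ac del: UZ_simps)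
    qed
    then show "frag_extend (\<lambda>(c, u). frag_of (c * d, u \<otimes>\<^bsub>UZ vs\<^esub> v)) g \<in> Dist_rel vs"
      by (rule Dist_rel_gen)
  qed
  have "Poly_Mapping.keys q \<subseteq> UNIV \<times> carrier (UZ vs)"
    using q by simp
  then show ?thesis
  proof (induction q rule: frag_induction)
    case zero
    show ?case using Dist_rel_zero Dist_free_mult_diff_right[of vs h 0 0] by simp
  next
    case (one x)
    then show ?case using gen by auto
  next
    case (diff a b)
    then show ?case by (simp add: Dist_free_mult_diff_right Dist_rel_diff)
  qed
qed

lemma Dist_rel_mult_right:
  fixes h q :: "('k::field \<times> fa set) \<Rightarrow>\<^sub>0 int"
  assumes h: "h \<in> Dist_rel vs" and q: "q \<in> carrier (Dist_base vs)"
  shows "Dist_free_mult vs q h \<in> Dist_rel vs"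
proof -
  have gen: "Dist_free_mult vs (frag_of (d, v)) h \<in> Dist_rel vs" if v: "v \<in> carrier (UZ vs)" for d v
    unfolding Dist_free_mult_of_left
  proof (rule frag_extend_image[OF _ Dist_gens_closed subgroup_Dist_rel h[unfolded Dist_rel_eq]])
    fix g :: "('k \<times> fa set) \<Rightarrow>\<^sub>0 int"
    assume "g \<in> Dist_gens vs"
    then have "frag_extend (\<lambda>(c, u). frag_of (d * c, v \<otimes>\<^bsub>UZ vs\<^esub> u)) g \<in> Dist_gens vs"
    proof (cases rule: Dist_gens_cases)
      case (add_left c c' u)
      then show ?thesis
        using Dist_gens_add_left[of "v \<otimes>\<^bsub>UZ vs\<^esub> u" vs "d * c" "d * c'"] v UZ.m_closed
        by (simp add: frag_extend_diff distrib_left del: UZ_simps)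
    next
      case (add_right c u u')
      then show ?thesis
        using Dist_gens_add_right[of "v \<otimes>\<^bsub>UZ vs\<^esub> u" vs "v \<otimes>\<^bsub>UZ vs\<^esub> u'" "d * c"] v UZ.m_closed UZ.r_distr
        by (simp add: frag_extend_diff del: UZ_simps)
    next
      case (balance c z u)
      then show ?thesis
        using Dist_gens_balance[of "v \<otimes>\<^bsub>UZ vs\<^esub> u" vs "d * c" z] v UZ.m_closed UZ.add_pow_rdistr_int
        by (simp add: frag_extend_diff mult_ac del: UZ_simps)
    qed
    then show "frag_extend (\<lambda>(c, u). frag_of (d * c, v \<otimes>\<^bsub>UZ vs\<^esub> u)) g \<in> Dist_rel vs"
      by (rule Dist_rel_gen)
  qed
  have "Poly_Mapping.keys q \<subseteq> UNIV \<times> carrier (UZ vs)"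
    using q by simp
  then show ?thesis
  proof (induction q rule: frag_induction)
    case zero
    show ?case using Dist_rel_zero Dist_free_mult_diff_left[of vs 0 0 h] by simp
  next
    case (one x)
    then show ?case using gen by auto
  next
    case (diff a b)
    then show ?case by (simp add: Dist_free_mult_diff_left Dist_rel_diff)
  qed
qed

text \<open>The product in \<open>Dist vs\<close> is a union over all representatives; it collapses
  to one coset because the relations absorb multiplication on either side.\<close>

lemma Dist_mult:
  assumes p: "p \<in> carrier (Dist_base vs)" and q: "q \<in> carrier (Dist_base vs)"
  shows "Dist_cls vs p \<otimes>\<^bsub>Dist vs\<^esub> Dist_cls vs q = Dist_cls vs (Dist_free_mult vs p q)"
proof -
  have "Dist_cls vs (Dist_free_mult vs p' q') = Dist_cls vs (Dist_free_mult vs p q)"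
    if "p' \<in> Dist_cls vs p" "q' \<in> Dist_cls vs q" for p' q'
  proof -
    have "p' - p \<in> Dist_rel vs" and q': "q' - q \<in> Dist_rel vs"
      using that by (auto simp: Dist_cls_mem)
    then have 1: "Dist_free_mult vs (p' - p) q \<in> Dist_rel vs"
      using q by (intro Dist_rel_mult_left)
    have "p' \<in> carrier (Dist_base vs)"
      using p subgroup.mem_carrier[OF subgroup_Dist_rel \<open>p' - p \<in> _\<close>] keys_add[of "p' - p" p] by auto
    then have "Dist_free_mult vs p' (q' - q) \<in> Dist_rel vs"
      using q' by (intro Dist_rel_mult_right)
    \<comment> \<open>The usual splitting p'q' - pq = p'(q' - q) + (p' - p)q, with the sum written
      as a difference to match the available closure rule.\<close>
    then have "Dist_free_mult vs p' (q' - q) - (0 - Dist_free_mult vs (p' - p) q) \<in> Dist_rel vs"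
      using 1 by (intro Dist_rel_diff Dist_rel_zero)
    then show ?thesis
      unfolding Dist_cls_eq_iff
      by (simp add: Dist_free_mult_diff_left Dist_free_mult_diff_right)
  qed
  then have "(\<Union>p' \<in> Dist_cls vs p. \<Union>q' \<in> Dist_cls vs q. Dist_cls vs (Dist_free_mult vs p' q')) =
      (\<Union>p' \<in> Dist_cls vs p. \<Union>q' \<in> Dist_cls vs q. Dist_cls vs (Dist_free_mult vs p q))"
    by simp
  moreover have "p \<in> Dist_cls vs p" "q \<in> Dist_cls vs q"
    by (simp_all add: Dist_cls_mem Dist_rel_zero)
  then have "(\<Union>p' \<in> Dist_cls vs p. \<Union>q' \<in> Dist_cls vs q. Dist_cls vs (Dist_free_mult vs p q)) =
      Dist_cls vs (Dist_free_mult vs p q)"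
    by blast
  ultimately show ?thesis
    by (simp add: Dist_def)
qed

lemma frag_of_Dist_base: "u \<in> carrier (UZ vs) \<Longrightarrow> frag_of (c, u) \<in> carrier (Dist_base vs)"
  by simp

lemma Dist_elem_closed: "x \<in> int_form vs \<Longrightarrow> Dist_elem vs x \<in> carrier (Dist vs)"
  unfolding Dist_elem_def carrier_Dist by (intro imageI frag_of_Dist_base int_form_cls)

lemma Dist_elem_mult:
  "x \<in> int_form vs \<Longrightarrow> y \<in> int_form vs \<Longrightarrow>
    Dist_elem vs (x * y) = Dist_elem vs x \<otimes>\<^bsub>Dist vs\<^esub> Dist_elem vs y"
  unfolding Dist_elem_def
  by (subst Dist_mult) (auto simp: int_form_cls Dist_free_mult_of_left UC_cls_mult int_form_free_alg)

lemma Dist_elem_add: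
  assumes "x \<in> int_form vs" "y \<in> int_form vs"
  shows "(Dist_elem vs (x + y) :: 'k::field dist) = Dist_elem vs x \<oplus>\<^bsub>Dist vs\<^esub> Dist_elem vs y"
proof -
  have "frag_of (1 :: 'k, UC_cls vs x \<oplus>\<^bsub>UZ vs\<^esub> UC_cls vs y) - frag_of (1, UC_cls vs x)
      - frag_of (1, UC_cls vs y) \<in> Dist_rel vs"
    using assms by (intro Dist_rel_gen Dist_gens_add_right int_form_cls)
  then show ?thesis
    unfolding Dist_elem_def using assms
    by (subst Dist_add) (auto simp: int_form_cls Dist_cls_eq_iff UC_cls_add int_form_free_alg
        diff_diff_eq)
qed

lemma Dist_elem_one: "Dist_elem vs 1 = \<one>\<^bsub>Dist vs\<^esub>"
  by (simp add: Dist_elem_def Dist_def UC_cls_one)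

lemma Dist_scalar_closed: "Dist_scalar vs c \<in> carrier (Dist vs)"
  unfolding Dist_scalar_def carrier_Dist by (intro imageI frag_of_Dist_base UZ.one_closed)

lemma Dist_scalar_mult:
  "Dist_scalar vs (c * d) = Dist_scalar vs c \<otimes>\<^bsub>Dist vs\<^esub> Dist_scalar vs d"
proof -
  have "\<one>\<^bsub>UC vs\<^esub> \<in> carrier (UZ vs)" using UZ.one_closed[of vs] by simp
  then show ?thesis
    unfolding Dist_scalar_def by (subst Dist_mult) (auto simp: Dist_free_mult_of_left)
qed

lemma Dist_scalar_add:
  "(Dist_scalar vs (c + d) :: 'k::field dist) = Dist_scalar vs c \<oplus>\<^bsub>Dist vs\<^esub> Dist_scalar vs d"
proof -
  have "frag_of (c + d, \<one>\<^bsub>UZ vs\<^esub>) - frag_of (c, \<one>\<^bsub>UZ vs\<^esub>) - frag_of (d, \<one>\<^bsub>UZ vs\<^esub>) \<in> Dist_rel vs"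
    by (intro Dist_rel_gen Dist_gens_add_left UZ.one_closed)
  then show ?thesis
    unfolding Dist_scalar_def using UZ.one_closed[of vs]
    by (subst Dist_add) (auto simp: Dist_cls_eq_iff diff_diff_eq simp del: UZ_simps)
qed

lemma Dist_scalar_one: "Dist_scalar vs 1 = \<one>\<^bsub>Dist vs\<^esub>"
  by (simp add: Dist_scalar_def Dist_def)

lemma Dist_scalar_central:
  assumes "a \<in> carrier (Dist vs)"
  shows "Dist_scalar vs c \<otimes>\<^bsub>Dist vs\<^esub> a = a \<otimes>\<^bsub>Dist vs\<^esub> Dist_scalar vs c"
proof -
  obtain p where p: "p \<in> carrier (Dist_base vs)" and a: "a = Dist_cls vs p"
    using assms by (auto simp: carrier_Dist)
  have one: "\<one>\<^bsub>UC vs\<^esub> \<in> carrier (UZ vs)" using UZ.one_closed[of vs] by simp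
  have "frag_extend (\<lambda>(d, v). frag_of (c * d, \<one>\<^bsub>UC vs\<^esub> \<otimes>\<^bsub>UZ vs\<^esub> v)) p =
      frag_extend (\<lambda>(d, v). frag_of (d * c, v \<otimes>\<^bsub>UZ vs\<^esub> \<one>\<^bsub>UC vs\<^esub>)) p"
    using p carrier_UZ_subset[of vs] by (intro frag_extend_eq) (auto simp: mult.commute)
  then show ?thesis
    unfolding a Dist_scalar_def using p one
    by (simp add: Dist_mult Dist_free_mult_of_left Dist_free_mult_of_right)
qed

text \<open>Congruent products have equal classes, so z commutes with all of U_Z. On formal sums of
  pure tensors the two products then agree term by term, even before passing to the
  quotient.\<close>

lemma Dist_elem_central:
  assumes z: "central vs z" "z \<in> int_form vs" and "a \<in> carrier (Dist vs)"
  shows "Dist_elem vs z \<otimes>\<^bsub>Dist vs\<^esub> a = a \<otimes>\<^bsub>Dist vs\<^esub> Dist_elem vs z"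
proof -
  obtain p where p: "p \<in> carrier (Dist_base vs)" and a: "a = Dist_cls vs p"
    using assms by (auto simp: carrier_Dist)
  have "UC_cls vs z \<otimes>\<^bsub>UZ vs\<^esub> v = v \<otimes>\<^bsub>UZ vs\<^esub> UC_cls vs z" if v: "v \<in> carrier (UZ vs)" for v
  proof -
    obtain y where y: "y \<in> int_form vs" "v = UC_cls vs y"
      using v unfolding carrier_UZ by blast
    have "UC_cls vs (z * y) = UC_cls vs (y * z)"
      using z y int_form_free_alg
      by (intro UC_cls_cong) (auto simp: central_def intro: free_alg_mult)
    then show ?thesis
      using z y int_form_free_alg by (simp add: UC_cls_mult)
  qed
  then have "frag_extend (\<lambda>(d, v). frag_of (1 * d, UC_cls vs z \<otimes>\<^bsub>UZ vs\<^esub> v)) p =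
      frag_extend (\<lambda>(d, v). frag_of (d * 1, v \<otimes>\<^bsub>UZ vs\<^esub> UC_cls vs z)) p"
    using p by (intro frag_extend_eq) (auto simp del: UZ_simps)
  then show ?thesis
    unfolding a Dist_elem_def using p int_form_cls[OF z(2)]
    by (simp add: Dist_mult Dist_free_mult_of_left Dist_free_mult_of_right)
qed

lemma Dist_elem_even:
  assumes "x \<in> int_form vs" "x \<in> free_part vs False"
  shows "Dist_elem vs x \<in> ring_part (Dist vs) False"
  using assms int_form_cls[of x vs]
  by (auto simp: Dist_def Dist_elem_def UZ_part_def intro!: imageI)

lemma Dist_scalar_even: "Dist_scalar vs c \<in> ring_part (Dist vs) False"
proof -
  have "\<one>\<^bsub>UC vs\<^esub> \<in> UZ_part vs False"
    using UZ.one_closed[of vs] free_part_const[of 1 vs] UC_cls_one[of vs, symmetric]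
    by (auto simp: UZ_part_def)
  then show ?thesis
    by (auto simp: Dist_def Dist_scalar_def intro!: imageI)
qed

section \<open>Eigenvalues on a highest weight vector\<close>

definition acts :: "bool list \<Rightarrow> ('k::field dist, 'b) supermodule \<Rightarrow> 'b \<Rightarrow> fa \<Rightarrow> 'k \<Rightarrow> bool" where
  "acts vs M v x c \<longleftrightarrow> Dist_elem vs x \<odot>\<^bsub>M\<^esub> v = Dist_scalar vs c \<odot>\<^bsub>M\<^esub> v"

text \<open>The ring axioms of \<open>Dist vs\<close> are part of \<open>left_supermodule\<close>,
  so inside this locale the ring laws come with the module.\<close>

locale dist_module = left_supermodule "Dist vs" M
  for vs :: "bool list" and M :: "('k::field dist, 'b) supermodule"
begin

lemma Dist_scalar_zero: "(Dist_scalar vs 0 :: 'k dist) = \<zero>\<^bsub>Dist vs\<^esub>"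
proof -
  have "(Dist_scalar vs 0 :: 'k dist) = Dist_scalar vs 0 \<oplus>\<^bsub>Dist vs\<^esub> Dist_scalar vs 0"
    using Dist_scalar_add[of vs "0 :: 'k" 0] by simp
  then show ?thesis
    using Dist_scalar_closed[of vs "0 :: 'k"] R.add.l_cancel_one' by blast
qed

lemma Dist_elem_zero: "(Dist_elem vs 0 :: 'k dist) = \<zero>\<^bsub>Dist vs\<^esub>"
proof -
  have "(Dist_elem vs 0 :: 'k dist) \<in> carrier (Dist vs)"
    by (rule Dist_elem_closed[OF int_form_zero])
  moreover have "(Dist_elem vs 0 :: 'k dist) = Dist_elem vs 0 \<oplus>\<^bsub>Dist vs\<^esub> Dist_elem vs 0"
    using Dist_elem_add[OF int_form_zero int_form_zero, of vs] by simp
  ultimately show ?thesis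
    using R.add.l_cancel_one' by blast
qed

lemma Dist_scalar_uminus: "(Dist_scalar vs (- c) :: 'k dist) = \<ominus>\<^bsub>Dist vs\<^esub> Dist_scalar vs c"
  using Dist_scalar_add[of vs "- c" c] Dist_scalar_closed[of vs]
  by (intro R.minus_equality[symmetric]) (auto simp: Dist_scalar_zero)

lemma Dist_elem_uminus:
  assumes "x \<in> int_form vs"
  shows "(Dist_elem vs (- x) :: 'k dist) = \<ominus>\<^bsub>Dist vs\<^esub> Dist_elem vs x"
proof -
  have "(Dist_elem vs (- x) :: 'k dist) \<oplus>\<^bsub>Dist vs\<^esub> Dist_elem vs x = \<zero>\<^bsub>Dist vs\<^esub>"
    by (simp add: Dist_elem_add[OF int_form_uminus[OF assms] assms, symmetric] Dist_elem_zero)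
  then show ?thesis
    using R.minus_equality Dist_elem_closed[OF assms] Dist_elem_closed[OF int_form_uminus[OF assms]]
    by metis
qed

lemma smult_l_zero: "x \<in> carrier M \<Longrightarrow> \<zero>\<^bsub>Dist vs\<^esub> \<odot>\<^bsub>M\<^esub> x = \<zero>\<^bsub>M\<^esub>"
  using smult_l_distr[of "\<zero>\<^bsub>Dist vs\<^esub>" "\<zero>\<^bsub>Dist vs\<^esub>" x] smult_closed[of "\<zero>\<^bsub>Dist vs\<^esub>" x]
    M.add.l_cancel_one' by (metis R.l_zero R.zero_closed)

lemma smult_r_zero: "a \<in> carrier (Dist vs) \<Longrightarrow> a \<odot>\<^bsub>M\<^esub> \<zero>\<^bsub>M\<^esub> = \<zero>\<^bsub>M\<^esub>"
  using smult_r_distr[of a "\<zero>\<^bsub>M\<^esub>" "\<zero>\<^bsub>M\<^esub>"] smult_closed[of a "\<zero>\<^bsub>M\<^esub>"]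
    M.add.l_cancel_one' by (metis M.l_zero M.zero_closed)

lemma smult_l_minus:
  assumes "a \<in> carrier (Dist vs)" "x \<in> carrier M"
  shows "(\<ominus>\<^bsub>Dist vs\<^esub> a) \<odot>\<^bsub>M\<^esub> x = \<ominus>\<^bsub>M\<^esub> (a \<odot>\<^bsub>M\<^esub> x)"
  using assms smult_l_distr[of "\<ominus>\<^bsub>Dist vs\<^esub> a" a x]
  by (intro M.minus_equality[symmetric]) (auto simp: R.l_neg smult_l_zero smult_closed)

lemma smult_r_minus:
  assumes "a \<in> carrier (Dist vs)" "x \<in> carrier M"
  shows "a \<odot>\<^bsub>M\<^esub> (\<ominus>\<^bsub>M\<^esub> x) = \<ominus>\<^bsub>M\<^esub> (a \<odot>\<^bsub>M\<^esub> x)"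
  using assms smult_r_distr[of a "\<ominus>\<^bsub>M\<^esub> x" x]
  by (intro M.minus_equality[symmetric]) (auto simp: M.l_neg smult_r_zero smult_closed)

lemma scalar_smult_zero: "x \<in> carrier M \<Longrightarrow> Dist_scalar vs 0 \<odot>\<^bsub>M\<^esub> x = \<zero>\<^bsub>M\<^esub>"
  by (simp add: Dist_scalar_zero smult_l_zero)

lemma acts_ueq:
  assumes "acts vs M v x c" "ueq vs x y" "x \<in> int_form vs" "y \<in> int_form vs"
  shows "acts vs M v y c"
  using assms UC_cls_cong[of vs x y] by (simp add: acts_def Dist_elem_def int_form_free_alg)

end

locale dist_vector = dist_module vs M
  for vs :: "bool list" and M :: "('k::field dist, 'b) supermodule" +
  fixes v :: 'b
  assumes v_closed: "v \<in> carrier M"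
begin

lemma acts_zero: "acts vs M v 0 0"
  by (simp add: acts_def Dist_elem_zero Dist_scalar_zero)

lemma acts_one: "acts vs M v 1 1"
  by (simp add: acts_def Dist_elem_one Dist_scalar_one)

lemma acts_add:
  "acts vs M v x c \<Longrightarrow> acts vs M v y d \<Longrightarrow> x \<in> int_form vs \<Longrightarrow> y \<in> int_form vs \<Longrightarrow>
    acts vs M v (x + y) (c + d)"
  by (simp add: acts_def Dist_elem_add Dist_scalar_add smult_l_distr v_closed Dist_elem_closed
      Dist_scalar_closed)

lemma acts_uminus: "acts vs M v x c \<Longrightarrow> x \<in> int_form vs \<Longrightarrow> acts vs M v (- x) (- c)"
  by (simp add: acts_def Dist_elem_uminus Dist_scalar_uminus smult_l_minus v_closed Dist_elem_closed
      Dist_scalar_closed)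

lemma acts_diff:
  "acts vs M v x c \<Longrightarrow> acts vs M v y d \<Longrightarrow> x \<in> int_form vs \<Longrightarrow> y \<in> int_form vs \<Longrightarrow>
    acts vs M v (x - y) (c - d)"
  using acts_add[of x c "- y" "- d"] acts_uminus[of y d] int_form_uminus[of y vs] by simp

lemma acts_mult:
  assumes x: "acts vs M v x c" "x \<in> int_form vs" and y: "acts vs M v y d" "y \<in> int_form vs"
  shows "acts vs M v (x * y) (c * d)"
proof -
  note cl = v_closed x(2) y(2) Dist_elem_closed Dist_scalar_closed
  have "Dist_elem vs (x * y) \<odot>\<^bsub>M\<^esub> v = Dist_elem vs x \<odot>\<^bsub>M\<^esub> (Dist_scalar vs d \<odot>\<^bsub>M\<^esub> v)"
    using y(1) by (simp add: cl Dist_elem_mult smult_assoc acts_def)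
  also have "\<dots> = (Dist_scalar vs d \<otimes>\<^bsub>Dist vs\<^esub> Dist_elem vs x) \<odot>\<^bsub>M\<^esub> v"
    by (simp add: cl Dist_scalar_central smult_assoc)
  also have "\<dots> = Dist_scalar vs d \<odot>\<^bsub>M\<^esub> (Dist_scalar vs c \<odot>\<^bsub>M\<^esub> v)"
    using x(1) by (simp add: cl smult_assoc acts_def)
  also have "\<dots> = Dist_scalar vs (c * d) \<odot>\<^bsub>M\<^esub> v"
    by (simp add: cl Dist_scalar_mult mult.commute[of c] smult_assoc)
  finally show ?thesis by (simp add: acts_def)
qed

text \<open>The elements annihilating v form a left ideal; unlike in \<open>acts_mult\<close>, v
  need not be an eigenvector of x.\<close>

lemma acts_mult_zero:
  assumes "x \<in> int_form vs" "acts vs M v y 0" "y \<in> int_form vs"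
  shows "acts vs M v (x * y) 0"
  using assms v_closed
  by (simp add: acts_def Dist_elem_mult smult_assoc Dist_elem_closed scalar_smult_zero smult_r_zero)

lemma acts_psgn: "acts vs M v (psgn b) (psgn b)"
  by (simp add: psgn_def acts_one acts_uminus int_form_one)

lemma acts_psgn_mult:
  "acts vs M v x c \<Longrightarrow> x \<in> int_form vs \<Longrightarrow> acts vs M v (psgn b * x) (psgn b * c)"
  by (intro acts_mult acts_psgn int_form_psgn)

lemma acts_sum:
  "(\<And>t. t \<in> T \<Longrightarrow> acts vs M v (f t) (c t)) \<Longrightarrow> (\<And>t. t \<in> T \<Longrightarrow> f t \<in> int_form vs) \<Longrightarrow>
    acts vs M v (sum f T) (sum c T)"
  by (induction T rule: infinite_finite_induct) (auto intro!: acts_zero acts_add int_form_sum)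

end

definition diag_entry :: "bool list \<Rightarrow> weight \<Rightarrow> nat \<Rightarrow> int" where
  "diag_entry vs lam i = psgn (vbar vs i) * Poly_Mapping.lookup lam i
     + (\<Sum>k \<in> {k \<in> idx vs. i < k}. psgn (vbar vs k))"

text \<open>The eigenvalue on a highest weight vector of the i-th diagonal entry of A^r, A =
  (sigma_i e_ij). The recursion is triangular in i, with the a_i of the overview as diagonal
  coefficients.\<close>

fun Eeig :: "bool list \<Rightarrow> weight \<Rightarrow> nat \<Rightarrow> nat \<Rightarrow> int" where
  "Eeig vs lam 0 i = 1"
| "Eeig vs lam (Suc r) i = diag_entry vs lam i * Eeig vs lam r i
     - (\<Sum>k \<in> {k \<in> idx vs. i < k}. psgn (vbar vs k) * Eeig vs lam r k)"

fun Heig :: "weight \<Rightarrow> nat \<Rightarrow> nat \<Rightarrow> int" where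
  "Heig lam 0 r = (if r = 0 then 1 else 0)"
| "Heig lam (Suc l) r = (\<Sum>j \<le> r. Heig lam l (r - j) * int_binom (Poly_Mapping.lookup lam (Suc l)) j)"

text \<open>The weight and raising conditions determine the eigenvalues on v;
  \<open>generates\<close> then transports the eigenvalue of a central element from v to the whole
  module.\<close>

locale highest_weight_vector = dist_vector vs M v
  for vs :: "bool list" and M :: "('k::field dist, 'b) supermodule" and v :: 'b +
  fixes lam :: weight
  assumes acts_fa_binom: "i \<in> idx vs \<Longrightarrow> r \<ge> 1 \<Longrightarrow>
      acts vs M v (fa_binom i r) (of_int (int_binom (Poly_Mapping.lookup lam i) r))"
    and acts_raising: "i \<in> idx vs \<Longrightarrow> j \<in> idx vs \<Longrightarrow> i < j \<Longrightarrow> acts vs M v (letter i j) 0"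
    and generates: "m \<in> carrier M \<Longrightarrow> \<exists>a \<in> carrier (Dist vs). m = a \<odot>\<^bsub>M\<^esub> v"
begin

lemma acts_cartan:
  "i \<in> idx vs \<Longrightarrow> acts vs M v (letter i i) (of_int (Poly_Mapping.lookup lam i))"
  using acts_fa_binom[of i "Suc 0"] by (simp add: int_binom_def)

lemma psgn_of_int: "(psgn b :: 'k) = of_int (psgn b)"
  by (simp add: psgn_def)

text \<open>Both statements are proved together: whenever the left factor e_ik has i < k, it is
  moved to the right, where it kills v, and only a bracket made of entries of the r-th power
  remains.\<close>

lemma acts_Epow:
  "i \<in> idx vs \<Longrightarrow> j \<in> idx vs \<Longrightarrow> i < j \<Longrightarrow> acts vs M v (Epow vs r i j) 0"
  "i \<in> idx vs \<Longrightarrow> acts vs M v (Epow vs r i i) (of_int (psgn (vbar vs i) * Eeig vs lam r i))"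
proof (induction r arbitrary: i j)
  case 0
  {
    case 1
    then show ?case by (simp add: acts_zero)
  next
    case 2
    then show ?case using acts_psgn[of "vbar vs i"] by (simp add: psgn_of_int)
  }
next
  case (Suc r)
  \<comment> \<open>After the swap the product with e_ik on the right vanishes on v, so the product
    acts as its bracket does.\<close>
  have swap: "acts vs M v (letter i k * Epow vs r k j) c"
    if ijk: "i \<in> idx vs" "j \<in> idx vs" "k \<in> idx vs" "i < k" and c: "acts vs M v (Ebr vs r i k k j) c"
    for i j k c
  proof -
    let ?s = "psgn (ebar vs i k \<and> ebar vs k j)"
    have Ebr: "Ebr vs r i k k j \<in> int_form vs"
      using ijk unfolding Ebr_def
      by (intro int_form_diff int_form_mult int_form_psgn) (auto intro: int_form_Epow int_form_zero)
    have "acts vs M v (Epow vs r k j * letter i k) 0"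
      using ijk by (intro acts_mult_zero acts_raising int_form_Epow int_form_letter)
    then have "acts vs M v (?s * (Epow vs r k j * letter i k) + Ebr vs r i k k j) (?s * 0 + c)"
      using ijk Ebr c
      by (intro acts_add acts_psgn_mult int_form_mult int_form_psgn int_form_Epow int_form_letter)
    then show ?thesis
      using ijk Ebr acts_ueq[OF _ ueq_sym[OF Epow_bracket[of i vs k k j r]]]
      by (simp add: int_form_add int_form_mult int_form_psgn int_form_Epow int_form_letter)
  qed
  {
    case (1 i j)
    have "acts vs M v (letter i k * Epow vs r k j) 0" if k: "k \<in> idx vs" for k
    proof (cases "k < j")
      case True
      then show ?thesis
        using 1 k Suc.IH(1)[of k j] by (intro acts_mult_zero int_form_letter int_form_Epow)
    next
      \<comment> \<open>Here i < j \<le> k, so the swap applies. As i \<noteq> j, the bracket is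
        just \<open>Epow vs r i j\<close>, which kills v by induction.\<close>
      case False
      then show ?thesis
        using 1 k Suc.IH(1)[of i j] by (intro swap) (auto simp: Ebr_def)
    qed
    then have "acts vs M v (psgn (vbar vs k) * (letter i k * Epow vs r k j)) 0" if "k \<in> idx vs" for k
      using that 1 by (intro acts_mult_zero[OF int_form_psgn] int_form_mult int_form_letter int_form_Epow)
    then have "acts vs M v (Epow vs (Suc r) i j) (\<Sum>k \<in> idx vs. 0)"
      unfolding Epow.simps using 1
      by (intro acts_sum int_form_mult int_form_psgn int_form_letter int_form_Epow)
    then show ?case by simp
  next
    case (2 i)
    let ?\<sigma> = "\<lambda>k. psgn (vbar vs k) :: int"
    let ?y = "Eeig vs lam r"
    \<comment> \<open>The eigenvalue of e_ik times the (k, i) entry. For k < i that entry kills v;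
      for k = i the eigenvalues multiply; for k > i the swap leaves the difference of two diagonal
      entries.\<close>
    define c where "c k = (if k < i then 0
        else if k = i then Poly_Mapping.lookup lam i * (?\<sigma> i * ?y i)
        else ?\<sigma> i * (?y i - ?y k))" for k
    have "acts vs M v (letter i k * Epow vs r k i) (of_int (c k))" if k: "k \<in> idx vs" for k
    proof -
      consider "k < i" | "k = i" | "k > i" by linarith
      then show ?thesis
      proof cases
        case 1
        then show ?thesis
          using 2 k Suc.IH(1)[of k i]
          by (simp add: c_def acts_mult_zero int_form_letter int_form_Epow)
      next
        case 2
        then have "acts vs M v (letter i k * Epow vs r k i)
            (of_int (Poly_Mapping.lookup lam i) * of_int (?\<sigma> i * ?y i))"
          using k Suc.IH(2)[of i] by (intro acts_mult) (auto intro: acts_cartan int_form_letter int_form_Epow)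
        then show ?thesis using 2 by (simp add: c_def)
      next
        case 3
        have "acts vs M v (Epow vs r i i - psgn (ebar vs i k \<and> ebar vs k i) * Epow vs r k k)
            (of_int (?\<sigma> i * ?y i) - psgn (ebar vs i k \<and> ebar vs k i) * of_int (?\<sigma> k * ?y k))"
          using k 2 Suc.IH(2)
          by (intro acts_diff acts_psgn_mult int_form_mult int_form_psgn int_form_Epow) auto
        \<comment> \<open>The bracket sign is -1 exactly when the parities of i and k differ, hence
          equals sigma_i sigma_k and turns sigma_k into sigma_i.\<close>
        moreover have "?\<sigma> i * ?y i - psgn (ebar vs i k \<and> ebar vs k i) * (?\<sigma> k * ?y k) = c k"
          using 3 by (auto simp: c_def psgn_def ebar_def)
        ultimately show ?thesis
          using k 2 3 by (intro swap) (auto simp: Ebr_def psgn_of_int simp flip: of_int_mult of_int_diff)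
      qed
    qed
    then have "acts vs M v (Epow vs (Suc r) i i) (\<Sum>k \<in> idx vs. psgn (vbar vs k) * of_int (c k))"
      unfolding Epow.simps using 2
      by (intro acts_sum acts_psgn_mult int_form_mult int_form_psgn int_form_letter int_form_Epow)
    moreover have "(\<Sum>k \<in> idx vs. psgn (vbar vs k) * (of_int (c k) :: 'k)) =
        of_int (\<Sum>k \<in> idx vs. ?\<sigma> k * c k)"
      by (simp add: psgn_of_int)
    moreover have "(\<Sum>k \<in> idx vs. ?\<sigma> k * c k) = ?\<sigma> i * Eeig vs lam (Suc r) i"
    proof -
      have "(\<Sum>k \<in> idx vs. ?\<sigma> k * c k) =
          (\<Sum>k \<in> idx vs. (if k = i then Poly_Mapping.lookup lam i * ?y i else 0)
            + (if i < k then ?\<sigma> i * (?\<sigma> k * ?y i) - ?\<sigma> i * (?\<sigma> k * ?y k) else 0))"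
        by (intro sum.cong) (auto simp: c_def algebra_simps psgn_def)
      also have "\<dots> = Poly_Mapping.lookup lam i * ?y i
          + (\<Sum>k \<in> {k \<in> idx vs. i < k}. ?\<sigma> i * (?\<sigma> k * ?y i) - ?\<sigma> i * (?\<sigma> k * ?y k))"
        using 2 by (simp add: sum.distrib sum.inter_filter)
      also have "\<dots> = ?\<sigma> i * Eeig vs lam (Suc r) i"
        by (simp add: diag_entry_def sum_subtractf sum_distrib_left sum_distrib_right algebra_simps)
      finally show ?thesis .
    qed
    ultimately show ?case by metis
  }
qed

lemma acts_Gelfand:
  "acts vs M v (Gelfand vs r) (of_int (\<Sum>i \<in> idx vs. psgn (vbar vs i) * Eeig vs lam r i))"
proof -
  have "acts vs M v (Gelfand vs r) (\<Sum>i \<in> idx vs. of_int (psgn (vbar vs i) * Eeig vs lam r i))"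
    unfolding Gelfand_def by (intro acts_sum acts_Epow int_form_Epow)
  then show ?thesis by simp
qed

lemma acts_Hbin: "l \<le> length vs \<Longrightarrow> acts vs M v (Hbin l r) (of_int (Heig lam l r))"
proof (induction l arbitrary: r)
  case 0
  then show ?case by (simp add: acts_one acts_zero)
next
  case (Suc l)
  have l: "Suc l \<in> idx vs" using Suc.prems by (simp add: idx_def)
  have "acts vs M v (fa_binom (Suc l) j) (of_int (int_binom (Poly_Mapping.lookup lam (Suc l)) j))" for j
    using acts_fa_binom[OF l, of j] by (cases "j = 0") (auto simp: int_binom_def acts_one)
  then have "acts vs M v (Hbin (Suc l) r)
      (\<Sum>j \<le> r. of_int (Heig lam l (r - j)) * of_int (int_binom (Poly_Mapping.lookup lam (Suc l)) j))"
    unfolding Hbin.simps using Suc l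
    by (intro acts_sum acts_mult int_form_mult int_form_Hbin int_form_binom) auto
  then show ?case by simp
qed

text \<open>A general element is a v, and z a v = a z v = a c v = c a v, since both z and the
  scalars are central.\<close>

lemma central_acts:
  assumes z: "central vs z" "z \<in> int_form vs" "acts vs M v z c" and m: "m \<in> carrier M"
  shows "acts vs M m z c"
proof -
  obtain a where a: "a \<in> carrier (Dist vs)" "m = a \<odot>\<^bsub>M\<^esub> v"
    using generates[OF m] by blast
  have "Dist_elem vs z \<odot>\<^bsub>M\<^esub> m = a \<odot>\<^bsub>M\<^esub> (Dist_elem vs z \<odot>\<^bsub>M\<^esub> v)"
    using a z v_closed by (simp add: Dist_elem_central Dist_elem_closed flip: smult_assoc)
  also have "\<dots> = a \<odot>\<^bsub>M\<^esub> (Dist_scalar vs c \<odot>\<^bsub>M\<^esub> v)"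
    using z(3) by (simp add: acts_def)
  also have "\<dots> = Dist_scalar vs c \<odot>\<^bsub>M\<^esub> m"
    using a v_closed by (simp add: Dist_scalar_central Dist_scalar_closed flip: smult_assoc)
  finally show ?thesis by (simp add: acts_def)
qed

end

section \<open>The highest weight vector of an irreducible module\<close>

lemma int_form_raising:
  assumes "i \<in> idx vs" "j \<in> idx vs" "i < j" "a \<ge> 1" "ebar vs i j \<longrightarrow> a = 1"
  shows "fa_divpow i j a \<in> int_form vs"
proof (cases "ebar vs i j")
  case True
  then show ?thesis using assms int_form_letter[of i vs j] by simp
next
  case False
  then show ?thesis using assms by (intro int_form_gen UZ_gens_divpow) auto
qed

locale verma = dist_module vs L
  for vs :: "bool list" and L :: "('k::field dist, 'b) supermodule" +
  fixes W :: "('k dist, 'w) supermodule" and lam :: weight and \<pi>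
  assumes k_lambda: "is_k_lambda vs lam W"
    and hom: "even_hom (Dist vs) (Verma vs W) L \<pi>"
    and surj: "\<pi> ` carrier (Verma vs W) = carrier L"
begin

lemma Dist_B_gens_closed:
  "range (Dist_scalar vs) \<union> {Dist_elem vs (fa_binom i r) | i r. i \<in> idx vs \<and> r \<ge> 1}
    \<subseteq> carrier (Dist vs :: 'k dist superring)"
  by (auto intro: Dist_scalar_closed Dist_elem_closed int_form_binom)

lemma Dist_T_closed: "Dist_T vs \<subseteq> carrier (Dist vs :: 'k dist superring)"
  unfolding Dist_T_def by (rule R.generate_ring_incl[OF Dist_B_gens_closed])

lemma Dist_raising_closed: "Dist_raising vs \<subseteq> carrier (Dist vs :: 'k dist superring)"
  unfolding Dist_raising_def by (auto intro!: Dist_elem_closed int_form_raising)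

lemma carrier_Dist_B:
  "carrier (Dist_B vs :: 'k dist superring) = generate_ring (Dist vs) (Dist_T vs \<union> Dist_raising vs)"
  by (simp add: Dist_B_def Let_def)

lemma Dist_B_closed: "b \<in> carrier (Dist_B vs) \<Longrightarrow> b \<in> carrier (Dist vs :: 'k dist superring)"
  using R.generate_ring_incl[of "Dist_T vs \<union> Dist_raising vs"] Dist_T_closed Dist_raising_closed
  by (auto simp: carrier_Dist_B)

lemma Dist_B_scalar: "Dist_scalar vs c \<in> carrier (Dist_B vs :: 'k dist superring)"
  unfolding carrier_Dist_B Dist_T_def by (intro generate_ring.incl UnI1) auto

lemma Dist_B_binom:
  "i \<in> idx vs \<Longrightarrow> r \<ge> 1 \<Longrightarrow> Dist_elem vs (fa_binom i r) \<in> carrier (Dist_B vs :: 'k dist superring)"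
  unfolding carrier_Dist_B Dist_T_def
  by (rule generate_ring.incl, rule UnI1, rule generate_ring.incl) blast

lemma Dist_B_raising: "x \<in> Dist_raising vs \<Longrightarrow> x \<in> carrier (Dist_B vs :: 'k dist superring)"
  unfolding carrier_Dist_B by (intro generate_ring.incl UnI2)

lemma W_module: "left_supermodule (Dist_B vs) W"
  using k_lambda by (simp add: is_k_lambda_def)

interpretation W: left_supermodule "Dist_B vs" W
  by (rule W_module)

abbreviation "base \<equiv> free_Abelian_group (carrier (Dist vs) \<times> carrier W)"

text \<open>The generators of \<open>tensor_rel\<close> in inductive form, so that each kind of
  relation can be treated by case analysis.\<close>

inductive_set Verma_gens :: "(('k dist \<times> 'w) \<Rightarrow>\<^sub>0 int) set" where
  add_left: "x \<in> carrier (Dist vs) \<Longrightarrow> x' \<in> carrier (Dist vs) \<Longrightarrow> y \<in> carrier W \<Longrightarrow>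
    frag_of (x \<oplus>\<^bsub>Dist vs\<^esub> x', y) - frag_of (x, y) - frag_of (x', y) \<in> Verma_gens"
| add_right: "x \<in> carrier (Dist vs) \<Longrightarrow> y \<in> carrier W \<Longrightarrow> y' \<in> carrier W \<Longrightarrow>
    frag_of (x, y \<oplus>\<^bsub>W\<^esub> y') - frag_of (x, y) - frag_of (x, y') \<in> Verma_gens"
| balance: "x \<in> carrier (Dist vs) \<Longrightarrow> b \<in> carrier (Dist_B vs) \<Longrightarrow> y \<in> carrier W \<Longrightarrow>
    frag_of (x \<otimes>\<^bsub>Dist vs\<^esub> b, y) - frag_of (x, b \<odot>\<^bsub>W\<^esub> y) \<in> Verma_gens"

lemma Verma_free_eq: "Verma_free vs W = base"
  by (simp add: Verma_free_def tensor_free_def)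

lemma Verma_rel_eq: "Verma_rel vs W = generate base Verma_gens"
proof -
  have "Verma_gens =
      {frag_of (x \<oplus>\<^bsub>Dist vs\<^esub> x', y) - frag_of (x, y) - frag_of (x', y) |
         x x' y. x \<in> carrier (Dist vs) \<and> x' \<in> carrier (Dist vs) \<and> y \<in> carrier W} \<union>
      {frag_of (x, y \<oplus>\<^bsub>W\<^esub> y') - frag_of (x, y) - frag_of (x, y') |
         x y y'. x \<in> carrier (Dist vs) \<and> y \<in> carrier W \<and> y' \<in> carrier W} \<union>
      {frag_of (x \<otimes>\<^bsub>Dist vs\<^esub> b, y) - frag_of (x, b \<odot>\<^bsub>W\<^esub> y) |
         x b y. x \<in> carrier (Dist vs) \<and> b \<in> carrier (Dist_B vs) \<and> y \<in> carrier W}" (is "_ = ?G")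
  proof (intro equalityI subsetI)
    fix g assume "g \<in> Verma_gens"
    then show "g \<in> ?G" by cases blast+
  next
    fix g assume "g \<in> ?G"
    then show "g \<in> Verma_gens" by (blast intro: Verma_gens.intros)
  qed
  then show ?thesis
    unfolding Verma_rel_def tensor_rel_def tensor_free_def by simp
qed

lemma Verma_gens_closed: "Verma_gens \<subseteq> carrier base"
proof
  fix g assume "g \<in> Verma_gens"
  then show "g \<in> carrier base"
    by cases (simp_all add: keys_frag_diff_subset Dist_B_closed W.smult_closed)
qed

lemma subgroup_Verma_rel: "subgroup (Verma_rel vs W) base"
  unfolding Verma_rel_eq by (rule group.generate_is_subgroup[OF group_free_Abelian_group Verma_gens_closed])

lemma Verma_cls_eq_iff: "Verma_cls vs W p = Verma_cls vs W q \<longleftrightarrow> p - q \<in> Verma_rel vs W"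
  unfolding Verma_cls_def Verma_free_eq by (rule free_Abelian_group_coset_eq_iff[OF subgroup_Verma_rel])

lemma Verma_cls_mem: "q \<in> Verma_cls vs W p \<longleftrightarrow> q - p \<in> Verma_rel vs W"
  unfolding Verma_cls_def Verma_free_eq free_Abelian_group_coset
  by (auto intro!: image_eqI[of _ _ "q - p"])

lemma Verma_rel_gen: "g \<in> Verma_gens \<Longrightarrow> g \<in> Verma_rel vs W"
  unfolding Verma_rel_eq by (rule generate.incl)

lemma carrier_Verma: "carrier (Verma vs W) = Verma_cls vs W ` carrier base"
  by (auto simp: Verma_def FactGroup_def RCOSETS_def Verma_free_eq Verma_cls_def)

lemma Verma_add:
  "p \<in> carrier base \<Longrightarrow> q \<in> carrier base \<Longrightarrow>
    Verma_cls vs W p \<oplus>\<^bsub>Verma vs W\<^esub> Verma_cls vs W q = Verma_cls vs W (p + q)"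
  using free_Abelian_group_coset_add[OF subgroup_Verma_rel]
  by (simp add: Verma_def FactGroup_def Verma_free_eq Verma_cls_def)

abbreviation mul :: "'k dist \<Rightarrow> (('k dist \<times> 'w) \<Rightarrow>\<^sub>0 int) \<Rightarrow> (('k dist \<times> 'w) \<Rightarrow>\<^sub>0 int)" where
  "mul a \<equiv> frag_extend (\<lambda>(x, w). frag_of (a \<otimes>\<^bsub>Dist vs\<^esub> x, w))"

text \<open>As for \<open>Dist\<close>, left multiplication sends each generating relation to one of
  the same kind; for the balancing relations this is associativity.\<close>

lemma Verma_rel_mult:
  assumes a: "a \<in> carrier (Dist vs)" and h: "h \<in> Verma_rel vs W"
  shows "mul a h \<in> Verma_rel vs W"
proof (rule frag_extend_image[OF _ Verma_gens_closed subgroup_Verma_rel h[unfolded Verma_rel_eq]])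
  fix g assume "g \<in> Verma_gens"
  then have "mul a g \<in> Verma_gens"
  proof cases
    case (add_left x x' y)
    then show ?thesis
      using Verma_gens.add_left[of "a \<otimes>\<^bsub>Dist vs\<^esub> x" "a \<otimes>\<^bsub>Dist vs\<^esub> x'" y] a
      by (simp add: frag_extend_diff R.r_distr)
  next
    case (add_right x y y')
    then show ?thesis
      using Verma_gens.add_right[of "a \<otimes>\<^bsub>Dist vs\<^esub> x" y y'] a by (simp add: frag_extend_diff)
  next
    case (balance x b y)
    then show ?thesis
      using Verma_gens.balance[of "a \<otimes>\<^bsub>Dist vs\<^esub> x" b y] a
      by (simp add: frag_extend_diff R.m_assoc Dist_B_closed)
  qed
  then show "mul a g \<in> Verma_rel vs W" by (rule Verma_rel_gen)
qed

lemma Verma_smult: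
  assumes a: "a \<in> carrier (Dist vs)"
  shows "a \<odot>\<^bsub>Verma vs W\<^esub> Verma_cls vs W p = Verma_cls vs W (mul a p)"
proof -
  have "Verma_cls vs W (mul a p') = Verma_cls vs W (mul a p)" if "p' \<in> Verma_cls vs W p" for p'
    using Verma_rel_mult[OF a, of "p' - p"] that
    by (simp add: Verma_cls_mem Verma_cls_eq_iff frag_extend_diff)
  then have "(\<Union>p' \<in> Verma_cls vs W p. Verma_cls vs W (mul a p')) =
      (\<Union>p' \<in> Verma_cls vs W p. Verma_cls vs W (mul a p))"
    by simp
  moreover have "p \<in> Verma_cls vs W p"
    using subgroup.one_closed[OF subgroup_Verma_rel] by (simp add: Verma_cls_mem)
  ultimately have "(\<Union>p' \<in> Verma_cls vs W p. Verma_cls vs W (mul a p')) = Verma_cls vs W (mul a p)"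
    by blast
  then show ?thesis by (simp add: Verma_def)
qed

definition img :: "'k dist \<Rightarrow> 'w \<Rightarrow> 'b" where
  "img a w = \<pi> (Verma_cls vs W (frag_of (a, w)))"

lemma frag_Verma:
  "a \<in> carrier (Dist vs) \<Longrightarrow> w \<in> carrier W \<Longrightarrow> Verma_cls vs W (frag_of (a, w)) \<in> carrier (Verma vs W)"
  unfolding carrier_Verma by (intro imageI) simp

lemma img_closed: "a \<in> carrier (Dist vs) \<Longrightarrow> w \<in> carrier W \<Longrightarrow> img a w \<in> carrier L"
  using frag_Verma surj by (auto simp: img_def)

lemma img_smult:
  assumes "a \<in> carrier (Dist vs)" "x \<in> carrier (Dist vs)" "w \<in> carrier W"
  shows "a \<odot>\<^bsub>L\<^esub> img x w = img (a \<otimes>\<^bsub>Dist vs\<^esub> x) w"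
proof -
  have "a \<odot>\<^bsub>L\<^esub> img x w = \<pi> (a \<odot>\<^bsub>Verma vs W\<^esub> Verma_cls vs W (frag_of (x, w)))"
    using hom assms frag_Verma by (simp add: even_hom_def img_def)
  then show ?thesis by (simp add: Verma_smult assms img_def)
qed

lemma img_balance:
  assumes "a \<in> carrier (Dist vs)" "b \<in> carrier (Dist_B vs)" "w \<in> carrier W"
  shows "img (a \<otimes>\<^bsub>Dist vs\<^esub> b) w = img a (b \<odot>\<^bsub>W\<^esub> w)"
  using Verma_gens.balance[OF assms, THEN Verma_rel_gen]
  unfolding img_def by (simp flip: Verma_cls_eq_iff)

lemma hom_add:
  "p \<in> carrier base \<Longrightarrow> q \<in> carrier base \<Longrightarrow>
    \<pi> (Verma_cls vs W (p + q)) = \<pi> (Verma_cls vs W p) \<oplus>\<^bsub>L\<^esub> \<pi> (Verma_cls vs W q)"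
  using hom by (simp add: even_hom_def carrier_Verma flip: Verma_add)

lemma hom_closed: "p \<in> carrier base \<Longrightarrow> \<pi> (Verma_cls vs W p) \<in> carrier L"
  using surj unfolding carrier_Verma by blast

lemma hom_zero: "\<pi> (Verma_cls vs W 0) = \<zero>\<^bsub>L\<^esub>"
  using hom_add[of 0 0] hom_closed[of 0] M.add.l_cancel_one' by simp

lemma img_zero: "img \<one>\<^bsub>Dist vs\<^esub> \<zero>\<^bsub>W\<^esub> = \<zero>\<^bsub>L\<^esub>"
proof -
  have "frag_of (\<one>\<^bsub>Dist vs\<^esub>, \<zero>\<^bsub>W\<^esub> \<oplus>\<^bsub>W\<^esub> \<zero>\<^bsub>W\<^esub>) - frag_of (\<one>\<^bsub>Dist vs\<^esub>, \<zero>\<^bsub>W\<^esub>) - frag_of (\<one>\<^bsub>Dist vs\<^esub>, \<zero>\<^bsub>W\<^esub>)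
      \<in> Verma_rel vs W"
    by (intro Verma_rel_gen Verma_gens.add_right) auto
  then have "0 - frag_of (\<one>\<^bsub>Dist vs\<^esub>, \<zero>\<^bsub>W\<^esub>) \<in> Verma_rel vs W"
    by simp
  then show ?thesis
    unfolding img_def using hom_zero Verma_cls_eq_iff by metis
qed

text \<open>In the tensor product b(1 \<otimes> w) = b \<otimes> w = 1 \<otimes> bw, so the
  relations known for w in the module of the Borel subalgebra pass to the image of 1 \<otimes>
  w.\<close>

lemma smult_img_one:
  assumes "b \<in> carrier (Dist_B vs)" "w \<in> carrier W"
  shows "b \<odot>\<^bsub>L\<^esub> img \<one>\<^bsub>Dist vs\<^esub> w = img \<one>\<^bsub>Dist vs\<^esub> (b \<odot>\<^bsub>W\<^esub> w)"
  using assms Dist_B_closed[of b] img_smult[of b "\<one>\<^bsub>Dist vs\<^esub>" w]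
    img_balance[of "\<one>\<^bsub>Dist vs\<^esub>" b w] by simp

text \<open>The vector is the image of 1 \<otimes> w, where w spans the one-dimensional module
  W.\<close>

lemma highest_weight_vector_exists: "\<exists>v. highest_weight_vector vs L v lam"
proof -
  obtain w where w: "w \<in> carrier W" and W_eq: "carrier W = range (\<lambda>c. Dist_scalar vs c \<odot>\<^bsub>W\<^esub> w)"
    using k_lambda unfolding is_k_lambda_def by blast
  define v where "v = img \<one>\<^bsub>Dist vs\<^esub> w"
  have v: "v \<in> carrier L"
    by (simp add: v_def img_closed w)
  have binom: "binom_acts vs W lam w" and raise: "\<And>x. x \<in> Dist_raising vs \<Longrightarrow> x \<odot>\<^bsub>W\<^esub> w = \<zero>\<^bsub>W\<^esub>"
    using k_lambda w unfolding is_k_lambda_def by auto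
  have img_gen: "img x w' \<in> {a \<odot>\<^bsub>L\<^esub> v | a. a \<in> carrier (Dist vs)}"
    if x: "x \<in> carrier (Dist vs)" and w': "w' \<in> carrier W" for x w'
  proof -
    obtain c where c: "w' = Dist_scalar vs c \<odot>\<^bsub>W\<^esub> w"
      using w' W_eq by auto
    \<comment> \<open>Since w' = c w, the scalar moves across the tensor sign, and x \<otimes> w' =
      xc \<otimes> w is xc applied to 1 \<otimes> w. The next fact extends this to formal sums,
      because the multiples of v are closed under differences.\<close>
    have "img x w' = img (x \<otimes>\<^bsub>Dist vs\<^esub> Dist_scalar vs c) w"
      using x w c img_balance[OF x Dist_B_scalar w] by simp
    also have "\<dots> = (x \<otimes>\<^bsub>Dist vs\<^esub> Dist_scalar vs c) \<odot>\<^bsub>L\<^esub> v"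
      using x w img_smult[of "x \<otimes>\<^bsub>Dist vs\<^esub> Dist_scalar vs c" "\<one>\<^bsub>Dist vs\<^esub>" w]
      by (simp add: v_def Dist_scalar_closed)
    finally show ?thesis using x Dist_scalar_closed by blast
  qed
  have gen: "\<pi> (Verma_cls vs W p) \<in> {a \<odot>\<^bsub>L\<^esub> v | a. a \<in> carrier (Dist vs)}"
    if "p \<in> carrier base" for p
  proof -
    have "Poly_Mapping.keys p \<subseteq> carrier (Dist vs) \<times> carrier W"
      using that by simp
    then show ?thesis
    proof (induction p rule: free_Abelian_group_induct[consumes 1, case_names zero diff one])
      case zero
      have "\<pi> (Verma_cls vs W 0) = \<zero>\<^bsub>Dist vs\<^esub> \<odot>\<^bsub>L\<^esub> v"
        by (simp add: hom_zero smult_l_zero v)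
      then show ?case by blast
    next
      case (diff p q)
      obtain a b where a: "a \<in> carrier (Dist vs)" "\<pi> (Verma_cls vs W p) = a \<odot>\<^bsub>L\<^esub> v"
        and b: "b \<in> carrier (Dist vs)" "\<pi> (Verma_cls vs W q) = b \<odot>\<^bsub>L\<^esub> v"
        using diff(3,4) by blast
      have pq: "p - q \<in> carrier base"
        using diff(1,2) by (simp add: keys_frag_diff_subset)
      have "\<pi> (Verma_cls vs W p) = \<pi> (Verma_cls vs W (p - q)) \<oplus>\<^bsub>L\<^esub> b \<odot>\<^bsub>L\<^esub> v"
        using hom_add[OF pq, of q] diff(2) b by simp
      moreover have "(a \<ominus>\<^bsub>Dist vs\<^esub> b) \<odot>\<^bsub>L\<^esub> v \<oplus>\<^bsub>L\<^esub> b \<odot>\<^bsub>L\<^esub> v = a \<odot>\<^bsub>L\<^esub> v"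
        using a b v by (simp add: R.minus_eq R.a_assoc R.l_neg flip: smult_l_distr)
      ultimately have "\<pi> (Verma_cls vs W (p - q)) = (a \<ominus>\<^bsub>Dist vs\<^esub> b) \<odot>\<^bsub>L\<^esub> v"
        using a b v hom_closed[OF pq]
        by (metis M.add.right_cancel R.minus_closed smult_closed)
      then show ?case using a b by blast
    next
      case (one xw)
      then show ?case using img_gen unfolding img_def by auto
    qed
  qed
  have "highest_weight_vector vs L v lam"
  proof (unfold_locales, goal_cases)
    case 1
    show ?case by (rule v)
  next
    case (2 i r)
    have "Dist_elem vs (fa_binom i r) \<odot>\<^bsub>W\<^esub> w =
       Dist_scalar vs (of_int (int_binom (Poly_Mapping.lookup lam i) r)) \<odot>\<^bsub>W\<^esub> w"
      using binom 2 unfolding binom_acts_def by blast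
    then show ?case
      using smult_img_one[OF Dist_B_binom[OF 2] w] smult_img_one[OF Dist_B_scalar w]
      by (simp add: acts_def v_def)
  next
    case (3 i j)
    \<comment> \<open>Exponent 1 is allowed for even and odd root vectors alike, and there the
      divided power is the letter.\<close>
    have "Dist_elem vs (fa_divpow i j (Suc 0)) \<in> Dist_raising vs"
      unfolding Dist_raising_def using 3
      by - (rule CollectI, rule exI[of _ i], rule exI[of _ j], rule exI[of _ "Suc 0"], simp)
    then have x: "Dist_elem vs (letter i j) \<in> Dist_raising vs"
      by simp
    have "Dist_elem vs (letter i j) \<odot>\<^bsub>L\<^esub> v = \<zero>\<^bsub>L\<^esub>"
      using smult_img_one[OF Dist_B_raising[OF x] w] raise[OF x] img_zero by (simp add: v_def)
    then show ?case
      by (simp add: acts_def scalar_smult_zero v)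
  next
    case (4 m)
    then obtain p where "p \<in> carrier base" "m = \<pi> (Verma_cls vs W p)"
      using surj unfolding carrier_Verma by blast
    then show ?case using gen by blast
  qed
  then show ?thesis by blast
qed

end

lemma is_L_highest_weight_vector:
  fixes L :: "('k::field dist, 'b) supermodule"
  assumes "is_L vs lam L"
  obtains v where "highest_weight_vector vs L v lam"
proof -
  obtain W :: "('k dist, 'k) supermodule" and \<pi> where W: "is_k_lambda vs lam W"
    "even_hom (Dist vs) (Verma vs W) L \<pi>" "\<pi> ` carrier (Verma vs W) = carrier L"
    using assms unfolding is_L_def by blast
  have "left_supermodule (Dist vs) L"
    using assms by (simp add: is_L_def irreducible_supermodule_def)
  then interpret verma vs L W lam \<pi>
    using W by (simp add: verma_def verma_axioms_def dist_module_def)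
  show ?thesis
    using highest_weight_vector_exists that by blast
qed

section \<open>Extensions split along eigenvalues of central elements\<close>

lemma (in left_supermodule) mod_part_closed: "x \<in> mod_part M p \<Longrightarrow> x \<in> carrier M"
  using additive_subgroup.a_subset[OF part_subgroup[of p]] by blast

lemma (in left_supermodule) eq_if_minus_zero:
  assumes "x \<ominus>\<^bsub>M\<^esub> y = \<zero>\<^bsub>M\<^esub>" "x \<in> carrier M" "y \<in> carrier M"
  shows "x = y"
proof -
  have "x = (x \<ominus>\<^bsub>M\<^esub> y) \<oplus>\<^bsub>M\<^esub> y"
    using assms(2,3) by (simp add: M.minus_eq M.a_assoc M.l_neg)
  then show ?thesis
    using assms by simp
qed

lemma (in left_supermodule) part_inter: "x \<in> mod_part M p \<Longrightarrow> x \<in> mod_part M (\<not> p) \<Longrightarrow> x = \<zero>\<^bsub>M\<^esub>"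
  using part_disjoint by (cases p) auto

lemma (in left_supermodule) part_minus:
  "x \<in> mod_part M p \<Longrightarrow> y \<in> mod_part M p \<Longrightarrow> x \<ominus>\<^bsub>M\<^esub> y \<in> mod_part M p"
  using additive_subgroup.a_closed[OF part_subgroup[of p]]
    additive_subgroup.a_inv_closed[OF part_subgroup[of p]] by (simp add: M.minus_eq)

lemma (in left_supermodule) part_decomp:
  assumes "x \<in> carrier M"
  obtains y z where "y \<in> mod_part M p" "z \<in> mod_part M (\<not> p)" "x = y \<oplus>\<^bsub>M\<^esub> z"
proof -
  obtain y z where yz: "y \<in> mod_part M False" "z \<in> mod_part M True" "x = y \<oplus>\<^bsub>M\<^esub> z"
    using part_sum[OF assms] by blast
  then have "x = z \<oplus>\<^bsub>M\<^esub> y"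
    using M.a_comm mod_part_closed by blast
  then show thesis
    using yz that[of y z] that[of z y] by (cases p) auto
qed

text \<open>The difference y - y' = z' - z lies in both parts and therefore vanishes.\<close>

lemma (in left_supermodule) part_decomp_unique:
  assumes "y \<in> mod_part M p" "z \<in> mod_part M (\<not> p)" "y' \<in> mod_part M p" "z' \<in> mod_part M (\<not> p)"
    and eq: "y \<oplus>\<^bsub>M\<^esub> z = y' \<oplus>\<^bsub>M\<^esub> z'"
  shows "y = y'" "z = z'"
proof -
  note cl = assms(1-4)[THEN mod_part_closed]
  have "y = (y \<oplus>\<^bsub>M\<^esub> z) \<ominus>\<^bsub>M\<^esub> z"
    using cl by (simp add: M.minus_eq M.a_assoc M.r_neg)
  also have "\<dots> = (z' \<ominus>\<^bsub>M\<^esub> z) \<oplus>\<^bsub>M\<^esub> y'"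
    unfolding eq using cl by (simp add: M.minus_eq M.a_ac)
  finally have "y \<ominus>\<^bsub>M\<^esub> y' = ((z' \<ominus>\<^bsub>M\<^esub> z) \<oplus>\<^bsub>M\<^esub> y') \<ominus>\<^bsub>M\<^esub> y'"
    by simp
  also have "\<dots> = z' \<ominus>\<^bsub>M\<^esub> z"
    using cl by (simp add: M.minus_eq M.a_assoc M.r_neg)
  finally have "y \<ominus>\<^bsub>M\<^esub> y' = z' \<ominus>\<^bsub>M\<^esub> z" .
  then have "y \<ominus>\<^bsub>M\<^esub> y' = \<zero>\<^bsub>M\<^esub>"
    using part_minus[OF assms(1,3)] part_minus[OF assms(4,2)] part_inter[of "y \<ominus>\<^bsub>M\<^esub> y'" p] by simp
  then show y: "y = y'"
    using cl eq_if_minus_zero by blast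
  then show "z = z'"
    using eq cl by simp
qed

lemma (in left_supermodule) parity_involution_closed:
  assumes "x \<in> carrier M"
  shows "parity_involution M x \<in> carrier M"
proof -
  obtain y z where yz: "y \<in> mod_part M False" "z \<in> mod_part M True" "x = y \<oplus>\<^bsub>M\<^esub> z"
    using part_sum[OF assms] by blast
  have "parity_involution M x = y \<ominus>\<^bsub>M\<^esub> z"
    unfolding parity_involution_def
  proof (rule the_equality)
    show "\<exists>x0 \<in> mod_part M False. \<exists>x1 \<in> mod_part M True. x = x0 \<oplus>\<^bsub>M\<^esub> x1 \<and> y \<ominus>\<^bsub>M\<^esub> z = x0 \<ominus>\<^bsub>M\<^esub> x1"
      using yz by blast
  next
    fix u
    assume "\<exists>x0 \<in> mod_part M False. \<exists>x1 \<in> mod_part M True. x = x0 \<oplus>\<^bsub>M\<^esub> x1 \<and> u = x0 \<ominus>\<^bsub>M\<^esub> x1"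
    then obtain x0 x1 where "x0 \<in> mod_part M False" "x1 \<in> mod_part M True" "x = x0 \<oplus>\<^bsub>M\<^esub> x1"
      "u = x0 \<ominus>\<^bsub>M\<^esub> x1" by blast
    then show "u = y \<ominus>\<^bsub>M\<^esub> z"
      using part_decomp_unique[of y False z x0 x1] yz by simp
  qed
  then show ?thesis
    using yz mod_part_closed by simp
qed

text \<open>The shift conjugates the actions of z and of the scalar by the same involution, so the
  eigenvalue equation for M at the involuted vector, followed by the involution, gives the one for
  the shift.\<close>

lemma acts_parity_shift:
  assumes "left_supermodule (Dist vs) M" "\<And>m. m \<in> carrier M \<Longrightarrow> acts vs M m z c"
    and "m \<in> carrier (parity_shift M)"
  shows "acts vs (parity_shift M) m z c"
  using assms left_supermodule.parity_involution_closed[OF assms(1), of m]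
  by (simp add: acts_def parity_shift_def)

text \<open>The element u = (z - d)/(c - d) is 0 on N and 1 on M. Hence u e depends only on
  \<open>g e\<close>, and e \<mapsto> u e factors through g to a map from M to E. It is linear
  because u is central, preserves parity because u is even, and is a section because u is 1 on
  M.\<close>

lemma extension_splits:
  fixes N :: "('k::field dist, 'b) supermodule" and E :: "('k dist, 'e) supermodule"
    and M :: "('k dist, 'c) supermodule"
  assumes N: "left_supermodule (Dist vs) N" and E: "left_supermodule (Dist vs) E"
    and M: "left_supermodule (Dist vs) M"
    and ex: "short_exact (Dist vs) N f E g M"
    and z: "central vs z" "z \<in> int_form vs" "z \<in> free_part vs False"
    and actM: "\<And>m. m \<in> carrier M \<Longrightarrow> acts vs M m z c"
    and actN: "\<And>n. n \<in> carrier N \<Longrightarrow> acts vs N n z d"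
    and cd: "c \<noteq> d"
  shows "splits (Dist vs) E g M"
proof -
  interpret N: dist_module vs N using N by (simp add: dist_module_def)
  interpret E: dist_module vs E using E by (simp add: dist_module_def)
  interpret M: dist_module vs M using M by (simp add: dist_module_def)
  have f: "even_hom (Dist vs) N E f" and g: "even_hom (Dist vs) E M g"
    and ker: "f ` carrier N = {x \<in> carrier E. g x = \<zero>\<^bsub>M\<^esub>}" and surj: "g ` carrier E = carrier M"
    using ex by (auto simp: short_exact_def)
  have g_closed: "g e \<in> carrier M" if "e \<in> carrier E" for e
    using that surj by blast
  have g_add: "g (e \<oplus>\<^bsub>E\<^esub> e') = g e \<oplus>\<^bsub>M\<^esub> g e'" if "e \<in> carrier E" "e' \<in> carrier E" for e e'
    using g that by (simp add: even_hom_def)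
  have g_smult: "g (a \<odot>\<^bsub>E\<^esub> e) = a \<odot>\<^bsub>M\<^esub> g e" if "a \<in> carrier (Dist vs)" "e \<in> carrier E" for a e
    using g that by (simp add: even_hom_def)
  have g_part: "g e \<in> mod_part M p" if "e \<in> mod_part E p" for e p
    using g that unfolding even_hom_def by blast
  have f_closed: "f n \<in> carrier E" if "n \<in> carrier N" for n
    using f that by (auto simp: even_hom_def)
  have f_smult: "f (a \<odot>\<^bsub>N\<^esub> n) = a \<odot>\<^bsub>E\<^esub> f n" if "a \<in> carrier (Dist vs)" "n \<in> carrier N" for a n
    using f that by (simp add: even_hom_def)
  have f_zero: "f \<zero>\<^bsub>N\<^esub> = \<zero>\<^bsub>E\<^esub>"
    using f_smult[OF N.R.zero_closed, of "\<zero>\<^bsub>N\<^esub>"] f_closed[of "\<zero>\<^bsub>N\<^esub>"]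
    by (simp add: N.smult_l_zero E.smult_l_zero)
  define u :: "'k dist" where
    "u = Dist_scalar vs (inverse (c - d)) \<otimes>\<^bsub>Dist vs\<^esub> (Dist_elem vs z \<ominus>\<^bsub>Dist vs\<^esub> Dist_scalar vs d)"
  note cl = Dist_scalar_closed Dist_elem_closed[OF z(2)]
  have u_closed: "u \<in> carrier (Dist vs)"
    by (simp add: u_def cl)
  have u_central: "u \<otimes>\<^bsub>Dist vs\<^esub> a = a \<otimes>\<^bsub>Dist vs\<^esub> u" if a: "a \<in> carrier (Dist vs)" for a
  proof -
    let ?y = "Dist_elem vs z \<ominus>\<^bsub>Dist vs\<^esub> Dist_scalar vs d" and ?s = "Dist_scalar vs (inverse (c - d))"
    have y: "?y \<otimes>\<^bsub>Dist vs\<^esub> a = a \<otimes>\<^bsub>Dist vs\<^esub> ?y"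
      using a by (simp add: N.R.minus_eq N.R.l_distr N.R.r_distr N.R.l_minus N.R.r_minus cl
          Dist_elem_central z Dist_scalar_central)
    have "u \<otimes>\<^bsub>Dist vs\<^esub> a = ?s \<otimes>\<^bsub>Dist vs\<^esub> (a \<otimes>\<^bsub>Dist vs\<^esub> ?y)"
      using a by (simp add: u_def N.R.m_assoc cl y)
    also have "\<dots> = a \<otimes>\<^bsub>Dist vs\<^esub> u"
      using a by (simp add: u_def cl Dist_scalar_central flip: N.R.m_assoc)
    finally show ?thesis .
  qed
  have uN: "u \<odot>\<^bsub>N\<^esub> n = \<zero>\<^bsub>N\<^esub>" if n: "n \<in> carrier N" for n
    using actN[OF n] n
    by (simp add: u_def acts_def N.smult_assoc N.R.minus_eq N.smult_l_distr N.smult_l_minus cl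
        N.smult_closed N.M.r_neg N.smult_r_zero)
  have uM: "u \<odot>\<^bsub>M\<^esub> m = m" if m: "m \<in> carrier M" for m
  proof -
    have "(Dist_elem vs z \<ominus>\<^bsub>Dist vs\<^esub> Dist_scalar vs d) \<odot>\<^bsub>M\<^esub> m = Dist_scalar vs (c - d) \<odot>\<^bsub>M\<^esub> m"
      using actM[OF m] m Dist_scalar_add[of vs c "- d"]
      by (simp add: acts_def N.R.minus_eq M.smult_l_distr cl M.Dist_scalar_uminus)
    then have "u \<odot>\<^bsub>M\<^esub> m = Dist_scalar vs (inverse (c - d)) \<odot>\<^bsub>M\<^esub> (Dist_scalar vs (c - d) \<odot>\<^bsub>M\<^esub> m)"
      using m by (simp add: u_def M.smult_assoc cl)
    also have "\<dots> = Dist_scalar vs (inverse (c - d) * (c - d)) \<odot>\<^bsub>M\<^esub> m"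
      using m by (simp only: Dist_scalar_mult M.smult_assoc cl)
    finally show ?thesis
      using m cd by (simp add: Dist_scalar_one M.smult_one)
  qed
  have u_part: "u \<odot>\<^bsub>E\<^esub> e \<in> mod_part E p" if e: "e \<in> mod_part E p" for e p
  proof -
    have *: "a \<odot>\<^bsub>E\<^esub> x \<in> mod_part E p" if "a \<in> ring_part (Dist vs) False" "x \<in> mod_part E p" for a x
      using E.part_smult[OF that] by simp
    have "u \<odot>\<^bsub>E\<^esub> e = Dist_scalar vs (inverse (c - d)) \<odot>\<^bsub>E\<^esub>
        (Dist_elem vs z \<odot>\<^bsub>E\<^esub> e \<ominus>\<^bsub>E\<^esub> Dist_scalar vs d \<odot>\<^bsub>E\<^esub> e)"
      using E.mod_part_closed[OF e]
      by (simp add: u_def E.smult_assoc N.R.minus_eq E.smult_l_distr E.smult_l_minus cl E.M.minus_eq)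
    then show ?thesis
      using e by (simp add: * E.part_minus Dist_scalar_even Dist_elem_even z)
  qed
  have u_eq: "u \<odot>\<^bsub>E\<^esub> e = u \<odot>\<^bsub>E\<^esub> e'" if e: "e \<in> carrier E" "e' \<in> carrier E" and eq: "g e = g e'" for e e'
  proof -
    have "g (e \<ominus>\<^bsub>E\<^esub> e') \<oplus>\<^bsub>M\<^esub> g e' = g e"
      using e by (simp add: E.M.minus_eq E.M.a_assoc E.M.l_neg flip: g_add)
    then have "g (e \<ominus>\<^bsub>E\<^esub> e') = \<zero>\<^bsub>M\<^esub>"
      using eq g_closed e M.M.add.r_cancel_one by simp
    then obtain n where n: "n \<in> carrier N" "e \<ominus>\<^bsub>E\<^esub> e' = f n"
      using ker e by blast
    then have "u \<odot>\<^bsub>E\<^esub> (e \<ominus>\<^bsub>E\<^esub> e') = \<zero>\<^bsub>E\<^esub>"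
      using f_smult[OF u_closed n(1)] by (simp add: uN f_zero)
    moreover have "u \<odot>\<^bsub>E\<^esub> (e \<ominus>\<^bsub>E\<^esub> e') = u \<odot>\<^bsub>E\<^esub> e \<ominus>\<^bsub>E\<^esub> u \<odot>\<^bsub>E\<^esub> e'"
      using e u_closed by (simp add: E.M.minus_eq E.smult_r_distr E.smult_r_minus)
    ultimately show ?thesis
      using E.eq_if_minus_zero E.smult_closed[OF u_closed] e by simp
  qed
  \<comment> \<open>An arbitrary preimage under g; \<open>s_eq\<close> below shows that applying u
    removes the dependence on the choice.\<close>
  define pick where "pick x = (SOME e. e \<in> carrier E \<and> g e = x)" for x
  have pick: "pick x \<in> carrier E" "g (pick x) = x" if "x \<in> carrier M" for x
  proof -
    have "x \<in> g ` carrier E" using that surj by simp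
    then have "\<exists>e. e \<in> carrier E \<and> g e = x" by blast
    from someI_ex[OF this] show "pick x \<in> carrier E" "g (pick x) = x"
      by (auto simp: pick_def)
  qed
  define s where "s x = u \<odot>\<^bsub>E\<^esub> pick x" for x
  have s_eq: "s x = u \<odot>\<^bsub>E\<^esub> e" if "e \<in> carrier E" "g e = x" for x e
  proof -
    have "x \<in> carrier M" using that g_closed by blast
    then show ?thesis
      unfolding s_def using that pick by (intro u_eq) simp_all
  qed
  have "even_hom (Dist vs) M E s"
    unfolding even_hom_def
  proof (intro conjI ballI allI funcsetI image_subsetI)
    fix x assume x: "x \<in> carrier M"
    show "s x \<in> carrier E" by (simp add: s_def E.smult_closed u_closed pick x)
    fix y assume y: "y \<in> carrier M"
    have "s (x \<oplus>\<^bsub>M\<^esub> y) = u \<odot>\<^bsub>E\<^esub> (pick x \<oplus>\<^bsub>E\<^esub> pick y)"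
      by (rule s_eq) (simp_all add: g_add pick x y)
    then show "s (x \<oplus>\<^bsub>M\<^esub> y) = s x \<oplus>\<^bsub>E\<^esub> s y"
      by (simp add: s_def E.smult_r_distr u_closed pick x y)
  next
    fix a :: "'k dist" and x assume a: "a \<in> carrier (Dist vs)" and x: "x \<in> carrier M"
    have "s (a \<odot>\<^bsub>M\<^esub> x) = u \<odot>\<^bsub>E\<^esub> (a \<odot>\<^bsub>E\<^esub> pick x)"
      by (rule s_eq) (simp_all add: g_smult pick a x E.smult_closed)
    then show "s (a \<odot>\<^bsub>M\<^esub> x) = a \<odot>\<^bsub>E\<^esub> s x"
      by (simp add: s_def pick x a u_closed u_central flip: E.smult_assoc)
  next
    fix p x assume x: "x \<in> mod_part M p"
    then have xM: "x \<in> carrier M" by (rule M.mod_part_closed)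
    obtain e e' where e: "e \<in> mod_part E p" "e' \<in> mod_part E (\<not> p)" "pick x = e \<oplus>\<^bsub>E\<^esub> e'"
      using E.part_decomp[OF pick(1)[OF xM]] by metis
    have "x \<oplus>\<^bsub>M\<^esub> \<zero>\<^bsub>M\<^esub> = g e \<oplus>\<^bsub>M\<^esub> g e'"
      using pick(2)[OF xM] xM e E.mod_part_closed by (simp add: g_add)
    \<comment> \<open>The chosen preimage need not be homogeneous. By uniqueness of components in M
      its part e of parity p already maps to x, so e may replace it.\<close>
    then have "x = g e"
      using M.part_decomp_unique(1)[OF x _ g_part[OF e(1)] g_part[OF e(2)]]
        additive_subgroup.zero_closed[OF M.part_subgroup] by blast
    then have "s x = u \<odot>\<^bsub>E\<^esub> e"
      using e E.mod_part_closed by (intro s_eq) auto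
    then show "s x \<in> mod_part E p"
      using u_part[OF e(1)] by simp
  qed
  moreover have "g (s x) = x" if "x \<in> carrier M" for x
    using that by (simp add: s_def g_smult u_closed pick uM)
  ultimately show ?thesis
    unfolding splits_def by blast
qed

text \<open>A nonsplit extension witnesses the nonvanishing, possibly with the parity shift of L' as
  submodule; z acts by d on either version, so c \<noteq> d would contradict
  \<open>extension_splits\<close>.\<close>

lemma Ext1_eigenvalue:
  fixes L :: "('k::field dist, 'a) supermodule" and L' :: "('k dist, 'b) supermodule"
  assumes L: "highest_weight_vector vs L v lam" and L': "highest_weight_vector vs L' v' mu"
    and ext: "\<not> Ext1_vanishes TYPE('e) vs L L'"
    and z: "central vs z" "z \<in> int_form vs" "z \<in> free_part vs False"
    and acts: "acts vs L v z c" "acts vs L' v' z d"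
  shows "c = d"
proof (rule ccontr)
  assume cd: "c \<noteq> d"
  obtain N' and E :: "('k dist, 'e) supermodule" and f g where
    N': "N' = L' \<or> N' = parity_shift L'" and inO: "in_O vs N'" "in_O vs E" "in_O vs L"
    and ex: "short_exact (Dist vs) N' f E g L" and ns: "\<not> splits (Dist vs) E g L"
    using ext unfolding Ext1_vanishes_def by blast
  interpret L: highest_weight_vector vs L v lam by (rule L)
  interpret L': highest_weight_vector vs L' v' mu by (rule L')
  have "acts vs N' n z d" if "n \<in> carrier N'" for n
    using N' that acts_parity_shift[OF L'.left_supermodule_axioms, of z d n]
      L'.central_acts[OF z(1,2) acts(2)] by auto
  then have "splits (Dist vs) E g L"
    using inO ex z cd L.central_acts[OF z(1,2) acts(1)]
    by (intro extension_splits[where N = N' and c = c and d = d and z = z]) (auto simp: in_O_def)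
  then show False using ns by simp
qed

section \<open>Generating functions of the eigenvalues\<close>

lemma fact_dvd_falling: "fact r dvd (\<Prod>t = 0..<r. z - int t)"
  using fact_dvd_pochhammer[of r "z - int r + 1"] by (simp add: falling_fact_pochhammer')

text \<open>Exactness of the division gives access to \<open>gbinomial\<close> over the rationals,
  from which identities such as Vandermonde's are pulled back to the integers.\<close>

lemma of_int_int_binom: "(of_int (int_binom z r) :: rat) = of_int z gchoose r"
  by (simp add: int_binom_def gbinomial_prod_rev fact_dvd_falling of_int_div)

lemma int_binom_0 [simp]: "int_binom z 0 = 1"
  by (simp add: int_binom_def)

lemma int_binom_Vandermonde: "(\<Sum>j \<le> r. int_binom a (r - j) * int_binom b j) = int_binom (a + b) r"
proof -
  have "(of_int (\<Sum>j \<le> r. int_binom a (r - j) * int_binom b j) :: rat) = of_int (int_binom (a + b) r)"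
    using gbinomial_Vandermonde[of "of_int b :: rat" "of_int a" r]
    by (simp add: of_int_int_binom atLeast0AtMost mult.commute add.commute)
  then show ?thesis
    by (simp only: of_int_eq_iff)
qed

lemma int_binom_self: "int_binom (int d) d = 1"
proof -
  have "(of_int (int_binom (int d) d) :: rat) = of_int 1"
    using binomial_gbinomial[of d d, where 'a = rat] by (simp add: of_int_int_binom)
  then show ?thesis by (simp only: of_int_eq_iff)
qed

text \<open>The series B and D are (1 + X)^b and (1 + X)^d over \<open>k\<close>. Vandermonde turns
  the assumption into B D = B; as B is nonzero, D = 1, although the coefficient of X^d in D is
  binom(d, d) = 1. The argument holds in every characteristic and thus recovers integers, not just
  residues.\<close>

lemma int_binom_separates_aux:
  assumes "d > 0" "\<And>r. (of_int (int_binom (b + int d) r) :: 'k::field) = of_int (int_binom b r)"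
  shows False
proof -
  define B where "B = Abs_fps (\<lambda>r. of_int (int_binom b r) :: 'k)"
  define D where "D = Abs_fps (\<lambda>r. of_int (int_binom (int d) r) :: 'k)"
  have "B * D = B"
  proof (rule fps_ext)
    fix r
    have "(\<Sum>j = 0..r. int_binom b j * int_binom (int d) (r - j)) = int_binom (b + int d) r"
      using int_binom_Vandermonde[of "int d" r b] by (simp add: atLeast0AtMost mult.commute add.commute)
    then show "(B * D) $ r = B $ r"
      using assms(2)[of r]
      by (simp add: fps_mult_nth B_def D_def flip: of_int_mult of_int_sum)
  qed
  moreover have "B $ 0 \<noteq> 0" by (simp add: B_def)
  then have "B \<noteq> 0" by auto
  ultimately have "D = 1" by simp
  then have "D $ d = 0" using assms(1) by simp
  then show False by (simp add: D_def int_binom_self)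
qed

lemma int_binom_separates:
  assumes "\<And>r. (of_int (int_binom a r) :: 'k::field) = of_int (int_binom b r)"
  shows "a = b"
proof (rule ccontr)
  assume "a \<noteq> b"
  then consider "a > b" | "b > a" by linarith
  then show False
  proof cases
    case 1
    then show False
      using int_binom_separates_aux[of "nat (a - b)" b, where 'k = 'k] assms by simp
  next
    case 2
    then show False
      using int_binom_separates_aux[of "nat (b - a)" a, where 'k = 'k] assms by simp
  qed
qed

lemma Heig_eq: "Heig lam l r = int_binom (\<Sum>i = 1..l. Poly_Mapping.lookup lam i) r"
proof (induction l arbitrary: r)
  case 0
  have "int_binom 0 r = 0" if "r > 0"
  proof -
    have "(\<Prod>t = 0..<r. 0 - int t) = 0"
      using that by (intro prod_zero) auto
    then show ?thesis by (simp only: int_binom_def div_0)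
  qed
  then show ?case by simp
next
  case (Suc l)
  then show ?case by (simp add: int_binom_Vandermonde)
qed

section \<open>The product formula for the Gelfand eigenvalues\<close>

definition Efps :: "bool list \<Rightarrow> weight \<Rightarrow> nat \<Rightarrow> 'k::field fps" where
  "Efps vs lam i = Abs_fps (\<lambda>r. of_int (Eeig vs lam r i))"

text \<open>At i = 0 this is the series 1 - sum_r chi_r t^(r+1) of the overview; the truncations to
  k > i are the stages of a telescoping product.\<close>

definition Ftail :: "bool list \<Rightarrow> weight \<Rightarrow> nat \<Rightarrow> 'k::field fps" where
  "Ftail vs lam i = 1 - fps_X * (\<Sum>k \<in> {k \<in> idx vs. i < k}. psgn (vbar vs k) * Efps vs lam k)"

abbreviation lin :: "'k::field \<Rightarrow> 'k fps" where
  "lin a \<equiv> 1 - fps_const a * fps_X"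

text \<open>The recursion of \<open>Eeig\<close> in generating function form: its subtracted tail is
  the sum inside \<open>Ftail\<close>, and the initial value 1 is the constant term.\<close>

lemma Efps_rec: "Efps vs lam i * lin (of_int (diag_entry vs lam i)) = (Ftail vs lam i :: 'k::field fps)"
proof -
  let ?K = "{k \<in> idx vs. i < k}"
  have "Efps vs lam i = 1 + fps_X * (fps_const (of_int (diag_entry vs lam i)) * Efps vs lam i
      - (\<Sum>k \<in> ?K. psgn (vbar vs k) * (Efps vs lam k :: 'k fps)))" (is "_ = ?R")
  proof (rule fps_ext)
    fix r
    have *: "(psgn b * f :: 'k fps) $ n = psgn b * f $ n" for b f n
      by (simp add: psgn_def)
    have "(of_int (psgn b) :: 'k) = psgn b" for b by (simp add: psgn_def)
    then show "Efps vs lam i $ r = ?R $ r"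
      by (cases r) (simp_all add: Efps_def fps_sum_nth *)
  qed
  then show ?thesis
    unfolding Ftail_def by (simp add: algebra_simps)
qed

text \<open>Passing from i to i - 1 subtracts t sigma_i Y_i, with Y_i the series \<open>Efps\<close>
  of index i. Multiplying by 1 - a_i t replaces Y_i(1 - a_i t) by \<open>Ftail vs lam i\<close>,
  which then factors out and leaves 1 - (a_i + sigma_i) t.\<close>

lemma Ftail_step:
  assumes "i > 0" "i \<in> idx vs"
  shows "Ftail vs lam (i - 1) * lin (of_int (diag_entry vs lam i)) =
    Ftail vs lam i * lin (of_int (diag_entry vs lam i + psgn (vbar vs i)) :: 'k::field)"
proof -
  have "{k \<in> idx vs. i - 1 < k} = insert i {k \<in> idx vs. i < k}"
    using assms by auto
  then have eq: "Ftail vs lam (i - 1) = Ftail vs lam i - fps_X * (psgn (vbar vs i) * Efps vs lam i :: 'k fps)"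
    by (simp add: Ftail_def algebra_simps)
  have "Ftail vs lam (i - 1) * l =
      Ftail vs lam i * l - fps_X * psgn (vbar vs i) * (Efps vs lam i * l)" for l :: "'k fps"
    unfolding eq by (simp add: algebra_simps)
  then have "Ftail vs lam (i - 1) * lin (of_int (diag_entry vs lam i)) =
      Ftail vs lam i * lin (of_int (diag_entry vs lam i) :: 'k)
      - fps_X * psgn (vbar vs i) * (Efps vs lam i * lin (of_int (diag_entry vs lam i)))" .
  also have "\<dots> = Ftail vs lam i * (lin (of_int (diag_entry vs lam i)) - fps_X * psgn (vbar vs i))"
    unfolding Efps_rec by (simp add: algebra_simps)
  also have "lin (of_int (diag_entry vs lam i)) - fps_X * psgn (vbar vs i) =
      lin (of_int (diag_entry vs lam i + psgn (vbar vs i)) :: 'k)"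
  proof -
    have "(psgn (vbar vs i) :: 'k fps) = fps_const (of_int (psgn (vbar vs i)))"
      by (simp add: psgn_def fps_const_neg[symmetric] del: fps_const_neg)
    then show ?thesis
      by (simp add: algebra_simps flip: fps_const_add)
  qed
  finally show ?thesis .
qed

text \<open>The steps telescope, starting from i = N. The denominators are multiplied out, so no
  inverses of power series occur.\<close>

lemma Ftail_0:
  "Ftail vs lam 0 * (\<Prod>i \<in> idx vs. lin (of_int (diag_entry vs lam i))) =
    (\<Prod>i \<in> idx vs. lin (of_int (diag_entry vs lam i + psgn (vbar vs i)) :: 'k::field))"
proof -
  let ?n = "length vs"
  let ?a = "\<lambda>i. lin (of_int (diag_entry vs lam i) :: 'k)"
  let ?A = "\<lambda>i. lin (of_int (diag_entry vs lam i + psgn (vbar vs i)) :: 'k)"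
  have "Ftail vs lam i * (\<Prod>k \<in> {i<..?n}. ?a k) = (\<Prod>k \<in> {i<..?n}. ?A k)" if "i \<le> ?n" for i
    using that
  proof (induction i rule: inc_induct)
    case base
    \<comment> \<open>No index exceeds N, so the last tail is 1.\<close>
    have "{k \<in> idx vs. ?n < k} = {}" by (auto simp: idx_def)
    then show ?case unfolding Ftail_def by (simp only:) simp
  next
    case (step i)
    have ins: "{i<..?n} = insert (Suc i) {Suc i<..?n}"
      using step by auto
    have "Ftail vs lam i * (\<Prod>k \<in> {i<..?n}. ?a k) =
        (Ftail vs lam i * ?a (Suc i)) * (\<Prod>k \<in> {Suc i<..?n}. ?a k)"
      unfolding ins by (simp add: mult_ac)
    also have "Ftail vs lam i * ?a (Suc i) = Ftail vs lam (Suc i) * ?A (Suc i)"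
      using Ftail_step[of "Suc i" vs lam] step by (simp add: idx_def)
    also have "\<dots> * (\<Prod>k \<in> {Suc i<..?n}. ?a k) = (\<Prod>k \<in> {i<..?n}. ?A k)"
      unfolding ins using step.IH by (simp add: mult_ac)
    finally show ?case .
  qed
  from this[of 0] show ?thesis
    by (simp add: idx_def atLeastSucAtMost_greaterThanAtMost[symmetric] del: of_int_add)
qed

section \<open>Recovering linear factors from their product\<close>

lemma reflect_poly_inj:
  assumes "reflect_poly p = reflect_poly q" "degree p = degree q"
  shows "p = q"
proof (rule poly_eqI)
  fix n
  show "coeff p n = coeff q n"
  proof (cases "n \<le> degree p")
    case True
    then have "coeff (reflect_poly p) (degree p - n) = coeff p n"
      "coeff (reflect_poly q) (degree p - n) = coeff q n"
      using assms(2) by (auto simp: coeff_reflect_poly)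
    then show ?thesis using assms(1) by simp
  next
    case False
    then show ?thesis using assms(2) by (simp add: coeff_eq_0)
  qed
qed

text \<open>The product is the reflection of the monic polynomial with roots a_i. A root 0 gives the
  factor 1 and is invisible in the product; it is recovered because both sides have the same number
  of factors, hence polynomials of equal degree. Counting roots as a multiset gives integer
  multiplicities in every characteristic.\<close>

lemma prod_lin_inj:
  fixes a b :: "'i \<Rightarrow> 'k::field"
  assumes "finite I" "(\<Prod>i \<in> I. lin (a i)) = (\<Prod>i \<in> I. lin (b i))"
  shows "(\<Sum>i \<in> I. of_bool (a i = c) :: int) = (\<Sum>i \<in> I. of_bool (b i = c))"
proof -
  define P where "P a = (\<Prod>i \<in> I. [:- a i, 1:])" for a :: "'i \<Rightarrow> 'k"
  have lin: "lin x = fps_of_poly (reflect_poly [:- x, 1:])" for x :: 'k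
    by (simp add: reflect_poly_def fps_of_poly_linear')
  have fps: "(\<Prod>i \<in> I. lin (a i)) = fps_of_poly (reflect_poly (P a))" for a :: "'i \<Rightarrow> 'k"
    unfolding P_def lin reflect_poly_prod fps_of_poly_prod ..
  have deg: "degree (P a) = card I" for a
    unfolding P_def by (subst degree_prod_eq_sum_degree) auto
  have "fps_of_poly (reflect_poly (P a)) = fps_of_poly (reflect_poly (P b))"
    using assms(2) unfolding fps .
  then have "P a = P b"
    unfolding fps_of_poly_eq_iff by (rule reflect_poly_inj) (simp add: deg)
  moreover have "int (count (proots (P a)) c) = (\<Sum>i \<in> I. of_bool (a i = c))" for a
  proof -
    have "proots (P a) = (\<Sum>i \<in> I. {#a i#})"
      unfolding P_def by (subst proots_prod) auto
    then show ?thesis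
      by (simp add: count_sum) (rule sum.cong, auto)
  qed
  ultimately show ?thesis by metis
qed

lemma Gelfand_eigenvalues_eq:
  assumes "\<And>r. (of_int (\<Sum>i \<in> idx vs. psgn (vbar vs i) * Eeig vs lam r i) :: 'k::field) =
      of_int (\<Sum>i \<in> idx vs. psgn (vbar vs i) * Eeig vs mu r i)"
  shows "(Ftail vs lam 0 :: 'k fps) = Ftail vs mu 0"
proof -
  have idx: "{k \<in> idx vs. 0 < k} = idx vs" by (auto simp: idx_def)
  have *: "(psgn b * f :: 'k fps) $ n = of_int (psgn b) * f $ n" for b f n
    by (simp add: psgn_def)
  have "(\<Sum>k \<in> idx vs. psgn (vbar vs k) * (Efps vs nu k :: 'k fps)) $ r =
      of_int (\<Sum>i \<in> idx vs. psgn (vbar vs i) * Eeig vs nu r i)" for nu r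
    by (simp add: fps_sum_nth * Efps_def)
  then have "(\<Sum>k \<in> idx vs. psgn (vbar vs k) * (Efps vs lam k :: 'k fps)) =
      (\<Sum>k \<in> idx vs. psgn (vbar vs k) * Efps vs mu k)"
    using assms by (intro fps_ext) simp
  then show ?thesis by (simp add: Ftail_def idx)
qed

section \<open>Comparison of weights\<close>

definition shifted :: "bool list \<Rightarrow> weight \<Rightarrow> nat \<Rightarrow> int" where
  "shifted vs lam i = bform vs (lam + rho vs) (eps i)"

text \<open>Descending induction from the prescribed value at N. Moving from i + 1 to i changes the
  right side by sigma_(i+1) + [v_i even] - [v_(i+1) even], which is 1, -1 or 0 exactly as rho
  prescribes.\<close>

lemma bform_rho_eps:
  assumes "1 \<le> i" "i \<le> length vs"
  shows "bform vs (rho vs) (eps i) =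
    (\<Sum>k \<in> {k \<in> idx vs. i < k}. psgn (vbar vs k)) + (if vbar vs i then 0 else 1)"
  using assms(2,1)
proof (induction i rule: inc_induct)
  case base
  have "{k \<in> idx vs. length vs < k} = {}" by (auto simp: idx_def)
  then have "(\<Sum>k \<in> {k \<in> idx vs. length vs < k}. psgn (vbar vs k)) = (0 :: int)"
    by (simp only: sum.empty)
  moreover have "vs \<noteq> []" using base by auto
  ultimately show ?case using is_rho_rho[of vs] by (simp add: is_rho_def)
next
  case (step i)
  let ?S = "\<lambda>i. \<Sum>k \<in> {k \<in> idx vs. i < k}. psgn (vbar vs k) :: int"
  have "{k \<in> idx vs. i < k} = insert (Suc i) {k \<in> idx vs. Suc i < k}"
    using step by (auto simp: idx_def)
  then have "?S i = psgn (vbar vs (Suc i)) + ?S (Suc i)"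
    by simp
  moreover have "bform vs (rho vs) (eps i) - bform vs (rho vs) (eps (Suc i)) =
      (if vbar vs i \<noteq> vbar vs (Suc i) then 0 else if vbar vs i then - 1 else 1)"
  proof -
    have "bform vs (rho vs) (eps i - eps (i + 1)) =
        (if vbar vs i \<noteq> vbar vs (i + 1) then 0 else if vbar vs i then - 1 else 1)"
      using is_rho_rho[of vs] step unfolding is_rho_def by blast
    then show ?thesis by (simp add: bform_diff_right)
  qed
  moreover have "bform vs (rho vs) (eps (Suc i)) = ?S (Suc i) + (if vbar vs (Suc i) then 0 else 1)"
    using step by simp
  ultimately show ?case
    unfolding psgn_def by (cases "vbar vs i"; cases "vbar vs (Suc i)") simp_all
qed

lemma shifted_eq_bform:
  assumes "i \<in> idx vs"
  shows "shifted vs lam i = psgn (vbar vs i) * Poly_Mapping.lookup lam i + bform vs (rho vs) (eps i)"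
  using bform_eps[OF assms] by (simp add: shifted_def lookup_add algebra_simps)

text \<open>For even i the shifted entry is a_i + sigma_i, the parameter of the zero; for odd i it
  is a_i, the parameter of the pole. The other parameter of the factor is smaller by 1 in both
  cases.\<close>

lemma shifted_eq_diag_entry:
  "i \<in> idx vs \<Longrightarrow> shifted vs lam i = diag_entry vs lam i + (if vbar vs i then 0 else 1)"
  by (simp add: shifted_eq_bform bform_rho_eps diag_entry_def idx_def)

text \<open>Indexing by elements of \<open>k\<close> treats integers (p = 0) and residues modulo p
  (p > 0) at once.\<close>

definition signed_count :: "bool list \<Rightarrow> weight \<Rightarrow> 'k::field \<Rightarrow> int" where
  "signed_count vs lam c = (\<Sum>i \<in> idx vs. psgn (vbar vs i) * of_bool (of_int (shifted vs lam i) = c))"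

text \<open>The right side is zeros minus poles with parameter c. With s the shifted entry of index
  i, the factor of i contributes sigma_i([s = c] - [s = c + 1]).\<close>

lemma signed_count_diff:
  "signed_count vs lam (c :: 'k::field) - signed_count vs lam (c + 1) =
    (\<Sum>i \<in> idx vs. of_bool (of_int (diag_entry vs lam i + psgn (vbar vs i)) = c))
    - (\<Sum>i \<in> idx vs. of_bool (of_int (diag_entry vs lam i) = c))"
proof -
  have *: "x - 1 = c \<longleftrightarrow> x = c + 1" "x + 1 = c + 1 \<longleftrightarrow> x = c" for x :: 'k
    by auto
  show ?thesis
    unfolding signed_count_def sum_subtractf[symmetric] right_diff_distrib[symmetric]
    by (intro sum.cong refl) (auto simp: shifted_eq_diag_entry psgn_def *)
qed

text \<open>Equal rational functions are compared by cross-multiplication: zeros for lambda with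
  poles for mu against zeros for mu with poles for lambda. Comparing multiplicities at c gives the
  identity.\<close>

lemma signed_count_step:
  assumes "(Ftail vs lam 0 :: 'k::field fps) = Ftail vs mu 0"
  shows "signed_count vs lam (c :: 'k) - signed_count vs lam (c + 1) =
    signed_count vs mu c - signed_count vs mu (c + 1)"
proof -
  let ?a = "\<lambda>nu i. of_int (diag_entry vs nu i) :: 'k"
  let ?A = "\<lambda>nu i. of_int (diag_entry vs nu i + psgn (vbar vs i)) :: 'k"
  let ?P = "\<lambda>f. \<Prod>i \<in> idx vs. lin (f i :: 'k)"
  let ?S = "\<lambda>f. \<Sum>i \<in> idx vs. of_bool (f i = c) :: int"
  \<comment> \<open>The disjoint sum of two copies of the index set presents each cross product as
    one family of linear factors.\<close>
  have plus: "(\<Prod>i \<in> idx vs <+> idx vs. lin (case_sum f g i)) = ?P f * ?P g"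
    "(\<Sum>i \<in> idx vs <+> idx vs. of_bool (case_sum f g i = c)) = ?S f + ?S g" for f g
    by (simp_all only: prod.Plus sum.Plus finite_idx o_def sum.case)
  have "?P (?A lam) * ?P (?a mu) = Ftail vs lam 0 * ?P (?a lam) * ?P (?a mu)"
    by (simp only: Ftail_0)
  also have "\<dots> = (Ftail vs mu 0 * ?P (?a mu)) * ?P (?a lam)"
    unfolding assms by (simp only: mult_ac)
  also have "\<dots> = ?P (?A mu) * ?P (?a lam)"
    by (simp only: Ftail_0)
  finally have "?S (?A lam) + ?S (?a mu) = ?S (?A mu) + ?S (?a lam)"
    using prod_lin_inj[of "idx vs <+> idx vs" "case_sum (?A lam) (?a mu)" "case_sum (?A mu) (?a lam)" c]
    unfolding plus by simp
  then show ?thesis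
    unfolding signed_count_diff by linarith
qed

lemma of_int_eq_iff_CHAR: "(of_int x :: 'k::field) = of_int y \<longleftrightarrow> int CHAR('k) dvd x - y"
  using of_int_eq_0_iff_char_dvd[of "x - y", where 'a = 'k] by simp

text \<open>The condition on Z says that, as far as the values of h can tell, Z represents the
  residue class of every shifted entry exactly once. Exchanging the sums then turns a sum over
  residues into a sum over indices.\<close>

lemma sum_signed_count:
  assumes Z: "finite Z"
    and h: "\<And>i. i \<in> idx vs \<Longrightarrow> (\<Sum>z \<in> Z. h z * of_bool ((of_int (shifted vs lam i) :: 'k::field) = of_int z))
      = h (shifted vs lam i)"
  shows "(\<Sum>z \<in> Z. h z * signed_count vs lam (of_int z :: 'k)) =
    (\<Sum>i \<in> idx vs. psgn (vbar vs i) * h (shifted vs lam i))"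
proof -
  have "(\<Sum>z \<in> Z. h z * signed_count vs lam (of_int z :: 'k)) = (\<Sum>i \<in> idx vs. psgn (vbar vs i)
      * (\<Sum>z \<in> Z. h z * of_bool ((of_int (shifted vs lam i) :: 'k) = of_int z)))"
    unfolding signed_count_def sum_distrib_left by (subst sum.swap) (simp add: mult_ac)
  then show ?thesis by (simp add: h)
qed

lemma sum_residues:
  assumes p: "CHAR('k::field) > 0" and h: "\<And>x y. (of_int x :: 'k) = of_int y \<Longrightarrow> h x = (h y :: int)"
  shows "(\<Sum>z \<in> {0..<int CHAR('k)}. h z * of_bool ((of_int b :: 'k) = of_int z)) = h b"
proof -
  let ?p = "int CHAR('k)"
  have "z = b mod ?p" if "0 \<le> z" "z < ?p" "?p dvd b - z" for z
    using that by (metis mod_eq_dvd_iff mod_pos_pos_trivial)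
  then have eq: "(of_int b :: 'k) = of_int z \<longleftrightarrow> z = b mod ?p" if "z \<in> {0..<?p}" for z
    using that unfolding of_int_eq_iff_CHAR by (auto simp: mod_eq_dvd_iff[symmetric])
  have "(\<Sum>z \<in> {0..<?p}. h z * of_bool ((of_int b :: 'k) = of_int z)) =
      (\<Sum>z \<in> {0..<?p}. if z = b mod ?p then h z else 0)"
    using eq by (intro sum.cong) auto
  also have "\<dots> = h (b mod ?p)"
    using p by simp
  also have "\<dots> = h b"
    by (rule h) (simp add: of_int_eq_iff_CHAR mod_eq_dvd_iff[symmetric])
  finally show ?thesis .
qed

text \<open>
  By \<open>signed_count_step\<close> the difference of the two signed counts is constant on the prime field;
  it vanishes for large arguments if \<open>p = 0\<close>, and sums to zero over the prime field if \<open>p > 0\<close>.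
\<close>

lemma signed_count_eq:
  assumes F: "(Ftail vs lam 0 :: 'k::field fps) = Ftail vs mu 0"
  shows "signed_count vs lam (of_int z :: 'k) = signed_count vs mu (of_int z :: 'k)"
proof -
  define D where "D z = signed_count vs lam (of_int z :: 'k) - signed_count vs mu (of_int z :: 'k)" for z
  have step: "D (z + 1) = D z" for z
    using signed_count_step[OF F, of "of_int z"] unfolding D_def of_int_add of_int_1 by linarith
  have const: "D z = D 0" for z
  proof (induction z rule: int_induct[of _ 0])
    case (step1 i)
    then show ?case using step[of i] by simp
  next
    case (step2 i)
    then show ?case using step[of "i - 1"] by simp
  qed simp
  have "D 0 = 0"
  proof (cases "CHAR('k) = 0")
    case True
    let ?B = "shifted vs lam ` idx vs \<union> shifted vs mu ` idx vs"
    obtain z where z: "z \<notin> ?B"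
      using ex_new_if_finite[OF infinite_UNIV_int, of ?B] by auto
    then have "signed_count vs nu (of_int z :: 'k) = 0" if "nu \<in> {lam, mu}" for nu
      using that True unfolding signed_count_def
      by (intro sum.neutral) (auto simp: of_int_eq_iff_CHAR)
    then have "D z = 0" by (simp add: D_def)
    then show ?thesis using const[of z] by simp
  next
    case False
    then have p: "CHAR('k) > 0" by simp
    \<comment> \<open>For either weight the signed counts of all residues add up to the sum of the
      sigma_i. Hence p times the constant difference is 0 as an integer.\<close>
    have "(\<Sum>z \<in> {0..<int CHAR('k)}. 1 * signed_count vs nu (of_int z :: 'k)) =
        (\<Sum>i \<in> idx vs. psgn (vbar vs i) * 1)" for nu
      by (rule sum_signed_count) (simp_all add: sum_residues[OF p, where h = "\<lambda>_. 1", simplified])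
    then have "(\<Sum>z \<in> {0..<int CHAR('k)}. D z) = 0"
      by (simp add: D_def sum_subtractf)
    then have "(\<Sum>z \<in> {0..<int CHAR('k)}. D 0) = 0"
      by (subst (asm) const)
    then show ?thesis using p by simp
  qed
  then show ?thesis
    using const[of z] by (simp add: D_def)
qed

text \<open>Equality of the signed counts in the form that is applied: signed sums of any integer
  function that is constant on residue classes agree. If p = 0 the condition on h is
  vacuous.\<close>

lemma sum_shifted_eq:
  assumes F: "(Ftail vs lam 0 :: 'k::field fps) = Ftail vs mu 0"
    and h: "\<And>x y. (of_int x :: 'k) = of_int y \<Longrightarrow> h x = (h y :: int)"
  shows "(\<Sum>i \<in> idx vs. psgn (vbar vs i) * h (shifted vs lam i)) =
    (\<Sum>i \<in> idx vs. psgn (vbar vs i) * h (shifted vs mu i))"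
proof -
  \<comment> \<open>A finite set with one representative of every class that matters: all residues
    if p > 0, the occurring integers if p = 0.\<close>
  define Z where "Z = (if CHAR('k) = 0 then shifted vs lam ` idx vs \<union> shifted vs mu ` idx vs
    else {0..<int CHAR('k)})"
  have "finite Z" by (simp add: Z_def)
  have "(\<Sum>z \<in> Z. h z * of_bool ((of_int (shifted vs nu i) :: 'k) = of_int z)) = h (shifted vs nu i)"
    if "nu \<in> {lam, mu}" "i \<in> idx vs" for nu i
  proof (cases "CHAR('k) = 0")
    case True
    have "(\<Sum>z \<in> Z. h z * of_bool ((of_int (shifted vs nu i) :: 'k) = of_int z)) =
        (\<Sum>z \<in> Z. if z = shifted vs nu i then h z else 0)"
      using True by (intro sum.cong) (auto simp: of_int_eq_iff_CHAR)
    then show ?thesis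
      using \<open>finite Z\<close> that True by (auto simp: Z_def)
  next
    case False
    then show ?thesis
      using sum_residues[where 'k = 'k and h = h, OF _ h] by (simp add: Z_def)
  qed
  then have "(\<Sum>z \<in> Z. h z * signed_count vs nu (of_int z :: 'k)) =
      (\<Sum>i \<in> idx vs. psgn (vbar vs i) * h (shifted vs nu i))" if "nu \<in> {lam, mu}" for nu
    using that \<open>finite Z\<close> by (intro sum_signed_count) auto
  from this[of lam] this[of mu] show ?thesis
    by (simp add: signed_count_eq[OF F])
qed

lemma lookup_wt:
  "Poly_Mapping.lookup (wt p vs lam) g =
    (\<Sum>i \<in> idx vs. psgn (vbar vs i) * Poly_Mapping.lookup (gam p (shifted vs lam i)) g)"
  by (simp add: wt_def lookup_sum shifted_def)

text \<open>Coefficients are compared one generator at a time. All of them except that of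
  \<open>Delta\<close> depend on the shifted entry only through its residue class, so
  \<open>F\<close> settles them; \<open>Delta\<close> also needs \<open>total\<close>.\<close>

lemma wt_eq:
  assumes F: "(Ftail vs lam 0 :: 'k::field fps) = Ftail vs mu 0"
    and total: "(\<Sum>i \<in> idx vs. Poly_Mapping.lookup lam i) = (\<Sum>i \<in> idx vs. Poly_Mapping.lookup mu i)"
  shows "wt CHAR('k) vs lam = wt CHAR('k) vs mu"
proof (rule poly_mapping_eqI)
  fix g
  let ?p = "int CHAR('k)"
  let ?h = "\<lambda>b. Poly_Mapping.lookup (gam CHAR('k) b) g"
  let ?wt = "\<lambda>nu. Poly_Mapping.lookup (wt CHAR('k) vs nu) g"
  have periodic: "?wt lam = ?wt mu" if "\<And>x y. (of_int x :: 'k) = of_int y \<Longrightarrow> ?h x = ?h y"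
    using sum_shifted_eq[OF F, where h = ?h, OF that] by (simp add: lookup_wt)
  show "Poly_Mapping.lookup (wt CHAR('k) vs lam) g = Poly_Mapping.lookup (wt CHAR('k) vs mu) g"
  proof (cases "CHAR('k) = 0")
    case True
    then show ?thesis by (intro periodic) (simp add: of_int_eq_iff_CHAR)
  next
    case False
    then have p: "?p > 0" by simp
    have per: "(x - 1) mod ?p = (y - 1) mod ?p" if "(of_int x :: 'k) = of_int y" for x y
      using that unfolding of_int_eq_iff_CHAR by (simp add: mod_eq_dvd_iff)
    show ?thesis
    proof (cases "g = Delta")
      case False
      then have eq: "?h b = (\<lambda>s. Poly_Mapping.lookup
          (frag_of (Lambda (s mod ?p)) - frag_of (Lambda ((s - 1) mod ?p))) g) ((b - 1) mod ?p + 1)" for b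
        using p by (simp add: gam_def Let_def lookup_minus)
      show ?thesis
      proof (rule periodic)
        fix x y
        assume "(of_int x :: 'k) = of_int y"
        from per[OF this] show "?h x = ?h y"
          unfolding eq by (rule arg_cong)
      qed
    next
      case True
      \<comment> \<open>The coefficient is -((b - 1) div p); multiplied by p it is a periodic
        function minus b. The signed sum of the periodic part is fixed by \<open>F\<close>, that of
        b = (lambda + rho, eps_i) by \<open>total\<close>, since sigma_i sigma_i = 1.\<close>
      have h: "?p * ?h b = 1 + (b - 1) mod ?p - b" for b
      proof -
        have "?h b = - ((b - 1) div ?p)"
          using p True by (simp add: gam_def Let_def lookup_minus)
        then have "?p * ?h b = - (?p * ((b - 1) div ?p))" by simp
        then show ?thesis
          using mult_div_mod_eq[of ?p "b - 1"] by linarith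
      qed
      have "?p * ?wt nu = (\<Sum>i \<in> idx vs. psgn (vbar vs i) * (1 + (shifted vs nu i - 1) mod ?p))
          - (\<Sum>i \<in> idx vs. psgn (vbar vs i) * shifted vs nu i)" for nu
      proof -
        have "?p * ?wt nu = (\<Sum>i \<in> idx vs. psgn (vbar vs i) * (?p * ?h (shifted vs nu i)))"
          by (simp add: lookup_wt sum_distrib_left mult_ac)
        then show ?thesis
          by (simp only: h right_diff_distrib sum_subtractf)
      qed
      moreover have "(\<Sum>i \<in> idx vs. psgn (vbar vs i) * (1 + (shifted vs lam i - 1) mod ?p)) =
          (\<Sum>i \<in> idx vs. psgn (vbar vs i) * (1 + (shifted vs mu i - 1) mod ?p))"
        by (rule sum_shifted_eq[OF F, where h = "\<lambda>b. 1 + (b - 1) mod ?p"]) (drule per, simp)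
      moreover have "(\<Sum>i \<in> idx vs. psgn (vbar vs i) * shifted vs nu i) = (\<Sum>i \<in> idx vs.
          Poly_Mapping.lookup nu i) + (\<Sum>i \<in> idx vs. psgn (vbar vs i) * bform vs (rho vs) (eps i))" for nu
        by (simp add: shifted_eq_bform distrib_left sum.distrib flip: mult.assoc)
      ultimately have "?p * ?wt lam = ?p * ?wt mu"
        using total by simp
      then show ?thesis using p by simp
    qed
  qed
qed

theorem theorem2p3:
  fixes m n :: nat
    and vs :: "bool list"
    and lam mu :: weight
    and L :: "('k::field dist, 'a) supermodule"
    and L' :: "('k dist, 'b) supermodule"
  assumes "count_list vs False = m" and "count_list vs True = n"
    and "lam \<in> XT vs" and "mu \<in> XT vs"
    and "is_L vs lam L" and "is_L vs mu L'"
    and "\<not> Ext1_vanishes TYPE('e) vs L L'"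
  shows "wt CHAR('k) vs lam = wt CHAR('k) vs mu"
proof -
  obtain v where v: "highest_weight_vector vs L v lam"
    using is_L_highest_weight_vector[OF assms(5)] .
  obtain v' where v': "highest_weight_vector vs L' v' mu"
    using is_L_highest_weight_vector[OF assms(6)] .
  interpret L: highest_weight_vector vs L v lam by (rule v)
  interpret L': highest_weight_vector vs L' v' mu by (rule v')
  note eigenvalue = Ext1_eigenvalue[OF v v' assms(7)]
  have "(of_int (\<Sum>i \<in> idx vs. psgn (vbar vs i) * Eeig vs lam r i) :: 'k) =
      of_int (\<Sum>i \<in> idx vs. psgn (vbar vs i) * Eeig vs mu r i)" for r
    by (rule eigenvalue[OF central_Gelfand int_form_Gelfand Gelfand_even L.acts_Gelfand L'.acts_Gelfand])
  then have F: "(Ftail vs lam 0 :: 'k fps) = Ftail vs mu 0"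
    by (rule Gelfand_eigenvalues_eq)
  have "(of_int (Heig lam (length vs) r) :: 'k) = of_int (Heig mu (length vs) r)" for r
    by (rule eigenvalue[OF central_Hbin int_form_Hbin[OF order_refl] Hbin_even[OF order_refl]
          L.acts_Hbin[OF order_refl] L'.acts_Hbin[OF order_refl]])
  \<comment> \<open>The eigenvalues are the images in \<open>k\<close> of binom(S, r), r \<ge> 0,
    for S the sum of the coordinates, and together they determine the integer S.\<close>
  then have "(\<Sum>i \<in> idx vs. Poly_Mapping.lookup lam i) = (\<Sum>i \<in> idx vs. Poly_Mapping.lookup mu i)"
    unfolding Heig_eq idx_def by (rule int_binom_separates)
  with F show ?thesis by (rule wt_eq)
qed

end
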